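(* Let $O_1,\dots,O_n$ be independent copies of $O=(C,A,M_1,M_2,Y)\sim P\in\mathcal P$, with $\mathcal P$, the parameters $\Psi,\Psi_A,\Psi_{M_1},\Psi_{M_2},\Psi_{M_1,M_2}$ and the functions $D^*,D^*_A,D^*_{M_1},D^*_{M_2},D^*_{M_1,M_2}$ as in the context. Let $\psi_\cdot=(\Psi_A(P),\Psi_{M_1}(P),\Psi_{M_2}(P),\Psi_{M_1,M_2}(P))^\top$, let $D^*_\cdot(P)=(D^*_A(P),D^*_{M_1}(P),D^*_{M_2}(P),D^*_{M_1,M_2}(P))^\top$, and let $\psi_{n,\cdot}$ be the corresponding vector of one-step estimators, or the corresponding vector of targeted minimum loss estimators. Suppose that for each of the parameters $\Psi,\Psi_A,\Psi_{M_1},\Psi_{M_2}$ (generically $\Psi_\bullet$, with gradient $D^*_\bullet$ and with $P'_n$ the estimated distribution used in its estimator) the following regularity conditions hold: (i) $\Psi_\bullet$ is pathwise differentiable at $P$ with gradient $D^*_\bullet(P)\in L^2(P)$; (ii) $D^*_\bullet(P'_n)-D^*_\bullet(P)$ falls in a $P$-Donsker class with probability tending to one; (iii) $\int\{D^*_\bullet(P'_n)(o)-D^*_\bullet(P)(o)\}^2\,dP(o)=o_p(1)$; (iv) the second-order remainder $R_{2,\bullet}(P,P'_n)=\Psi_\bullet(P'_n)-\Psi_\bullet(P)+\int D^*_\bullet(P'_n)(o)\,dP(o)$ satisfies $R_{2,\bullet}(P,P'_n)=o_p(n^{-1/2})$. Then $$n^{1/2}(\psi_{n,\cdot}-\psi_\cdot)\;\to_d\;\mathrm{Normal}(0,\Sigma),\qquad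 \Sigma=\int D^*_\cdot(P)(o)\,D^*_\cdot(P)(o)^\top\,dP(o).$$
   Context: **Data and model.** $O=(C,A,M_1,M_2,Y)$, where $C\in\mathcal C$ is a vector of confounders, $A\in\{a,a^\star\}$ is a binary intervention, $M_1\in\mathcal M_1$ and $M_2\in\mathcal M_2$ are mediators, and $Y\in(0,1)$ is an outcome. For a distribution $P$ of $O$ and $a_0\in\{a,a^\star\}$: - $g_{a_0}(c)=\mathrm{pr}_P(A=a_0\mid C=c)$. - $\bar Q_{a_0}(m_1,m_2,c)=E_P(Y\mid A=a_0,M_1=m_1,M_2=m_2,C=c)$. - $Q_{a_0,M_1,M_2}(\cdot,\cdot\mid c)$ is the conditional joint distribution of $(M_1,M_2)$ given $A=a_0,C=c$, with density $q_{a_0,M_1,M_2}(\cdot,\cdot\mid c)$ with respect to a dominating (product) measure. - $Q_{a_0,M_j}(\cdot\mid c)$, $q_{a_0,M_j}(\cdot\mid c)$ are the corresponding marginals for $M_j$, $j=1,2$. - $Q_C$ is the marginal distribution of $C$. The model $\mathcal P$ consists of all $P$ with $\mathrm{pr}_P\{0<\mathrm{pr}_P(A=a\mid C)<1\}=1$ and, for $a_0=a,a^\star$, $\mathrm{pr}_P\{\inf_{(m_1,m_2)\in\mathcal M_1\times\mathcal M_2}q_{a_0,M_1,M_2}(m_1,m_2\mid C)>0\}=1$; no other assumptions are made. **Marginalized outcome regressions.** For $a_0\in\{a,a^\star\}$: - $\tilde Q_{a,M_1,M_2}(c)=\int\bar Q_a\,dQ_{a,M_1,M_2}(m_1,m_2\mid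 c)$. - $\tilde Q_{a_0,M_1^\star,M_2^\star}(c)=\int\bar Q_{a_0}\,dQ_{a^\star,M_1,M_2}(m_1,m_2\mid c)$. - $\tilde Q_{a,M_1\times M_2}(c)=\iint\bar Q_a\,dQ_{a,M_1}(m_1\mid c)dQ_{a,M_2}(m_2\mid c)$. - $\tilde Q_{a,M_1\times M_2^\star}(c)=\iint\bar Q_a\,dQ_{a,M_1}(m_1\mid c)dQ_{a^\star,M_2}(m_2\mid c)$. - $\tilde Q_{a,M_1^\star\times M_2^\star}(c)=\iint\bar Q_a\,dQ_{a^\star,M_1}(m_1\mid c)dQ_{a^\star,M_2}(m_2\mid c)$. - For $i\ne j$: $\tilde Q_{a,M_i}(m_j,c)=\int\bar Q_a\,dQ_{a,M_i}(m_i\mid c)$ and $\tilde Q_{a,M_i^\star}(m_j,c)=\int\bar Q_a\,dQ_{a^\star,M_i}(m_i\mid c)$. **Parameters** (all quantities on the right computed under the argument $P$): - $\Psi(P)=\int\{\tilde Q_{a,M_1,M_2}-\tilde Q_{a^\star,M_1^\star,M_2^\star}\}dQ_C$ (total effect). - $\Psi_A(P)=\int\{\tilde Q_{a,M_1^\star,M_2^\star}-\tilde Q_{a^\star,M_1^\star,M_2^\star}\}dQ_C$ (interventional direct effect). - $\Psi_{M_1}(P)=\int\{\tilde Q_{a,M_1\times M_2^\star}-\tilde Q_{a,M_1^\star\times M_2^\star}\}dQ_C$ (indirect effect through $M_1$). - $\Psi_{M_2}(P)=\int\{\tilde Q_{a,M_1\times M_2}-\tilde Q_{a,M_1\times M_2^\star}\}dQ_C$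 (indirect effect through $M_2$). - $\Psi_{M_1,M_2}=\Psi-\Psi_A-\Psi_{M_1}-\Psi_{M_2}$ (covariant effect). **Efficient influence functions.** With $\mathbf 1_{a_0}(\cdot)$ the indicator of the value $a_0$, $o=(c,\tilde a,m_1,m_2,y)$, and arguments of functions being the corresponding components of $o$: $$D^*(P)(o)=\tfrac{\mathbf 1_a(\tilde a)}{g_a(c)}\{y-\tilde Q_{a,M_1,M_2}(c)\}-\tfrac{\mathbf 1_{a^\star}(\tilde a)}{g_{a^\star}(c)}\{y-\tilde Q_{a^\star,M_1^\star,M_2^\star}(c)\}+\tilde Q_{a,M_1,M_2}(c)-\tilde Q_{a^\star,M_1^\star,M_2^\star}(c)-\Psi(P);$$ $$\begin{aligned}D_A^*(P)(o)&=\tfrac{\mathbf 1_a(\tilde a)}{g_a(c)}\tfrac{q_{a^\star,M_1,M_2}(m_1,m_2\mid c)}{q_{a,M_1,M_2}(m_1,m_2\mid c)}\{y-\bar Q_a(m_1,m_2,c)\}-\tfrac{\mathbf 1_{a^\star}(\tilde a)}{g_{a^\star}(c)}\{y-\bar Q_{a^\star}(m_1,m_2,c)\}\\&\quad+\tfrac{\mathbf 1_{a^\star}(\tilde a)}{g_{a^\star}(c)}[\bar Q_a(m_1,m_2,c)-\bar Q_{a^\star}(m_1,m_2,c)-\{\tilde Q_{a,M_1^\star,M_2^\star}(c)-\tilde Q_{a^\star,M_1^\star,M_2^\star}(c)\}]\\&\quad+\tilde Q_{a,M_1^\star,M_2^\star}(c)-\tilde Q_{a^\star,M_1^\star,M_2^\star}(c)-\Psi_A(P);\end{aligned}$$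 $$\begin{aligned}D_{M_1}^*(P)(o)&=\tfrac{\mathbf 1_a(\tilde a)}{g_a(c)}\tfrac{\{q_{a,M_1}(m_1\mid c)-q_{a^\star,M_1}(m_1\mid c)\}q_{a^\star,M_2}(m_2\mid c)}{q_{a,M_1,M_2}(m_1,m_2\mid c)}\{y-\bar Q_a(m_1,m_2,c)\}\\&\quad+\tfrac{\mathbf 1_a(\tilde a)}{g_a(c)}\{\tilde Q_{a,M_2^\star}(m_1,c)-\tilde Q_{a,M_1\times M_2^\star}(c)\}-\tfrac{\mathbf 1_{a^\star}(\tilde a)}{g_{a^\star}(c)}\{\tilde Q_{a,M_2^\star}(m_1,c)-\tilde Q_{a,M_1^\star\times M_2^\star}(c)\}\\&\quad+\tfrac{\mathbf 1_{a^\star}(\tilde a)}{g_{a^\star}(c)}[\tilde Q_{a,M_1}(m_2,c)-\tilde Q_{a,M_1^\star}(m_2,c)-\{\tilde Q_{a,M_1\times M_2^\star}(c)-\tilde Q_{a,M_1^\star\times M_2^\star}(c)\}]\\&\quad+\tilde Q_{a,M_1\times M_2^\star}(c)-\tilde Q_{a,M_1^\star\times M_2^\star}(c)-\Psi_{M_1}(P);\end{aligned}$$ $$\begin{aligned}D_{M_2}^*(P)(o)&=\tfrac{\mathbf 1_a(\tilde a)}{g_a(c)}\tfrac{\{q_{a,M_2}(m_2\mid c)-q_{a^\star,M_2}(m_2\mid c)\}q_{a,M_1}(m_1\mid c)}{q_{a,M_1,M_2}(m_1,m_2\mid c)}\{y-\bar Q_a(m_1,m_2,c)\}\\&\quad+\tfrac{\mathbf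 1_a(\tilde a)}{g_a(c)}\{\tilde Q_{a,M_1}(m_2,c)-\tilde Q_{a,M_1\times M_2}(c)\}-\tfrac{\mathbf 1_{a^\star}(\tilde a)}{g_{a^\star}(c)}\{\tilde Q_{a,M_1}(m_2,c)-\tilde Q_{a,M_1\times M_2^\star}(c)\}\\&\quad+\tfrac{\mathbf 1_a(\tilde a)}{g_a(c)}[\tilde Q_{a,M_2}(m_1,c)-\tilde Q_{a,M_2^\star}(m_1,c)-\{\tilde Q_{a,M_1\times M_2}(c)-\tilde Q_{a,M_1\times M_2^\star}(c)\}]\\&\quad+\tilde Q_{a,M_1\times M_2}(c)-\tilde Q_{a,M_1\times M_2^\star}(c)-\Psi_{M_2}(P);\end{aligned}$$ and $D^*_{M_1,M_2}=D^*-D^*_A-D^*_{M_1}-D^*_{M_2}$. **Estimators.** Let $P'_n$ denote a (data-dependent) distribution in $\mathcal P$ compatible with estimates of the nuisance parameters (propensity score, outcome regression, conditional joint mediator distribution), with the marginal distribution of $C$ estimated by the empirical distribution. - The one-step estimator of $\Psi_\bullet(P)$ is $\Psi_\bullet(P'_n)+n^{-1}\sum_{i=1}^nD^*_\bullet(P'_n)(O_i)$. - A targeted minimum loss estimator of $\Psi_\bullet(P)$ is a plug-in estimator $\Psi_\bullet(P'_n)$, where the initial nuisance estimates have been revised (targeted), possibly differently for different parameters, so that $n^{-1}\sum_{i=1}^nD^*_\bullet(P'_n)(O_i)=o_p(n^{-1/2})$. - In either case the estimator of the covariant effect is the estimator of the total effect minus the sum of the estimators of $\Psi_A(P)$, $\Psi_{M_1}(P)$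 and $\Psi_{M_2}(P)$. *)

theory Defs
  imports "HOL-Probability.Probability"
begin

section \<open>Stochastic convergence without measurability\<close>

text \<open>
  Empirical processes, viewed as maps into \<open>\<ell>\<^sup>\<infinity>(F)\<close>, are in general not Borel measurable, and
  nothing is assumed about measurability of data-dependent nuisance estimates.  All modes of
  convergence are therefore taken in the sense of Hoffmann-Jorgensen, with outer probabilities and
  outer expectations; for measurable maps they are the usual ones.
\<close>

definition tends_to_0_in_prob :: "'w measure \<Rightarrow> (nat \<Rightarrow> 'w \<Rightarrow> real) \<Rightarrow> bool" where
  "tends_to_0_in_prob M X \<longleftrightarrow>
     (\<forall>e>0. (\<lambda>n. outer_measure_of M {\<omega> \<in> space M. \<bar>X n \<omega>\<bar> > e}) \<longlonglongrightarrow> 0)"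

definition little_op :: "'w measure \<Rightarrow> (nat \<Rightarrow> 'w \<Rightarrow> real) \<Rightarrow> (nat \<Rightarrow> real) \<Rightarrow> bool" where
  "little_op M X r \<longleftrightarrow> tends_to_0_in_prob M (\<lambda>n \<omega>. X n \<omega> / r n)"

definition prob_tends_to_1 :: "'w measure \<Rightarrow> (nat \<Rightarrow> 'w \<Rightarrow> bool) \<Rightarrow> bool" where
  "prob_tends_to_1 M E \<longleftrightarrow> (\<lambda>n. outer_measure_of M {\<omega> \<in> space M. \<not> E n \<omega>}) \<longlonglongrightarrow> 0"

definition outer_expectation :: "'w measure \<Rightarrow> ('w \<Rightarrow> real) \<Rightarrow> real" where
  "outer_expectation M h =
     Inf {integral\<^sup>L M U | U. integrable M U \<and> (\<forall>\<omega>\<in>space M. h \<omega> \<le> U \<omega>)}"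

definition weakly_converges ::
  "'x topology \<Rightarrow> 'w measure \<Rightarrow> (nat \<Rightarrow> 'w \<Rightarrow> 'x) \<Rightarrow> 'x measure \<Rightarrow> bool" where
  "weakly_converges T M X L \<longleftrightarrow>
     (\<forall>h. continuous_map T euclideanreal h \<and> bounded (h ` topspace T) \<longrightarrow>
        (\<lambda>n. outer_expectation M (\<lambda>\<omega>. h (X n \<omega>))) \<longlonglongrightarrow> integral\<^sup>L L h)"

definition tight_borel_prob :: "'x topology \<Rightarrow> 'x measure \<Rightarrow> bool" where
  "tight_borel_prob T L \<longleftrightarrow>
     prob_space L \<and> space L = topspace T \<and> sets L = sigma_sets (topspace T) {U. openin T U} \<and>
     (\<forall>e>0. \<exists>K\<in>sets L. compactin T K \<and> measure L K \<ge> 1 - e)"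

section \<open>Donsker classes\<close>

definition empirical_process :: "'o measure \<Rightarrow> nat \<Rightarrow> (nat \<Rightarrow> 'o) \<Rightarrow> ('o \<Rightarrow> real) \<Rightarrow> real" where
  "empirical_process P n x f = sqrt (real n) * ((\<Sum>i<n. f (x i)) / real n - (\<integral>z. f z \<partial>P))"

text \<open>
  The metric space \<open>funspace F euclidean_metric\<close> is \<open>\<ell>\<^sup>\<infinity>(F)\<close>: bounded real functions on \<open>F\<close> with
  the supremum distance.  The underlying observations are the coordinate projections on the
  infinite product space.
\<close>

definition donsker_class :: "'o measure \<Rightarrow> ('o \<Rightarrow> real) set \<Rightarrow> bool" where
  "donsker_class P F \<longleftrightarrow>
     (\<forall>f\<in>F. f \<in> borel_measurable P \<and> integrable P (\<lambda>z. (f z)\<^sup>2)) \<and>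
     (\<forall>z\<in>space P. bdd_above ((\<lambda>f. \<bar>f z - (\<integral>z'. f z' \<partial>P)\<bar>) ` F)) \<and>
     (\<exists>G. tight_borel_prob (mtopology_of (funspace F euclidean_metric)) G \<and>
          weakly_converges (mtopology_of (funspace F euclidean_metric)) (\<Pi>\<^sub>M i\<in>(UNIV :: nat set). P)
            (\<lambda>n x. restrict (empirical_process P n x) F) G)"

section \<open>Multivariate normal distributions\<close>

definition std_normal_vec :: "(real ^ 'n) measure" where
  "std_normal_vec = density lborel (\<lambda>z. ennreal (\<Prod>i\<in>UNIV. std_normal_density (z $ i)))"

text \<open>
  \<open>N\<close> is the law of \<open>m + L Z\<close>, with \<open>Z\<close> a vector of independent standard normals and
  \<open>L L\<^sup>T = S\<close>; the covariance \<open>S\<close> may be singular.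
\<close>

definition is_normal :: "real ^ 'n \<Rightarrow> real ^ 'n ^ 'n \<Rightarrow> (real ^ 'n) measure \<Rightarrow> bool" where
  "is_normal m S N \<longleftrightarrow>
     (\<exists>L :: real ^ 'n ^ 'n. L ** transpose L = S \<and> N = distr std_normal_vec borel (\<lambda>z. m + L *v z))"

section \<open>The observed data and the model\<close>

text \<open>\<open>Active\<close> and \<open>Control\<close> are the two intervention levels \<open>a\<close> and \<open>a\<^sup>\<star>\<close>.\<close>

datatype arm = Active | Control

type_synonym ('c, 'm1, 'm2) obs = "'c \<times> arm \<times> 'm1 \<times> 'm2 \<times> real"

definition obs_C :: "('c, 'm1, 'm2) obs \<Rightarrow> 'c" where "obs_C = (\<lambda>(c, t, m1, m2, y). c)"
definition obs_A :: "('c, 'm1, 'm2) obs \<Rightarrow> arm" where "obs_A = (\<lambda>(c, t, m1, m2, y). t)"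
definition obs_M1 :: "('c, 'm1, 'm2) obs \<Rightarrow> 'm1" where "obs_M1 = (\<lambda>(c, t, m1, m2, y). m1)"
definition obs_M2 :: "('c, 'm1, 'm2) obs \<Rightarrow> 'm2" where "obs_M2 = (\<lambda>(c, t, m1, m2, y). m2)"
definition obs_Y :: "('c, 'm1, 'm2) obs \<Rightarrow> real" where "obs_Y = (\<lambda>(c, t, m1, m2, y). y)"

text \<open>
  A distribution of \<open>O = (C, A, M\<^sub>1, M\<^sub>2, Y)\<close> comes with versions of its conditional distributions:
  the propensity score \<open>g\<close>, the joint mediator density \<open>q\<close> and the outcome regression
  \<open>Q\<close>.  Carrying the versions matters for estimated distributions: when the law of \<open>C\<close> is the
  empirical distribution, the joint law says nothing about these functions off the sample, whereas
  \<open>\<integral> D(P'\<^sub>n) dP\<close> depends on them.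
\<close>

record ('c, 'm1, 'm2) law =
  joint :: "('c, 'm1, 'm2) obs measure"
  ps :: "arm \<Rightarrow> 'c \<Rightarrow> real"
  med_dens :: "arm \<Rightarrow> 'm1 \<Rightarrow> 'm2 \<Rightarrow> 'c \<Rightarrow> real"
  out_reg :: "arm \<Rightarrow> 'm1 \<Rightarrow> 'm2 \<Rightarrow> 'c \<Rightarrow> real"

text \<open>The total effect and the three effects with efficient influence functions of their own.\<close>

datatype param = Total | Direct | Indirect1 | Indirect2

context
  fixes MC :: "'c measure"      \<comment> \<open>only its sigma-algebra matters\<close>
    and mu1 :: "'m1 measure"    \<comment> \<open>dominating measures for the mediators\<close>
    and mu2 :: "'m2 measure"
begin

definition obs_space :: "('c, 'm1, 'm2) obs measure" where
  "obs_space = MC \<Otimes>\<^sub>M count_space UNIV \<Otimes>\<^sub>M mu1 \<Otimes>\<^sub>M mu2 \<Otimes>\<^sub>M borel"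

definition QC :: "('c, 'm1, 'm2) law \<Rightarrow> 'c measure" where
  "QC L = distr (joint L) MC obs_C"

definition QM12 :: "('c, 'm1, 'm2) law \<Rightarrow> arm \<Rightarrow> 'c \<Rightarrow> ('m1 \<times> 'm2) measure" where
  "QM12 L t c = density (mu1 \<Otimes>\<^sub>M mu2) (\<lambda>(m1, m2). ennreal (med_dens L t m1 m2 c))"

definition qM1 :: "('c, 'm1, 'm2) law \<Rightarrow> arm \<Rightarrow> 'm1 \<Rightarrow> 'c \<Rightarrow> real" where
  "qM1 L t m1 c = (\<integral>m2. med_dens L t m1 m2 c \<partial>mu2)"

definition qM2 :: "('c, 'm1, 'm2) law \<Rightarrow> arm \<Rightarrow> 'm2 \<Rightarrow> 'c \<Rightarrow> real" where
  "qM2 L t m2 c = (\<integral>m1. med_dens L t m1 m2 c \<partial>mu1)"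

definition QM1 :: "('c, 'm1, 'm2) law \<Rightarrow> arm \<Rightarrow> 'c \<Rightarrow> 'm1 measure" where
  "QM1 L t c = distr (QM12 L t c) mu1 fst"

definition QM2 :: "('c, 'm1, 'm2) law \<Rightarrow> arm \<Rightarrow> 'c \<Rightarrow> 'm2 measure" where
  "QM2 L t c = distr (QM12 L t c) mu2 snd"

definition proper_versions :: "('c, 'm1, 'm2) law \<Rightarrow> bool" where
  "proper_versions L \<longleftrightarrow>
     (\<forall>t. ps L t \<in> borel_measurable MC) \<and>
     (\<forall>t. (\<lambda>(m1, m2, c). med_dens L t m1 m2 c) \<in> borel_measurable (mu1 \<Otimes>\<^sub>M mu2 \<Otimes>\<^sub>M MC)) \<and>
     (\<forall>t. (\<lambda>(m1, m2, c). out_reg L t m1 m2 c) \<in> borel_measurable (mu1 \<Otimes>\<^sub>M mu2 \<Otimes>\<^sub>M MC)) \<and>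
     (\<forall>c\<in>space MC. (\<forall>t. 0 \<le> ps L t c) \<and> ps L Active c + ps L Control c = 1) \<and>
     (\<forall>c\<in>space MC. \<forall>t. (\<forall>m1\<in>space mu1. \<forall>m2\<in>space mu2. 0 \<le> med_dens L t m1 m2 c) \<and>
        prob_space (QM12 L t c)) \<and>
     (\<forall>c\<in>space MC. \<forall>t. \<forall>m1\<in>space mu1. \<forall>m2\<in>space mu2. out_reg L t m1 m2 c \<in> {0<..<1})"

definition conditionals_of_joint :: "('c, 'm1, 'm2) law \<Rightarrow> bool" where
  "conditionals_of_joint L \<longleftrightarrow>
     (\<forall>t. AE z in joint L.
        real_cond_exp (joint L) (vimage_algebra (space (joint L)) obs_C MC)
          (\<lambda>z. indicator {t} (obs_A z)) z
        = ps L t (obs_C z)) \<and>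
     (\<forall>B\<in>sets (mu1 \<Otimes>\<^sub>M mu2). AE z in joint L.
        real_cond_exp (joint L)
          (vimage_algebra (space (joint L)) (\<lambda>z. (obs_A z, obs_C z)) (count_space UNIV \<Otimes>\<^sub>M MC))
          (\<lambda>z. indicator B (obs_M1 z, obs_M2 z)) z
        = measure (QM12 L (obs_A z) (obs_C z)) B) \<and>
     (AE z in joint L.
        real_cond_exp (joint L)
          (vimage_algebra (space (joint L)) (\<lambda>z. (obs_A z, obs_M1 z, obs_M2 z, obs_C z))
             (count_space UNIV \<Otimes>\<^sub>M mu1 \<Otimes>\<^sub>M mu2 \<Otimes>\<^sub>M MC))
          obs_Y z
        = out_reg L (obs_A z) (obs_M1 z) (obs_M2 z) (obs_C z))"

definition model :: "('c, 'm1, 'm2) law set" where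
  "model = {L.
     prob_space (joint L) \<and> sets (joint L) = sets obs_space \<and>
     (AE z in joint L. obs_Y z \<in> {0<..<1}) \<and>
     proper_versions L \<and> conditionals_of_joint L \<and>
     (AE z in joint L. 0 < ps L Active (obs_C z) \<and> ps L Active (obs_C z) < 1) \<and>
     (\<forall>t. AE z in joint L.
        (INF (m1, m2) \<in> space mu1 \<times> space mu2. med_dens L t m1 m2 (obs_C z)) > 0)}"

section \<open>Parameters and efficient influence functions\<close>

text \<open>
  \<open>Q_joint L t t' c\<close> averages \<open>Q\<^sub>t\<close> over the joint law of the mediators under \<open>t'\<close>;
  \<open>Q_prod L t1 t2 c\<close> averages \<open>Q\<^sub>a\<close> over the product of the marginal laws of \<open>M\<^sub>1\<close> under \<open>t1\<close> and of
  \<open>M\<^sub>2\<close> under \<open>t2\<close>; in \<open>Q_M1 L t1\<close> and \<open>Q_M2 L t2\<close> only the named mediator is averaged out.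
\<close>

definition Q_joint :: "('c, 'm1, 'm2) law \<Rightarrow> arm \<Rightarrow> arm \<Rightarrow> 'c \<Rightarrow> real" where
  "Q_joint L t t' c = (\<integral>(m1, m2). out_reg L t m1 m2 c \<partial>QM12 L t' c)"

definition Q_prod :: "('c, 'm1, 'm2) law \<Rightarrow> arm \<Rightarrow> arm \<Rightarrow> 'c \<Rightarrow> real" where
  "Q_prod L t1 t2 c = (\<integral>m1. (\<integral>m2. out_reg L Active m1 m2 c \<partial>QM2 L t2 c) \<partial>QM1 L t1 c)"

definition Q_M1 :: "('c, 'm1, 'm2) law \<Rightarrow> arm \<Rightarrow> 'm2 \<Rightarrow> 'c \<Rightarrow> real" where
  "Q_M1 L t1 m2 c = (\<integral>m1. out_reg L Active m1 m2 c \<partial>QM1 L t1 c)"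

definition Q_M2 :: "('c, 'm1, 'm2) law \<Rightarrow> arm \<Rightarrow> 'm1 \<Rightarrow> 'c \<Rightarrow> real" where
  "Q_M2 L t2 m1 c = (\<integral>m2. out_reg L Active m1 m2 c \<partial>QM2 L t2 c)"

fun Psi :: "param \<Rightarrow> ('c, 'm1, 'm2) law \<Rightarrow> real" where
  "Psi Total L = (\<integral>c. Q_joint L Active Active c - Q_joint L Control Control c \<partial>QC L)"
| "Psi Direct L = (\<integral>c. Q_joint L Active Control c - Q_joint L Control Control c \<partial>QC L)"
| "Psi Indirect1 L = (\<integral>c. Q_prod L Active Control c - Q_prod L Control Control c \<partial>QC L)"
| "Psi Indirect2 L = (\<integral>c. Q_prod L Active Active c - Q_prod L Active Control c \<partial>QC L)"

definition ipw :: "('c, 'm1, 'm2) law \<Rightarrow> arm \<Rightarrow> arm \<Rightarrow> 'c \<Rightarrow> real" where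
  "ipw L t0 t c = indicator {t0} t / ps L t0 c"

fun EIF :: "param \<Rightarrow> ('c, 'm1, 'm2) law \<Rightarrow> ('c, 'm1, 'm2) obs \<Rightarrow> real" where
  "EIF Total L (c, t, m1, m2, y) =
     ipw L Active t c * (y - Q_joint L Active Active c)
     - ipw L Control t c * (y - Q_joint L Control Control c)
     + Q_joint L Active Active c - Q_joint L Control Control c - Psi Total L"
| "EIF Direct L (c, t, m1, m2, y) =
     ipw L Active t c * (med_dens L Control m1 m2 c / med_dens L Active m1 m2 c)
       * (y - out_reg L Active m1 m2 c)
     - ipw L Control t c * (y - out_reg L Control m1 m2 c)
     + ipw L Control t c
       * (out_reg L Active m1 m2 c - out_reg L Control m1 m2 c
          - (Q_joint L Active Control c - Q_joint L Control Control c))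
     + Q_joint L Active Control c - Q_joint L Control Control c - Psi Direct L"
| "EIF Indirect1 L (c, t, m1, m2, y) =
     ipw L Active t c
       * ((qM1 L Active m1 c - qM1 L Control m1 c) * qM2 L Control m2 c / med_dens L Active m1 m2 c)
       * (y - out_reg L Active m1 m2 c)
     + ipw L Active t c * (Q_M2 L Control m1 c - Q_prod L Active Control c)
     - ipw L Control t c * (Q_M2 L Control m1 c - Q_prod L Control Control c)
     + ipw L Control t c
       * (Q_M1 L Active m2 c - Q_M1 L Control m2 c
          - (Q_prod L Active Control c - Q_prod L Control Control c))
     + Q_prod L Active Control c - Q_prod L Control Control c - Psi Indirect1 L"
| "EIF Indirect2 L (c, t, m1, m2, y) =
     ipw L Active t c
       * ((qM2 L Active m2 c - qM2 L Control m2 c) * qM1 L Active m1 c / med_dens L Active m1 m2 c)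
       * (y - out_reg L Active m1 m2 c)
     + ipw L Active t c * (Q_M1 L Active m2 c - Q_prod L Active Active c)
     - ipw L Control t c * (Q_M1 L Active m2 c - Q_prod L Active Control c)
     + ipw L Active t c
       * (Q_M2 L Active m1 c - Q_M2 L Control m1 c
          - (Q_prod L Active Active c - Q_prod L Active Control c))
     + Q_prod L Active Active c - Q_prod L Active Control c - Psi Indirect2 L"

section \<open>Pathwise differentiability\<close>

text \<open>
  One-dimensional submodels \<open>t \<mapsto> P\<^sub>t\<close>, \<open>t \<ge> 0\<close>, through \<open>P\<close> that are differentiable in quadratic mean
  at \<open>t = 0\<close> with score \<open>s\<close>.  The model is nonparametric apart from positivity, so every such
  submodel within it is considered.
\<close>

definition regular_submodel ::
  "(real \<Rightarrow> ('c, 'm1, 'm2) law) \<Rightarrow> ('c, 'm1, 'm2) law \<Rightarrow> (('c, 'm1, 'm2) obs \<Rightarrow> real) \<Rightarrow> bool" where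
  "regular_submodel \<gamma> P s \<longleftrightarrow>
     \<gamma> 0 = P \<and> (\<forall>t\<ge>0. \<gamma> t \<in> model) \<and>
     s \<in> borel_measurable (joint P) \<and> integrable (joint P) (\<lambda>z. (s z)\<^sup>2) \<and>
     (\<exists>\<nu> p. sigma_finite_measure \<nu> \<and>
        (\<forall>t\<ge>0. p t \<in> borel_measurable \<nu> \<and> (\<forall>z. 0 \<le> p t z) \<and>
               joint (\<gamma> t) = density \<nu> (\<lambda>z. ennreal (p t z))) \<and>
        ((\<lambda>t. \<integral>\<^sup>+z. ennreal (((sqrt (p t z) - sqrt (p 0 z)) / t - s z * sqrt (p 0 z) / 2)\<^sup>2) \<partial>\<nu>)
          \<longlongrightarrow> 0) (at_right 0))"

definition pathwise_differentiable ::
  "(('c, 'm1, 'm2) law \<Rightarrow> real) \<Rightarrow> ('c, 'm1, 'm2) law \<Rightarrow> (('c, 'm1, 'm2) obs \<Rightarrow> real) \<Rightarrow> bool" where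
  "pathwise_differentiable \<psi> P D \<longleftrightarrow>
     D \<in> borel_measurable (joint P) \<and> integrable (joint P) (\<lambda>z. (D z)\<^sup>2) \<and>
     (\<forall>\<gamma> s. regular_submodel \<gamma> P s \<longrightarrow>
        ((\<lambda>t. (\<psi> (\<gamma> t) - \<psi> P) / t) \<longlongrightarrow> (\<integral>z. D z * s z \<partial>joint P)) (at_right 0))"

section \<open>Estimators\<close>

definition empirical_QC :: "nat \<Rightarrow> (nat \<Rightarrow> ('c, 'm1, 'm2) obs) \<Rightarrow> 'c measure" where
  "empirical_QC n x = distr (uniform_count_measure {..<n}) MC (\<lambda>i. obs_C (x i))"

definition one_step ::
  "param \<Rightarrow> ('c, 'm1, 'm2) law \<Rightarrow> nat \<Rightarrow> (nat \<Rightarrow> ('c, 'm1, 'm2) obs) \<Rightarrow> real" where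
  "one_step k P' n x = Psi k P' + (\<Sum>i<n. EIF k P' (x i)) / real n"

definition remainder :: "param \<Rightarrow> ('c, 'm1, 'm2) law \<Rightarrow> ('c, 'm1, 'm2) law \<Rightarrow> real" where
  "remainder k P P' = Psi k P' - Psi k P + (\<integral>z. EIF k P' z \<partial>joint P)"

end

text \<open>
  The vector of direct, first indirect, second indirect and covariant components.  For the
  parameters, their gradients and their estimators alike, the covariant component is the total
  minus the three others.
\<close>

definition effect_vec :: "(param \<Rightarrow> real) \<Rightarrow> real ^ 4" where
  "effect_vec f =
     vector [f Direct, f Indirect1, f Indirect2, f Total - f Direct - f Indirect1 - f Indirect2]"

lemma effect_vec_nth [simp]:
  "effect_vec f $ 1 = f Direct"
  "effect_vec f $ 2 = f Indirect1"
  "effect_vec f $ 3 = f Indirect2"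
  "effect_vec f $ 4 = f Total - f Direct - f Indirect1 - f Indirect2"
  by (simp_all add: effect_vec_def vector_def)

definition second_moment_matrix :: "'o measure \<Rightarrow> ('o \<Rightarrow> real ^ 'n) \<Rightarrow> real ^ 'n ^ 'n" where
  "second_moment_matrix P D = (\<chi> i j. \<integral>z. D z $ i * D z $ j \<partial>P)"

end

theory Submission
  imports Defs
begin

text \<open>
  Writing \<open>G\<^sub>n\<close> for the empirical process and \<open>D\<^sub>n\<close>, \<open>D\<close> for the estimated and the true influence
  function, the definition of the second-order remainder gives
  \<open>\<surd>n (\<psi>\<^sub>n - \<psi>) = G\<^sub>n D + G\<^sub>n (D\<^sub>n - D) + \<surd>n R\<^sub>2\<close> for the one-step estimator, and the targeted estimator
  differs from it by \<open>o\<^sub>p(n\<^sup>-\<^sup>1\<^sup>/\<^sup>2)\<close>.  The middle term vanishes by asymptotic equicontinuity over the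
  Donsker class.  That needs only tightness of the limit, not that it is Gaussian: up to small
  probability \<open>G\<^sub>n\<close> is uniformly close to one of finitely many bounded functions on the class, which
  cut the class into finitely many cells on which \<open>G\<^sub>n\<close> oscillates little; in every cell containing
  functions of small norm in \<open>L\<^sup>2(P)\<close> Chebyshev's inequality controls one of them.

  The leading term is handled by a multivariate central limit theorem, for which trigonometric
  polynomials suffice as test functions, so that the one-dimensional theorem applies to each
  projection.  Its covariance is the second moment matrix because the influence functions have mean
  zero; this is not part of pathwise differentiability and is computed from their formulas.
\<close>

section \<open>Factorization of positive semidefinite matrices\<close>

text \<open>The estimates may depend on the data in a non-measurable way. The central limit theorem
  is therefore applied only to the sums of true influence functions, and the estimators are compared
  with these through measurable covers of small exceptional sets.

  Pathwise differentiability pairs \<open>D\<close> only with scores, which have mean zero, so it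
  cannot detect an additive constant in \<open>D\<close>. Centering has to come from disintegrating
  \<open>joint P\<close>: given C and the arm, the mediators follow \<open>QM12\<close>, and given
  these as well the outcome has mean \<open>out_reg\<close>. The obstacle is integrability: square
  integrability is assumed for the whole influence function, while its terms are integrated one at a
  time. The inverse weights and density ratios are integrable because a change of measure turns each
  into a density of mass at most 1.\<close>

text \<open>Pivot elimination.  A zero pivot has a zero row by positivity, so the junk value \<open>x / 0 = 0\<close>
  is the right one and needs no separate case in the construction.\<close>

lemma psd_eq_gram:
  fixes A :: "'n::finite \<Rightarrow> 'n \<Rightarrow> real"
  assumes "finite I" "\<And>j k. A j k = A k j"
    "\<And>x. 0 \<le> (\<Sum>j\<in>UNIV. \<Sum>k\<in>UNIV. x j * A j k * x k)"
    "\<And>j k. j \<notin> I \<Longrightarrow> A j k = 0"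
  shows "\<exists>l. \<forall>j k. A j k = (\<Sum>i\<in>I. l i j * l i k)"
  using assms
proof (induction I arbitrary: A rule: finite_induct)
  case empty
  then show ?case by simp
next
  case (insert i I)
  note sym = insert.prems(1) and psd = insert.prems(2) and supp = insert.prems(3)
  define q where "q x = (\<Sum>j\<in>UNIV. \<Sum>k\<in>UNIV. x j * A j k * x k)" for x
  define y where "y x = (\<Sum>k\<in>UNIV. A i k * x k)" for x
  have q_shift: "q (\<lambda>j. x j + s * of_bool (j = i)) = q x + 2 * s * y x + s\<^sup>2 * A i i" for x s
  proof -
    have "q (\<lambda>j. x j + s * of_bool (j = i)) =
        (\<Sum>j\<in>UNIV. \<Sum>k\<in>UNIV. x j * A j k * x k + (s * x j * A j k) * of_bool (k = i)
          + (s * A j k * x k) * of_bool (j = i) + (s\<^sup>2 * A j k * of_bool (k = i)) * of_bool (j = i))"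
      unfolding q_def by (intro sum.cong refl) (simp add: algebra_simps power2_eq_square)
    also have "\<dots> = q x + (\<Sum>j\<in>UNIV. s * x j * A j i) + (\<Sum>k\<in>UNIV. s * A i k * x k) + s\<^sup>2 * A i i"
      unfolding q_def by (simp add: sum.distrib sum.swap [of "\<lambda>j k. _ j k * of_bool (j = i)"]
          flip: sum_distrib_right)
    also have "(\<Sum>j\<in>UNIV. s * x j * A j i) = s * y x"
      unfolding y_def sum_distrib_left by (intro sum.cong refl) (simp add: sym[of _ i])
    also have "(\<Sum>k\<in>UNIV. s * A i k * x k) = s * y x"
      unfolding y_def sum_distrib_left by (intro sum.cong refl) simp
    finally show ?thesis by simp
  qed
  have q_axis: "q (\<lambda>j. of_bool (j = k)) = A k k" for k
  proof -
    have "q (\<lambda>j. of_bool (j = k)) = (\<Sum>j\<in>UNIV. (\<Sum>l\<in>UNIV. A j l * of_bool (l = k)) * of_bool (j = k))"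
      unfolding q_def sum_distrib_right by (intro sum.cong refl) simp
    also have "\<dots> = (\<Sum>j\<in>UNIV. A j k * of_bool (j = k))" by (intro sum.cong refl) simp
    finally show ?thesis by simp
  qed
  have y_axis: "y (\<lambda>j. of_bool (j = k)) = A i k" for k
    unfolding y_def by simp
  have Aii: "0 \<le> A i i"
    using psd[of "\<lambda>j. of_bool (j = i)"] q_axis[of i] by (simp add: q_def)
  have row0: "A i k = 0" if "A i i = 0" for k
  proof (rule ccontr)
    assume nz: "A i k \<noteq> 0"
    \<comment> \<open>With a zero pivot the form is affine in \<open>s\<close> along this line, so a
      nonzero slope would make it negative somewhere; the \<open>s\<close> chosen below gives the
      value -1.\<close>
    have "0 \<le> A k k + 2 * s * A i k" for s
      using psd[of "\<lambda>j. of_bool (j = k) + s * of_bool (j = i)"] q_shift[of "\<lambda>j. of_bool (j = k)" s]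
      by (simp add: q_axis y_axis that flip: q_def)
    from this[of "- (A k k + 1) / (2 * A i k)"] nz show False by (simp add: field_simps)
  qed
  \<comment> \<open>Schur complement of the pivot.\<close>
  define A' where "A' j k = A j k - A i j * A i k / A i i" for j k
  have "\<exists>l. \<forall>j k. A' j k = (\<Sum>i\<in>I. l i j * l i k)"
  proof (rule insert.IH)
    show "A' j k = A' k j" for j k by (simp add: A'_def sym[of j k])
    show "0 \<le> (\<Sum>j\<in>UNIV. \<Sum>k\<in>UNIV. x j * A' j k * x k)" for x
    proof -
      have "(\<Sum>j\<in>UNIV. \<Sum>k\<in>UNIV. x j * A' j k * x k)
          = (\<Sum>j\<in>UNIV. \<Sum>k\<in>UNIV. x j * A j k * x k - (A i j * x j) * (A i k * x k) / A i i)"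
        by (intro sum.cong refl) (simp add: A'_def algebra_simps)
      also have "\<dots> = q x - (y x)\<^sup>2 / A i i"
        unfolding q_def y_def power2_eq_square sum_product sum_divide_distrib
        by (simp add: sum_subtractf)
      \<comment> \<open>Completing the square: for a positive pivot the new form is the old one at
        its minimum along axis \<open>i\<close>, so it inherits nonnegativity.\<close>
      also have "\<dots> = q (\<lambda>j. x j + (- y x / A i i) * of_bool (j = i))"
        unfolding q_shift by (cases "A i i = 0") (simp_all add: field_simps power2_eq_square)
      also have "\<dots> \<ge> 0" unfolding q_def by (rule psd)
      finally show ?thesis .
    qed
    show "A' j k = 0" if "j \<notin> I" for j k
    proof (cases "j = i")
      case True
      \<comment> \<open>A zero pivot leaves row \<open>i\<close> unchanged, and \<open>row0\<close>
        says that this row vanished already.\<close>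
      then show ?thesis using row0[of k] by (cases "A i i = 0") (simp_all add: A'_def)
    next
      case False
      then show ?thesis using that supp[of j] sym[of i j] by (simp add: A'_def)
    qed
  qed
  then obtain l where l: "\<And>j k. A' j k = (\<Sum>i\<in>I. l i j * l i k)" by blast
  define l' where "l' = l(i := \<lambda>j. A i j / sqrt (A i i))"
  have "A j k = (\<Sum>i\<in>insert i I. l' i j * l' i k)" for j k
  proof -
    have "(\<Sum>i\<in>I. l' i j * l' i k) = A' j k"
      unfolding l using insert.hyps by (intro sum.cong) (auto simp: l'_def)
    then show ?thesis
      using insert.hyps Aii by (simp add: A'_def l'_def)
  qed
  then show ?case by blast
qed

text \<open>Pivoting over the whole index type yields as many Gram rows as coordinates, hence the
  square factor that \<open>is_normal\<close> demands.\<close>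

lemma psd_matrix_factor:
  fixes S :: "real ^ 'n ^ 'n"
  assumes "\<And>i j. S $ i $ j = S $ j $ i" "\<And>x. 0 \<le> x \<bullet> (S *v x)"
  shows "\<exists>L :: real ^ 'n ^ 'n. L ** transpose L = S"
proof -
  have "\<exists>l. \<forall>j k. S $ j $ k = (\<Sum>i\<in>(UNIV :: 'n set). l i j * l i k)"
  proof (rule psd_eq_gram)
    show "0 \<le> (\<Sum>j\<in>UNIV. \<Sum>k\<in>UNIV. x j * S $ j $ k * x k)" for x
      using assms(2)[of "\<chi> i. x i"]
      by (simp add: inner_vec_def matrix_vector_mult_def sum_distrib_left mult.assoc)
  qed (simp_all add: assms(1))
  then obtain l where "\<And>j k. S $ j $ k = (\<Sum>i\<in>(UNIV :: 'n set). l i j * l i k)" by blast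
  then have "(\<chi> j i. l i j) ** transpose (\<chi> j i. l i j) = S"
    by (simp add: vec_eq_iff matrix_matrix_mult_def transpose_def)
  then show ?thesis ..
qed

section \<open>The standard normal vector\<close>

text \<open>Lebesgue measure on \<open>real ^ 'n\<close> is the image of a product measure indexed
  by basis vectors; \<open>e\<close> matches these with the coordinates, and Fubini does the
  rest.\<close>

lemma
  fixes f :: "'n::finite \<Rightarrow> real \<Rightarrow> complex"
  assumes [simp]: "\<And>i. integrable lborel (f i)"
  shows integral_lborel_vec_prod:
    "(\<integral>z. (\<Prod>i\<in>UNIV. f i (z $ i)) \<partial>(lborel :: (real ^ 'n) measure)) = (\<Prod>i\<in>UNIV. \<integral>x. f i x \<partial>lborel)"
proof -
  have [measurable]: "f i \<in> borel_measurable borel" for i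
    using borel_measurable_integrable[OF assms(1)[of i]] by simp
  define e :: "'n \<Rightarrow> real ^ 'n" where "e i = axis i 1" for i
  have e: "inj e" "Basis = range e"
    by (auto simp: inj_def e_def axis_eq_axis Basis_vec_def)
  interpret product_sigma_finite "\<lambda>_ :: real ^ 'n. lborel :: real measure" ..
  have nth: "(\<Sum>b\<in>Basis. x b *\<^sub>R b) $ i = x (e i)" for x :: "real ^ 'n \<Rightarrow> real" and i
    using inner_sum_left_Basis[of "e i" x] by (simp add: e_def inner_axis)
  have "(\<integral>z. (\<Prod>i\<in>UNIV. f i (z $ i)) \<partial>(lborel :: (real ^ 'n) measure))
      = (\<integral>x. (\<Prod>i\<in>UNIV. f i (x (e i))) \<partial>(\<Pi>\<^sub>M b\<in>Basis. lborel))"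
    by (subst lborel_eq, subst integral_distr) (simp_all only: nth, simp_all)
  also have "\<dots> = (\<integral>x. (\<Prod>b\<in>Basis. f (inv e b) (x b)) \<partial>(\<Pi>\<^sub>M b\<in>Basis. lborel))"
    by (simp add: e(2) prod.reindex e(1))
  also have "\<dots> = (\<Prod>b\<in>Basis. \<integral>x. f (inv e b) x \<partial>lborel)"
    by (rule product_integral_prod) simp_all
  also have "\<dots> = (\<Prod>i\<in>UNIV. \<integral>x. f i x \<partial>lborel)"
    by (simp add: e(2) prod.reindex e(1))
  finally show ?thesis .
qed

lemma prob_space_std_normal_vec: "prob_space (std_normal_vec :: (real ^ 'n) measure)"
proof
  \<comment> \<open>The dummy argument gives the factors the shape of a family indexed by
    \<open>Basis\<close>.\<close>
  define d :: "real ^ 'n \<Rightarrow> real \<Rightarrow> real" where "d b = std_normal_density" for b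
  have e: "inj (\<lambda>i :: 'n. axis i (1 :: real))" "Basis = range (\<lambda>i :: 'n. axis i (1 :: real))"
    by (auto simp: inj_def axis_eq_axis Basis_vec_def)
  have "emeasure (std_normal_vec :: (real ^ 'n) measure) (space std_normal_vec)
      = (\<integral>\<^sup>+z. (\<Prod>i\<in>UNIV. ennreal (std_normal_density (z $ i))) \<partial>(lborel :: (real ^ 'n) measure))"
    by (simp add: std_normal_vec_def emeasure_density prod_ennreal)
  also have "\<dots> = (\<integral>\<^sup>+z. (\<Prod>b\<in>Basis. ennreal (d b (z \<bullet> b))) \<partial>(lborel :: (real ^ 'n) measure))"
    by (simp add: e(2) prod.reindex e(1) d_def inner_axis)
  also have "\<dots> = (\<Prod>b\<in>(Basis :: (real ^ 'n) set). \<integral>\<^sup>+x. ennreal (d b x) \<partial>lborel)"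
    by (rule nn_integral_lborel_prod) (simp_all add: d_def)
  also have "\<dots> = 1"
    using prob_space.emeasure_space_1[OF prob_space_normal_density[of 1 0]]
    by (simp add: d_def emeasure_density)
  finally show "emeasure (std_normal_vec :: (real ^ 'n) measure) (space std_normal_vec) = 1" .
qed

lemma sets_std_normal_vec [simp]: "sets std_normal_vec = sets borel"
  by (simp add: std_normal_vec_def)

text \<open>Density and exponential both factor over the coordinates, which reduces the claim to the
  one-dimensional characteristic function.\<close>

lemma char_std_normal_vec:
  fixes u :: "real ^ 'n"
  shows "(CLINT z|std_normal_vec. iexp (u \<bullet> z)) = complex_of_real (exp (- (norm u)\<^sup>2 / 2))"
proof -
  have int: "integrable lborel (\<lambda>x. std_normal_density x *\<^sub>R iexp (u $ i * x))" for i
  proof (rule Bochner_Integration.integrable_bound[where f = std_normal_density])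
    show "integrable lborel std_normal_density" by simp
  qed (simp_all del: of_real_mult)
  have "(CLINT z|std_normal_vec. iexp (u \<bullet> z))
      = (CLINT z|lborel. (\<Prod>i\<in>UNIV. std_normal_density (z $ i) *\<^sub>R iexp (u $ i * z $ i)))"
    unfolding std_normal_vec_def
    by (subst integral_density)
      (auto intro!: Bochner_Integration.integral_cong prod_nonneg
        simp: prod.distrib exp_sum[symmetric] inner_vec_def sum_distrib_left scaleR_conv_of_real)
  also have "\<dots> = (\<Prod>i\<in>UNIV. CLINT x|lborel. std_normal_density x *\<^sub>R iexp (u $ i * x))"
    by (rule integral_lborel_vec_prod[where f = "\<lambda>i x. std_normal_density x *\<^sub>R iexp (u $ i * x)"]) (rule int)
  also have "\<dots> = (\<Prod>i\<in>UNIV. char std_normal_distribution (u $ i))"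
    unfolding char_def by (subst integral_density) simp_all
  also have "\<dots> = complex_of_real (exp (\<Sum>i\<in>UNIV. - ((u $ i)\<^sup>2 / 2)))"
    by (simp add: char_std_normal_distribution exp_sum)
  also have "(\<Sum>i\<in>UNIV. - ((u $ i)\<^sup>2 / 2)) = - (norm u)\<^sup>2 / 2"
    by (simp add: norm_vec_def L2_set_def sum_nonneg sum_divide_distrib sum_negf)
  finally show ?thesis by simp
qed

section \<open>Trigonometric polynomials\<close>

text \<open>The phase \<open>b\<close> brings in sines and constants, and by the product-to-sum
  formulas sums of such cosines form an algebra. Real values suit both Stone-Weierstrass and outer
  expectations, while the mean of each generator is read off a characteristic function.\<close>

inductive trig_poly :: "('a::real_inner \<Rightarrow> real) \<Rightarrow> bool" where
  trig_cos: "trig_poly (\<lambda>x. a * cos (t \<bullet> x + b))"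
| trig_add: "trig_poly f \<Longrightarrow> trig_poly g \<Longrightarrow> trig_poly (\<lambda>x. f x + g x)"

lemma trig_const: "trig_poly (\<lambda>x. c)"
  using trig_cos[of c 0 0] by simp

lemma trig_mult:
  assumes "trig_poly f" "trig_poly g" shows "trig_poly (\<lambda>x. f x * g x)"
  using assms
proof (induction f rule: trig_poly.induct)
  case (trig_cos a t b)
  then show ?case
  proof (induction g rule: trig_poly.induct)
    case (trig_cos a' t' b')
    have eq: "(\<lambda>x. a * cos (t \<bullet> x + b) * (a' * cos (t' \<bullet> x + b')))
        = (\<lambda>x. (a * a' / 2) * cos ((t + t') \<bullet> x + (b + b')) + (a * a' / 2) * cos ((t - t') \<bullet> x + (b - b')))"
      by (rule ext) (simp add: inner_add_left inner_diff_left cos_add cos_diff sin_add sin_diff algebra_simps)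
    show ?case unfolding eq by (intro trig_poly.intros)
  qed (simp add: distrib_left trig_add)
qed (simp add: distrib_right trig_add)

lemma trig_bounded: "trig_poly f \<Longrightarrow> \<exists>B. \<forall>x. \<bar>f x\<bar> \<le> B"
proof (induction rule: trig_poly.induct)
  case (trig_cos a t b)
  have "\<bar>a * cos (t \<bullet> x + b)\<bar> \<le> \<bar>a\<bar>" for x
    by (simp add: abs_mult mult_left_le)
  then show ?case by blast
next
  case (trig_add f g)
  then obtain B C where "\<And>x. \<bar>f x\<bar> \<le> B" "\<And>x. \<bar>g x\<bar> \<le> C" by blast
  then have "\<bar>f x + g x\<bar> \<le> B + C" for x by (meson abs_triangle_ineq add_mono order_trans)
  then show ?case by blast
qed

lemma abs_cos_diff_le: "\<bar>cos x - cos y\<bar> \<le> \<bar>x - y\<bar>" for x y :: real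
proof -
  have "\<bar>cos x - cos y\<bar> = 2 * \<bar>sin ((x + y) / 2)\<bar> * \<bar>sin ((y - x) / 2)\<bar>"
    by (simp add: cos_diff_cos abs_mult)
  also have "\<dots> \<le> 2 * 1 * \<bar>(y - x) / 2\<bar>"
    by (intro mult_mono abs_sin_le_one abs_sin_x_le_abs_x) auto
  finally show ?thesis by simp
qed

text \<open>A global constant transfers closeness of two random vectors to their images without
  confining either to a compact set.\<close>

lemma trig_Lipschitz: "trig_poly f \<Longrightarrow> \<exists>L\<ge>0. \<forall>x y. \<bar>f x - f y\<bar> \<le> L * norm (x - y)"
proof (induction rule: trig_poly.induct)
  case (trig_cos a t b)
  have "\<bar>a * cos (t \<bullet> x + b) - a * cos (t \<bullet> y + b)\<bar> \<le> (\<bar>a\<bar> * norm t) * norm (x - y)" for x y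
  proof -
    have "\<bar>a * cos (t \<bullet> x + b) - a * cos (t \<bullet> y + b)\<bar> = \<bar>a\<bar> * \<bar>cos (t \<bullet> x + b) - cos (t \<bullet> y + b)\<bar>"
      by (simp add: right_diff_distrib[symmetric] abs_mult)
    also have "\<dots> \<le> \<bar>a\<bar> * \<bar>t \<bullet> (x - y)\<bar>"
      using abs_cos_diff_le[of "t \<bullet> x + b" "t \<bullet> y + b"]
      by (intro mult_left_mono) (simp_all add: inner_diff_right)
    also have "\<dots> \<le> \<bar>a\<bar> * (norm t * norm (x - y))"
      by (intro mult_left_mono Cauchy_Schwarz_ineq2) simp
    finally show ?thesis by (simp add: mult.assoc)
  qed
  then show ?case by (intro exI[of _ "\<bar>a\<bar> * norm t"]) simp
next
  case (trig_add f g)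
  then obtain L K where *: "L \<ge> 0" "K \<ge> 0" "\<And>x y. \<bar>f x - f y\<bar> \<le> L * norm (x - y)"
    "\<And>x y. \<bar>g x - g y\<bar> \<le> K * norm (x - y)" by blast
  have "\<bar>f x + g x - (f y + g y)\<bar> \<le> (L + K) * norm (x - y)" for x y
    using *(3,4)[of x y] by (simp add: distrib_right)
  with *(1,2) show ?case by (intro exI[of _ "L + K"]) simp
qed

lemma trig_continuous: "trig_poly f \<Longrightarrow> continuous_on A f"
  by (induction rule: trig_poly.induct) (auto intro!: continuous_intros)

lemma trig_measurable: "trig_poly f \<Longrightarrow> f \<in> borel_measurable borel" for f :: "'a::euclidean_space \<Rightarrow> real"
  by (intro borel_measurable_continuous_onI trig_continuous)

lemma trig_poly_compose:
  assumes "real_polynomial_function r" "trig_poly p" shows "trig_poly (\<lambda>x. r (p x))"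
  using assms(1)
proof (induction r rule: real_polynomial_function.induct)
  case (linear f)
  then obtain c where "f = (\<lambda>x. x * c)" by (auto simp: real_bounded_linear)
  then show ?case using trig_mult[OF assms(2) trig_const] by simp
qed (simp_all add: trig_const trig_add trig_mult)

lemma trig_separates:
  fixes x y :: "'a::real_inner" assumes "x \<noteq> y" shows "\<exists>f. trig_poly f \<and> f x \<noteq> f y"
proof -
  \<comment> \<open>Scaling by the squared distance makes \<open>v \<bullet> x\<close> and
    \<open>v \<bullet> y\<close> differ by exactly 1; the phase then compares \<open>sin 1\<close>
    with \<open>sin 0\<close>, whatever the points.\<close>
  define v where "v = (1 / (norm (x - y))\<^sup>2) *\<^sub>R (x - y)"
  have "v \<bullet> (x - y) = 1" using assms by (simp add: v_def dot_square_norm)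
  then have "v \<bullet> x = v \<bullet> y + 1" by (simp add: inner_diff_right)
  then have "cos (v \<bullet> x + (- v \<bullet> y - pi / 2)) = sin 1" "cos (v \<bullet> y + (- v \<bullet> y - pi / 2)) = 0"
    by (simp_all add: cos_diff)
  moreover have "sin 1 > (0 :: real)" using pi_gt3 by (intro sin_gt_zero) auto
  ultimately show ?thesis
    using trig_cos[of 1 v "- v \<bullet> y - pi / 2"]
    by (intro exI[of _ "\<lambda>x. 1 * cos (v \<bullet> x + (- v \<bullet> y - pi / 2))"]) simp
qed

text \<open>Composing a Stone-Weierstrass approximant with a polynomial close to the truncation at the
  level of \<open>B\<close> keeps it under control off \<open>K\<close> while staying a trigonometric polynomial.\<close>

lemma trig_approx:
  fixes h :: "'a::euclidean_space \<Rightarrow> real"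
  assumes h: "continuous_on UNIV h" "\<And>x. \<bar>h x\<bar> \<le> B" and K: "compact K" and e: "e > 0"
  shows "\<exists>f. trig_poly f \<and> (\<forall>x\<in>K. \<bar>h x - f x\<bar> \<le> e) \<and> (\<forall>x. \<bar>f x\<bar> \<le> B + e)"
proof -
  interpret R: function_ring_on "Collect trig_poly" K
    by unfold_locales
      (auto simp: K trig_continuous trig_add trig_mult trig_const trig_separates)
  have "continuous_on K h" using h(1) continuous_on_subset by blast
  from R.Stone_Weierstrass_basic[OF this, of "e / 2"] e
  obtain p where p: "trig_poly p" "\<And>x. x \<in> K \<Longrightarrow> \<bar>h x - p x\<bar> < e / 2" by auto
  obtain C where C: "\<And>x. \<bar>p x\<bar> \<le> C" using trig_bounded[OF p(1)] by blast
  \<comment> \<open>Truncation fixes the values of \<open>h\<close> and does not increase distances,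
    so \<open>clamp (p x)\<close> is as close to \<open>h x\<close> on \<open>K\<close> as
    \<open>p x\<close> is.\<close>
  define clamp where "clamp y = max (- B) (min B y)" for y
  \<comment> \<open>The interval contains the whole range of \<open>p\<close>, so an approximation
    of \<open>clamp\<close> there is valid at every point of the space.\<close>
  have "continuous_on {- C..C} clamp" unfolding clamp_def by (intro continuous_intros)
  then obtain r where r: "real_polynomial_function r" "\<And>y. y \<in> {- C..C} \<Longrightarrow> \<bar>clamp y - r y\<bar> < e / 2"
    using Stone_Weierstrass_real_polynomial_function[of "{- C..C}" clamp "e / 2"] e
    by (metis compact_Icc half_gt_zero)
  have r': "\<bar>clamp (p x) - r (p x)\<bar> < e / 2" for x
    using C[of x] by (intro r(2)) (auto simp: abs_le_iff)
  have "\<bar>h x - r (p x)\<bar> \<le> e" if "x \<in> K" for x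
    using p(2)[OF that] r'[of x] h(2)[of x] unfolding clamp_def
    by (auto simp: max_def min_def abs_if split: if_splits)
  moreover have "\<bar>r (p x)\<bar> \<le> B + e" for x
    using r'[of x] h(2)[of x] e unfolding clamp_def by (auto simp: max_def min_def abs_if split: if_splits)
  ultimately show ?thesis using trig_poly_compose[OF r(1) p(1)] by blast
qed

section \<open>Weak convergence of possibly non-measurable maps\<close>

text \<open>Common form of convergence to 0 in outer probability and of events whose complements
  have probability tending to one.\<close>

definition vanishing :: "'w measure \<Rightarrow> (nat \<Rightarrow> 'w set) \<Rightarrow> bool" where
  "vanishing M A \<longleftrightarrow> (\<lambda>n. outer_measure_of M (A n)) \<longlonglongrightarrow> 0"

text \<open>Outer measure is an infimum over measurable supersets. Passing to such covers lets
  exceptional sets be combined by ordinary measure estimates.\<close>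

lemma (in finite_measure) vanishing_iff:
  "vanishing M A \<longleftrightarrow> (\<forall>e>0. \<forall>\<^sub>F n in sequentially. \<exists>E\<in>sets M. A n \<subseteq> E \<and> measure M E \<le> e)"
proof
  assume A: "vanishing M A"
  show "\<forall>e>0. \<forall>\<^sub>F n in sequentially. \<exists>E\<in>sets M. A n \<subseteq> E \<and> measure M E \<le> e"
  proof (intro allI impI)
    fix e :: real assume e: "e > 0"
    with A have "\<forall>\<^sub>F n in sequentially. outer_measure_of M (A n) < ennreal e"
      unfolding vanishing_def by (intro order_tendstoD(2)) auto
    then show "\<forall>\<^sub>F n in sequentially. \<exists>E\<in>sets M. A n \<subseteq> E \<and> measure M E \<le> e"
    proof eventually_elim
      case (elim n)
      then obtain E where "E \<in> sets M" "A n \<subseteq> E" "emeasure M E < ennreal e"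
        unfolding outer_measure_of_def INF_less_iff by auto
      then show ?case using e by (intro bexI[of _ E]) (auto simp: emeasure_eq_measure ennreal_less_iff)
    qed
  qed
next
  assume A: "\<forall>e>0. \<forall>\<^sub>F n in sequentially. \<exists>E\<in>sets M. A n \<subseteq> E \<and> measure M E \<le> e"
  show "vanishing M A"
    unfolding vanishing_def
  proof (rule order_tendstoI)
    fix a :: ennreal assume "0 < a"
    then obtain e where e: "e > 0" "ennreal e < a"
    proof (cases a)
      case (real r)
      with \<open>0 < a\<close> that[of "r / 2"] show ?thesis by (simp add: ennreal_less_iff)
    next
      case top
      with that[of 1] show ?thesis by simp
    qed
    from A[rule_format, OF e(1)] show "\<forall>\<^sub>F n in sequentially. outer_measure_of M (A n) < a"
    proof eventually_elim
      case (elim n)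
      then obtain E where E: "E \<in> sets M" "A n \<subseteq> E" "measure M E \<le> e" by auto
      then have "outer_measure_of M (A n) \<le> ennreal e"
        using outer_measure_of_mono[OF E(2), of M] by (auto simp: emeasure_eq_measure intro: order_trans ennreal_leI)
      with e show ?case by (auto intro: le_less_trans)
    qed
  qed simp
qed

lemma (in finite_measure) vanishing_Un:
  assumes "vanishing M A" "vanishing M B" shows "vanishing M (\<lambda>n. A n \<union> B n)"
  unfolding vanishing_iff
proof (intro allI impI)
  fix e :: real assume "e > 0"
  then have "e / 2 > 0" by simp
  with assms have "\<forall>\<^sub>F n in sequentially. \<exists>E\<in>sets M. A n \<subseteq> E \<and> measure M E \<le> e / 2"
    "\<forall>\<^sub>F n in sequentially. \<exists>E\<in>sets M. B n \<subseteq> E \<and> measure M E \<le> e / 2"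
    unfolding vanishing_iff by blast+
  then show "\<forall>\<^sub>F n in sequentially. \<exists>E\<in>sets M. A n \<union> B n \<subseteq> E \<and> measure M E \<le> e"
  proof eventually_elim
    case (elim n)
    then obtain E F where EF: "E \<in> sets M" "A n \<subseteq> E" "measure M E \<le> e / 2"
      "F \<in> sets M" "B n \<subseteq> F" "measure M F \<le> e / 2" by blast
    then have "measure M (E \<union> F) \<le> e" using measure_Un_le[of E M F] by simp
    with EF show ?case by (intro bexI[of _ "E \<union> F"]) auto
  qed
qed

lemma vanishing_mono:
  assumes "vanishing M B" "\<forall>\<^sub>F n in sequentially. A n \<subseteq> B n" shows "vanishing M A"
  unfolding vanishing_def
proof (rule tendsto_sandwich[OF _ _ tendsto_const assms(1)[unfolded vanishing_def]])
  show "\<forall>\<^sub>F n in sequentially. outer_measure_of M (A n) \<le> outer_measure_of M (B n)"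
    using assms(2) by eventually_elim (rule outer_measure_of_mono)
qed simp

lemma vanishing_empty: "vanishing M (\<lambda>n. {})"
  by (simp add: vanishing_def)

lemma (in finite_measure) vanishing_UN:
  assumes "finite I" "\<And>i. i \<in> I \<Longrightarrow> vanishing M (A i)"
  shows "vanishing M (\<lambda>n. \<Union>i\<in>I. A i n)"
  using assms by (induction I rule: finite_induct) (simp_all add: vanishing_empty vanishing_Un)

lemma tends_to_0_in_prob_iff:
  "tends_to_0_in_prob M X \<longleftrightarrow> (\<forall>e>0. vanishing M (\<lambda>n. {\<omega>\<in>space M. \<bar>X n \<omega>\<bar> > e}))"
  by (simp add: tends_to_0_in_prob_def vanishing_def)

text \<open>\<open>u + w\<close> is an admissible majorant of \<open>g\<close>, and every majorant
  dominates \<open>u - w\<close>. This is the only way in which outer expectations of non-measurable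
  maps are evaluated below.\<close>

lemma outer_expectation_close:
  assumes g: "\<And>\<omega>. \<omega> \<in> space M \<Longrightarrow> \<bar>g \<omega> - u \<omega>\<bar> \<le> w \<omega>"
    and [simp]: "integrable M u" "integrable M w"
  shows "\<bar>outer_expectation M g - integral\<^sup>L M u\<bar> \<le> integral\<^sup>L M w"
proof -
  let ?S = "{integral\<^sup>L M U | U. integrable M U \<and> (\<forall>\<omega>\<in>space M. g \<omega> \<le> U \<omega>)}"
  have mem: "integral\<^sup>L M (\<lambda>\<omega>. u \<omega> + w \<omega>) \<in> ?S"
    using g by (intro CollectI exI[of _ "\<lambda>\<omega>. u \<omega> + w \<omega>"]) (fastforce simp: abs_le_iff)
  have lower: "integral\<^sup>L M (\<lambda>\<omega>. u \<omega> - w \<omega>) \<le> x" if "x \<in> ?S" for x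
  proof -
    from that obtain U where U: "x = integral\<^sup>L M U" "integrable M U"
      "\<And>\<omega>. \<omega> \<in> space M \<Longrightarrow> g \<omega> \<le> U \<omega>" by blast
    have "u \<omega> - w \<omega> \<le> U \<omega>" if "\<omega> \<in> space M" for \<omega>
      using U(3)[OF that] g[OF that] by linarith
    then show ?thesis unfolding U(1) by (intro integral_mono U(2)) auto
  qed
  have "bdd_below ?S" using lower by (rule bdd_belowI)
  from cInf_lower[OF mem this] have "Inf ?S \<le> integral\<^sup>L M u + integral\<^sup>L M w" by simp
  moreover from mem have "?S \<noteq> {}" by blast
  from cInf_greatest[OF this lower] have "integral\<^sup>L M u - integral\<^sup>L M w \<le> Inf ?S" by simp
  ultimately show ?thesis unfolding outer_expectation_def by linarith
qed

lemma (in prob_space) norm_tail_small: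
  fixes Z :: "'a \<Rightarrow> 'b::{real_normed_vector, second_countable_topology}"
  assumes [measurable]: "Z \<in> borel_measurable M" and "e > 0"
  shows "\<exists>R. measure M {\<omega>\<in>space M. norm (Z \<omega>) > R} \<le> e"
proof -
  define A where "A k = {\<omega>\<in>space M. norm (Z \<omega>) > real k}" for k :: nat
  have "(\<lambda>k. measure M (A k)) \<longlonglongrightarrow> measure M (\<Inter>k. A k)"
    by (rule finite_Lim_measure_decseq) (auto simp: A_def decseq_def intro: le_less_trans)
  also have "(\<Inter>k. A k) = {}"
  proof (intro equals0I)
    fix \<omega> assume \<omega>: "\<omega> \<in> (\<Inter>k. A k)"
    obtain k where "norm (Z \<omega>) < real k" using reals_Archimedean2 by blast
    moreover from \<omega> have "real k < norm (Z \<omega>)" unfolding A_def by blast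
    ultimately show False by simp
  qed
  finally have "\<forall>\<^sub>F k in sequentially. measure M (A k) < e"
    using \<open>e > 0\<close> by (intro order_tendstoD(2)) auto
  then obtain k where "measure M (A k) < e" by (auto simp: eventually_sequentially)
  then show ?thesis unfolding A_def by (intro exI[of _ "real k"]) simp
qed

lemma (in prob_space)
  fixes d C :: real assumes [simp]: "E \<in> sets M"
  shows integrable_affine_indicator: "integrable M (\<lambda>\<omega>. d + C * indicator E \<omega>)"
    and integral_affine_indicator: "(\<integral>\<omega>. d + C * indicator E \<omega> \<partial>M) = d + C * measure M E"
proof -
  have int: "integrable M (\<lambda>\<omega>. C * indicator E \<omega>)"
    by (intro integrable_mult_right integrable_real_indicator) (simp_all add: emeasure_eq_measure)
  show "integrable M (\<lambda>\<omega>. d + C * indicator E \<omega>)"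
    by (rule Bochner_Integration.integrable_add[OF integrable_const int])
  show "(\<integral>\<omega>. d + C * indicator E \<omega> \<partial>M) = d + C * measure M E"
    by (subst Bochner_Integration.integral_add[OF integrable_const int]) (simp add: prob_space)
qed

lemma (in prob_space) integral_approx_off_small_set:
  fixes f g :: "'a \<Rightarrow> real"
  assumes [simp]: "integrable M f" "integrable M g" "E \<in> sets M"
    and "\<And>\<omega>. \<omega> \<in> space M \<Longrightarrow> \<omega> \<notin> E \<Longrightarrow> \<bar>f \<omega> - g \<omega>\<bar> \<le> d"
    and "\<And>\<omega>. \<omega> \<in> space M \<Longrightarrow> \<bar>f \<omega> - g \<omega>\<bar> \<le> C"
    and "d \<ge> 0" "C \<ge> 0"
  shows "\<bar>integral\<^sup>L M f - integral\<^sup>L M g\<bar> \<le> d + C * measure M E"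
proof -
  have "\<bar>integral\<^sup>L M f - integral\<^sup>L M g\<bar> = \<bar>\<integral>\<omega>. f \<omega> - g \<omega> \<partial>M\<bar>" by simp
  also have "\<dots> \<le> (\<integral>\<omega>. \<bar>f \<omega> - g \<omega>\<bar> \<partial>M)" by (rule integral_abs_bound)
  also have "\<dots> \<le> (\<integral>\<omega>. d + C * indicator E \<omega> \<partial>M)"
  proof (intro integral_mono integrable_affine_indicator)
    show "\<bar>f \<omega> - g \<omega>\<bar> \<le> d + C * indicator E \<omega>" if "\<omega> \<in> space M" for \<omega>
      using assms(4)[OF that] assms(5)[OF that] assms(6,7) by (cases "\<omega> \<in> E") simp_all
  qed simp_all
  also have "\<dots> = d + C * measure M E" by (rule integral_affine_indicator) simp
  finally show ?thesis .
qed

text \<open>The measurable maps \<open>S\<close> carry all integrals; \<open>X\<close> enters only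
  through its distance from \<open>S\<close>. Convergence for cosines extends to trigonometric
  polynomials by linearity, and from there to \<open>h\<close> by approximation on a large ball,
  with tightness bounding what happens outside.\<close>

lemma weakly_converges_if_trig:
  fixes S X :: "nat \<Rightarrow> 'w \<Rightarrow> 'a::euclidean_space"
  assumes M: "prob_space M" and N: "prob_space N" "sets N = sets borel"
    and S [measurable]: "\<And>n. S n \<in> borel_measurable M"
    and cos: "\<And>t b. (\<lambda>n. \<integral>\<omega>. cos (t \<bullet> S n \<omega> + b) \<partial>M) \<longlonglongrightarrow> (\<integral>z. cos (t \<bullet> z + b) \<partial>N)"
    and tight: "\<And>e. e > 0 \<Longrightarrow> \<exists>R. \<forall>n. measure M {\<omega>\<in>space M. norm (S n \<omega>) > R} \<le> e"
    and near: "\<And>d. d > 0 \<Longrightarrow> vanishing M (\<lambda>n. {\<omega>\<in>space M. norm (X n \<omega> - S n \<omega>) > d})"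
  shows "weakly_converges euclidean M X N"
  unfolding weakly_converges_def
proof (intro allI impI)
  interpret M: prob_space M by fact
  interpret N: prob_space N by fact
  note [measurable_cong] = N(2)
  have trig_int: "integrable M (\<lambda>\<omega>. f (S n \<omega>))" "integrable N f" if f: "trig_poly f" for f n
  proof -
    note [measurable] = trig_measurable[OF f]
    obtain B where "\<And>x. \<bar>f x\<bar> \<le> B" using trig_bounded[OF f] by blast
    then show "integrable M (\<lambda>\<omega>. f (S n \<omega>))" "integrable N f"
      by (auto intro!: M.integrable_const_bound[where B = B] N.integrable_const_bound[where B = B])
  qed
  have trig_conv: "(\<lambda>n. \<integral>\<omega>. f (S n \<omega>) \<partial>M) \<longlonglongrightarrow> (\<integral>z. f z \<partial>N)" if "trig_poly f" for f
    using that
  proof (induction rule: trig_poly.induct)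
    case (trig_add f g)
    then show ?case
      by (simp add: trig_int tendsto_add)
  qed (simp add: cos tendsto_mult_left)
  fix h :: "'a \<Rightarrow> real"
  assume "continuous_map euclidean euclideanreal h \<and> bounded (h ` topspace euclidean)"
  then have h: "continuous_on UNIV h" and "bounded (range h)" by simp_all
  then obtain B where "\<And>x. \<bar>h x\<bar> \<le> B" by (auto simp: bounded_iff)
  then obtain B where B: "\<And>x. \<bar>h x\<bar> \<le> B" "B \<ge> 0" by (meson abs_ge_zero order_trans)
  have [measurable]: "h \<in> borel_measurable borel" by (intro borel_measurable_continuous_onI h)
  have h_int: "integrable N h" by (rule N.integrable_const_bound[where B = B]) (auto simp: B)
  \<comment> \<open>The constant adds up \<open>2 * B + 2\<close> for replacing \<open>h\<close> by
    \<open>f\<close> under \<open>N\<close>, 1 for the convergence with \<open>f\<close>, and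
    \<open>4 * B + 4\<close> for the outer expectation.\<close>
  have close: "\<forall>\<^sub>F n in sequentially.
      \<bar>outer_expectation M (\<lambda>\<omega>. h (X n \<omega>)) - integral\<^sup>L N h\<bar> \<le> (6 * B + 7) * e"
    if e: "0 < e" "e \<le> 1" for e
  proof -
    obtain R1 where R1: "\<And>n. measure M {\<omega>\<in>space M. norm (S n \<omega>) > R1} \<le> e" using tight[OF e(1)] by blast
    obtain R2 where R2: "measure N {z\<in>space N. norm z > R2} \<le> e"
      using N.norm_tail_small[of "\<lambda>z. z" e] e(1) by auto
    \<comment> \<open>The extra 1 keeps \<open>X n \<omega>\<close> in the ball when it is within
      \<open>d \<le> 1\<close> of an \<open>S n \<omega>\<close> of norm at most
      \<open>R1\<close>.\<close>
    define R where "R = max R1 R2 + 1"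
    obtain f where f: "trig_poly f" "\<And>x. x \<in> cball 0 R \<Longrightarrow> \<bar>h x - f x\<bar> \<le> e" "\<And>x. \<bar>f x\<bar> \<le> B + e"
      using trig_approx[OF h B(1) compact_cball[of 0 R] e(1)] by blast
    obtain L where L: "L \<ge> 0" "\<And>x y. \<bar>f x - f y\<bar> \<le> L * norm (x - y)" using trig_Lipschitz[OF f(1)] by blast
    \<comment> \<open>Crude bound for the exceptional sets, where the two arguments are
      unrelated.\<close>
    have hf: "\<bar>h x - f y\<bar> \<le> 2 * B + 1" for x y using B(1)[of x] f(3)[of y] e by linarith
    \<comment> \<open>\<open>L + 1\<close> instead of \<open>L\<close> avoids dividing by zero when
      \<open>f\<close> is constant.\<close>
    define d where "d = min 1 (e / (L + 1))"
    have d: "d > 0" "d \<le> 1" "L * d \<le> e"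
    proof -
      show "d > 0" "d \<le> 1" using e L(1) by (simp_all add: d_def)
      have "L * d \<le> L * (e / (L + 1))" using L(1) by (intro mult_left_mono) (simp_all add: d_def)
      also have "\<dots> \<le> e" using L(1) e by (simp add: field_simps)
      finally show "L * d \<le> e" .
    qed
    have "\<bar>integral\<^sup>L N h - integral\<^sup>L N f\<bar> \<le> e + (2 * B + 1) * measure N {z\<in>space N. norm z > R2}"
      by (rule N.integral_approx_off_small_set[OF h_int trig_int(2)[OF f(1)]])
        (use e B(2) in \<open>auto intro!: f(2) hf simp: R_def\<close>)
    also have "\<dots> \<le> e + (2 * B + 1) * e" using R2 B(2) by (intro add_left_mono mult_left_mono) auto
    finally have N_close: "\<bar>integral\<^sup>L N h - integral\<^sup>L N f\<bar> \<le> (2 * B + 2) * e" by (simp add: algebra_simps)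
    have "\<forall>\<^sub>F n in sequentially. \<bar>(\<integral>\<omega>. f (S n \<omega>) \<partial>M) - integral\<^sup>L N f\<bar> < e"
      using tendstoD[OF trig_conv[OF f(1)] e(1)] by (simp add: dist_real_def)
    moreover have "\<forall>\<^sub>F n in sequentially. \<exists>E\<in>sets M. {\<omega>\<in>space M. norm (X n \<omega> - S n \<omega>) > d} \<subseteq> E \<and> measure M E \<le> e"
      using near[OF d(1)] e(1) unfolding M.vanishing_iff by blast
    ultimately show ?thesis
    proof eventually_elim
      case (elim n)
      then obtain E where E: "E \<in> sets M" "{\<omega>\<in>space M. norm (X n \<omega> - S n \<omega>) > d} \<subseteq> E" "measure M E \<le> e"
        by blast
      define E' where "E' = E \<union> {\<omega>\<in>space M. norm (S n \<omega>) > R1}"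
      have E': "E' \<in> sets M" using E(1) by (simp add: E'_def)
      have "measure M E' \<le> 2 * e"
        unfolding E'_def using measure_Un_le[of E M "{\<omega>\<in>space M. norm (S n \<omega>) > R1}"] E(1,3) R1[of n] by simp
      have "\<bar>h (X n \<omega>) - f (S n \<omega>)\<bar> \<le> 2 * e + (2 * B + 1) * indicator E' \<omega>" if \<omega>: "\<omega> \<in> space M" for \<omega>
      proof (cases "\<omega> \<in> E'")
        case True
        then show ?thesis using hf[of "X n \<omega>" "S n \<omega>"] e by simp
      next
        case False
        with \<omega> E(2) have *: "norm (X n \<omega> - S n \<omega>) \<le> d" "norm (S n \<omega>) \<le> R1" by (auto simp: E'_def)
        then have "norm (X n \<omega>) \<le> R"
          using norm_triangle_sub[of "X n \<omega>" "S n \<omega>"] d(2) by (simp add: R_def)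
        then have "\<bar>h (X n \<omega>) - f (X n \<omega>)\<bar> \<le> e" by (intro f(2)) simp
        moreover have "\<bar>f (X n \<omega>) - f (S n \<omega>)\<bar> \<le> e"
          using L(2)[of "X n \<omega>" "S n \<omega>"] mult_left_mono[OF *(1) L(1)] d(3) by linarith
        ultimately show ?thesis using False by simp
      qed
      then have "\<bar>outer_expectation M (\<lambda>\<omega>. h (X n \<omega>)) - (\<integral>\<omega>. f (S n \<omega>) \<partial>M)\<bar>
          \<le> (\<integral>\<omega>. 2 * e + (2 * B + 1) * indicator E' \<omega> \<partial>M)"
        by (rule outer_expectation_close[OF _ trig_int(1)[OF f(1)] M.integrable_affine_indicator[OF E']])
      also have "\<dots> = 2 * e + (2 * B + 1) * measure M E'"
        by (rule M.integral_affine_indicator[OF E'])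
      also have "\<dots> \<le> 2 * e + (2 * B + 1) * (2 * e)"
        using \<open>measure M E' \<le> 2 * e\<close> B(2) by (intro add_left_mono mult_left_mono) auto
      finally have "\<bar>outer_expectation M (\<lambda>\<omega>. h (X n \<omega>)) - (\<integral>\<omega>. f (S n \<omega>) \<partial>M)\<bar> \<le> 4 * (B * e) + 4 * e"
        by (simp add: algebra_simps)
      with elim(1) N_close show ?case by (simp add: algebra_simps)
    qed
  qed
  show "(\<lambda>n. outer_expectation M (\<lambda>\<omega>. h (X n \<omega>))) \<longlonglongrightarrow> integral\<^sup>L N h"
  proof (rule tendstoI)
    fix e :: real assume e: "e > 0"
    define e' where "e' = min 1 (e / (2 * (6 * B + 7)))"
    have "(6 * B + 7) * e' \<le> (6 * B + 7) * (e / (2 * (6 * B + 7)))"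
      using B(2) by (intro mult_left_mono) (simp_all add: e'_def)
    also have "\<dots> = e / 2" using B(2) by (simp add: field_simps)
    finally have "(6 * B + 7) * e' < e" using e by simp
    moreover have "0 < e'" "e' \<le> 1" using e B(2) by (simp_all add: e'_def)
    from close[OF this] have "\<forall>\<^sub>F n in sequentially.
      \<bar>outer_expectation M (\<lambda>\<omega>. h (X n \<omega>)) - integral\<^sup>L N h\<bar> \<le> (6 * B + 7) * e'" .
    ultimately show "\<forall>\<^sub>F n in sequentially. dist (outer_expectation M (\<lambda>\<omega>. h (X n \<omega>))) (integral\<^sup>L N h) < e"
      by (auto elim!: eventually_mono simp: dist_real_def)
  qed
qed

text \<open>Centered independent summands are orthogonal. Integrability is proved in the same
  induction because the cross term can be split off only once the earlier square is
  integrable.\<close>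

lemma (in prob_space) second_moment_indep_sum:
  fixes Y :: "nat \<Rightarrow> 'a \<Rightarrow> real"
  assumes indep: "indep_vars (\<lambda>_. borel) Y UNIV"
    and mean: "\<And>i. expectation (Y i) = 0"
    and sq: "\<And>i. integrable M (\<lambda>\<omega>. (Y i \<omega>)\<^sup>2)"
    and var: "\<And>i. expectation (\<lambda>\<omega>. (Y i \<omega>)\<^sup>2) = v"
  shows "integrable M (\<lambda>\<omega>. (\<Sum>i<n. Y i \<omega>)\<^sup>2) \<and> expectation (\<lambda>\<omega>. (\<Sum>i<n. Y i \<omega>)\<^sup>2) = real n * v"
proof -
  have [measurable]: "Y i \<in> borel_measurable M" for i
    using indep unfolding indep_vars_def2 by simp
  have int: "integrable M (Y i)" for i
    by (rule square_integrable_imp_integrable[OF _ sq]) simp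
  show ?thesis
  proof (induction n)
    case (Suc n)
    have "indep_vars (\<lambda>_. borel) Y (insert n {..<n})" by (rule indep_vars_subset[OF indep]) simp
    from indep_vars_sum[OF _ _ this]
    have iv: "indep_var borel (Y n) borel (\<lambda>\<omega>. \<Sum>i<n. Y i \<omega>)" by simp
    have 1: "integrable M (\<lambda>\<omega>. Y n \<omega> * (\<Sum>i<n. Y i \<omega>))"
      by (rule indep_var_integrable[OF iv]) (simp_all add: int)
    have 2: "expectation (\<lambda>\<omega>. Y n \<omega> * (\<Sum>i<n. Y i \<omega>)) = 0"
      by (subst indep_var_lebesgue_integral[OF iv]) (simp_all add: int mean)
    have eq: "(\<Sum>i<Suc n. Y i \<omega>)\<^sup>2 = (\<Sum>i<n. Y i \<omega>)\<^sup>2 + 2 * (Y n \<omega> * (\<Sum>i<n. Y i \<omega>)) + (Y n \<omega>)\<^sup>2" for \<omega>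
      by (simp add: power2_eq_square algebra_simps)
    have 3: "integrable M (\<lambda>\<omega>. (\<Sum>i<n. Y i \<omega>)\<^sup>2 + 2 * (Y n \<omega> * (\<Sum>i<n. Y i \<omega>)))"
      using Suc 1 by (intro Bochner_Integration.integrable_add integrable_mult_right) auto
    have "expectation (\<lambda>\<omega>. (\<Sum>i<n. Y i \<omega>)\<^sup>2 + 2 * (Y n \<omega> * (\<Sum>i<n. Y i \<omega>))) = real n * v + 2 * 0"
      unfolding 2[symmetric] integral_mult_right_zero[symmetric]
      by (subst Bochner_Integration.integral_add) (use Suc 1 in auto)
    then have "expectation (\<lambda>\<omega>. (\<Sum>i<n. Y i \<omega>)\<^sup>2 + 2 * (Y n \<omega> * (\<Sum>i<n. Y i \<omega>)) + (Y n \<omega>)\<^sup>2)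
        = real (Suc n) * v"
      by (subst Bochner_Integration.integral_add[OF 3 sq]) (simp add: var algebra_simps)
    with 3 sq show ?case unfolding eq by simp
  qed simp
qed

section \<open>A multivariate central limit theorem\<close>

lemma integrable_mult_if_squares:
  fixes f g :: "'a \<Rightarrow> real"
  assumes [measurable]: "f \<in> borel_measurable M" "g \<in> borel_measurable M"
    and sq: "integrable M (\<lambda>x. (f x)\<^sup>2)" "integrable M (\<lambda>x. (g x)\<^sup>2)"
  shows "integrable M (\<lambda>x. f x * g x)"
proof (rule Bochner_Integration.integrable_bound[OF Bochner_Integration.integrable_add[OF sq]])
  have "\<bar>f x * g x\<bar> \<le> (f x)\<^sup>2 + (g x)\<^sup>2" for x
  proof -
    have "0 \<le> (\<bar>f x\<bar> - \<bar>g x\<bar>)\<^sup>2" "0 \<le> \<bar>f x\<bar> * \<bar>g x\<bar>" by simp_all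
    then show ?thesis unfolding power2_diff abs_mult power2_abs by linarith
  qed
  then show "AE x in M. norm (f x * g x) \<le> norm ((f x)\<^sup>2 + (g x)\<^sup>2)" by simp
qed simp

text \<open>The classical theorem divides by \<open>\<sigma>\<close>. The degenerate case is kept
  because a singular covariance has projections of zero variance; there all summands vanish almost
  surely.\<close>

lemma (in prob_space) clt_char:
  fixes Y :: "nat \<Rightarrow> 'a \<Rightarrow> real"
  assumes indep: "indep_vars (\<lambda>_. borel) Y UNIV"
    and distr: "\<And>i. distr M borel (Y i) = \<mu>"
    and mean: "\<And>i. expectation (Y i) = 0"
    and sq: "\<And>i. integrable M (\<lambda>\<omega>. (Y i \<omega>)\<^sup>2)"
    and var: "\<And>i. expectation (\<lambda>\<omega>. (Y i \<omega>)\<^sup>2) = \<sigma>\<^sup>2"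
    and \<sigma>: "\<sigma> \<ge> 0"
  shows "(\<lambda>n. CLINT \<omega>|M. iexp ((\<Sum>i<n. Y i \<omega>) / sqrt (real n))) \<longlonglongrightarrow> complex_of_real (exp (- \<sigma>\<^sup>2 / 2))"
proof (cases "\<sigma> = 0")
  case True
  have [measurable]: "Y i \<in> borel_measurable M" for i
    using indep unfolding indep_vars_def2 by simp
  have "AE \<omega> in M. (Y i \<omega>)\<^sup>2 = 0" for i
    using integral_nonneg_eq_0_iff_AE[OF sq[of i]] var[of i] True by simp
  then have "AE \<omega> in M. \<forall>i. Y i \<omega> = 0" by (simp add: AE_all_countable)
  then have "(CLINT \<omega>|M. iexp ((\<Sum>i<n. Y i \<omega>) / sqrt (real n))) = (CLINT \<omega>|M. 1)" for n
    by (intro integral_cong_AE) (auto elim!: eventually_mono)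
  then show ?thesis using True by (simp add: prob_space)
next
  case False
  with \<sigma> have \<sigma>: "\<sigma> > 0" by simp
  have [measurable]: "Y i \<in> borel_measurable M" for i
    using indep unfolding indep_vars_def2 by simp
  have "weak_conv_m (\<lambda>n. distr M borel (\<lambda>\<omega>. (\<Sum>i<n. Y i \<omega>) / sqrt (real n * \<sigma>\<^sup>2))) std_normal_distribution"
    by (rule central_limit_theorem_zero_mean[OF indep mean \<sigma> sq _ distr]) (simp add: mean var)
  \<comment> \<open>Evaluating the characteristic functions at \<open>\<sigma>\<close> undoes the
    standardization.\<close>
  then have "(\<lambda>n. char (distr M borel (\<lambda>\<omega>. (\<Sum>i<n. Y i \<omega>) / sqrt (real n * \<sigma>\<^sup>2))) \<sigma>)
      \<longlonglongrightarrow> char std_normal_distribution \<sigma>"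
    by (intro levy_continuity1) (auto intro!: real_dist_normal_dist)
  moreover have "char (distr M borel (\<lambda>\<omega>. (\<Sum>i<n. Y i \<omega>) / sqrt (real n * \<sigma>\<^sup>2))) \<sigma>
      = (CLINT \<omega>|M. iexp ((\<Sum>i<n. Y i \<omega>) / sqrt (real n)))" for n
    unfolding char_def using \<sigma> by (subst integral_distr) (simp_all add: real_sqrt_mult)
  ultimately show ?thesis by (simp add: char_std_normal_distribution)
qed

lemma cos_integral_via_iexp:
  assumes "prob_space N" and [measurable]: "u \<in> borel_measurable N"
  shows "(\<integral>x. cos (u x + b) \<partial>N) = Re (iexp b * (CLINT x|N. iexp (u x)))"
proof -
  interpret prob_space N by fact
  have "integrable N (\<lambda>x. iexp (u x))"
    by (rule integrable_const_bound[where B = 1]) auto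
  then have int: "integrable N (\<lambda>x. iexp b * iexp (u x))" by (rule integrable_mult_right)
  have "(\<integral>x. cos (u x + b) \<partial>N) = (\<integral>x. Re (iexp b * iexp (u x)) \<partial>N)"
    by (intro Bochner_Integration.integral_cong refl)
      (simp add: exp_add[symmetric] Re_exp add.commute)
  also have "\<dots> = Re (CLINT x|N. iexp b * iexp (u x))"
    by (rule integral_Re[OF int])
  also have "\<dots> = Re (iexp b * (CLINT x|N. iexp (u x)))" by (simp only: integral_mult_right_zero)
  finally show ?thesis .
qed

text \<open>Cramer-Wold device: the projection on \<open>t\<close> is a normalized sum with variance
  \<open>(norm (t v* L))\<^sup>2\<close>, and \<open>t\<close> paired with \<open>L *v z\<close>
  equals \<open>t v* L\<close> paired with \<open>z\<close>, so the limits of the characteristic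
  functions agree. \<open>Z\<close> need only be near the sums, which admits non-measurable
  estimators.\<close>

theorem (in prob_space) clt_vec:
  fixes X :: "nat \<Rightarrow> 'a \<Rightarrow> real ^ 'n" and L :: "real ^ 'n ^ 'n"
  assumes indep: "indep_vars (\<lambda>_. borel) X UNIV"
    and distr: "\<And>i. distr M borel (X i) = \<mu>"
    and mean: "\<And>i j. expectation (\<lambda>\<omega>. X i \<omega> $ j) = 0"
    and sq: "\<And>i j. integrable M (\<lambda>\<omega>. (X i \<omega> $ j)\<^sup>2)"
    and L: "\<And>i j k. (L ** transpose L) $ j $ k = expectation (\<lambda>\<omega>. X i \<omega> $ j * X i \<omega> $ k)"
    and near: "\<And>d. d > 0 \<Longrightarrow>
      vanishing M (\<lambda>n. {\<omega>\<in>space M. norm (Z n \<omega> - (1 / sqrt (real n)) *\<^sub>R (\<Sum>i<n. X i \<omega>)) > d})"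
  shows "weakly_converges euclidean M Z (distr std_normal_vec borel (\<lambda>z. 0 + L *v z))"
proof (rule weakly_converges_if_trig[OF prob_space_axioms _ _ _ _ _ near])
  have X [measurable]: "X i \<in> borel_measurable M" for i
    using indep unfolding indep_vars_def2 by simp
  interpret std: prob_space "std_normal_vec :: (real ^ 'n) measure" by (rule prob_space_std_normal_vec)
  note [measurable_cong] = sets_std_normal_vec
  have [measurable]: "(\<lambda>z. L *v z) \<in> borel_measurable borel"
    by (intro borel_measurable_continuous_onI linear_continuous_on matrix_vector_mul_bounded_linear)
  let ?S = "\<lambda>n \<omega>. (1 / sqrt (real n)) *\<^sub>R (\<Sum>i<n. X i \<omega>)"
  let ?N = "distr std_normal_vec borel (\<lambda>z. 0 + L *v z)"
  show N: "prob_space ?N" by (rule std.prob_space_distr) simp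
  show "sets ?N = sets borel" by simp
  show "?S n \<in> borel_measurable M" for n by simp
  have [measurable]: "(\<lambda>\<omega>. X i \<omega> $ j) \<in> borel_measurable M" for i j
    using borel_measurable_inner[OF X[of i] borel_measurable_const[of "axis j 1"]] by (simp add: inner_axis)
  have int: "integrable M (\<lambda>\<omega>. X i \<omega> $ j)" for i j
    by (rule square_integrable_imp_integrable[OF _ sq]) simp
  have int2: "integrable M (\<lambda>\<omega>. X i \<omega> $ j * X i \<omega> $ k)" for i j k
    by (rule integrable_mult_if_squares) (simp_all add: sq)
  {
    fix t
    define Y where "Y i \<omega> = t \<bullet> X i \<omega>" for i \<omega>
    have Y_indep: "indep_vars (\<lambda>_. borel) Y UNIV"
      unfolding Y_def by (rule indep_vars_compose2[OF indep]) simp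
    have "distr M borel (Y i) = distr \<mu> borel (\<lambda>x. t \<bullet> x)" for i
      unfolding Y_def distr[of i, symmetric] by (subst distr_distr) (simp_all add: comp_def)
    note Y_distr = this
    have Y_mean: "expectation (Y i) = 0" for i
      unfolding Y_def inner_vec_def by (simp add: int mean)
    have Y_sq_eq: "(Y i \<omega>)\<^sup>2 = (\<Sum>j\<in>UNIV. \<Sum>k\<in>UNIV. t $ j * t $ k * (X i \<omega> $ j * X i \<omega> $ k))" for i \<omega>
      by (simp add: Y_def inner_vec_def power2_eq_square sum_product algebra_simps)
    have Y_sq: "integrable M (\<lambda>\<omega>. (Y i \<omega>)\<^sup>2)" for i
      unfolding Y_sq_eq by (intro Bochner_Integration.integrable_sum integrable_mult_right int2)
    have Y_var: "expectation (\<lambda>\<omega>. (Y i \<omega>)\<^sup>2) = (norm (t v* L))\<^sup>2" for i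
    proof -
      have "expectation (\<lambda>\<omega>. (Y i \<omega>)\<^sup>2) = (\<Sum>j\<in>UNIV. \<Sum>k\<in>UNIV. t $ j * t $ k * (L ** transpose L) $ j $ k)"
        unfolding Y_sq_eq by (simp add: int2 L[of _ _ i])
      also have "\<dots> = t \<bullet> ((L ** transpose L) *v t)"
        by (simp add: inner_vec_def matrix_vector_mult_def sum_distrib_left algebra_simps)
      also have "\<dots> = (t v* L) \<bullet> (t v* L)"
        by (simp add: matrix_vector_mul_assoc[symmetric] dot_lmul_matrix)
      finally show ?thesis by (simp add: dot_square_norm)
    qed
    have Y_sum: "t \<bullet> ?S n \<omega> = (\<Sum>i<n. Y i \<omega>) / sqrt (real n)" for n \<omega>
      by (simp add: Y_def inner_sum_right)
    note Y = Y_indep Y_distr Y_mean Y_sq Y_var Y_sum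
  }
  note Y = this
  show "(\<lambda>n. \<integral>\<omega>. cos (t \<bullet> ?S n \<omega> + b) \<partial>M) \<longlonglongrightarrow> (\<integral>z. cos (t \<bullet> z + b) \<partial>?N)" for t b
  proof -
    have "(\<integral>z. cos (t \<bullet> z + b) \<partial>?N) = (\<integral>z. cos ((t v* L) \<bullet> z + b) \<partial>std_normal_vec)"
      by (subst integral_distr) (simp_all add: dot_lmul_matrix)
    also have "\<dots> = Re (iexp b * complex_of_real (exp (- (norm (t v* L))\<^sup>2 / 2)))"
      by (subst cos_integral_via_iexp[OF prob_space_std_normal_vec])
        (simp_all only: char_std_normal_vec, simp)
    finally have N_eq: "(\<integral>z. cos (t \<bullet> z + b) \<partial>?N)
      = Re (iexp b * complex_of_real (exp (- (norm (t v* L))\<^sup>2 / 2)))" .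
    have "(\<lambda>n. Re (iexp b * (CLINT \<omega>|M. iexp (t \<bullet> ?S n \<omega>)))) \<longlonglongrightarrow>
        Re (iexp b * complex_of_real (exp (- (norm (t v* L))\<^sup>2 / 2)))"
      unfolding Y(6) by (intro tendsto_Re tendsto_mult_left clt_char[OF Y(1-5)]) simp
    moreover have "(\<integral>\<omega>. cos (t \<bullet> ?S n \<omega> + b) \<partial>M) = Re (iexp b * (CLINT \<omega>|M. iexp (t \<bullet> ?S n \<omega>)))" for n
      by (rule cos_integral_via_iexp[OF prob_space_axioms]) simp
    ultimately show ?thesis unfolding N_eq by simp
  qed
  show "\<exists>R. \<forall>n. measure M {\<omega>\<in>space M. norm (?S n \<omega>) > R} \<le> e" if e: "e > 0" for e
  proof -
    \<comment> \<open>The trace of \<open>L ** transpose L\<close>, that is, the second moment of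
      the norm of each \<open>X i\<close>.\<close>
    define c where "c = (\<Sum>j\<in>UNIV. (norm (axis j 1 v* L))\<^sup>2)"
    have c: "c \<ge> 0" by (simp add: c_def sum_nonneg)
    \<comment> \<open>Markov's inequality then gives \<open>c * e / (c + 1)\<close>, which is at
      most \<open>e\<close>; adding 1 keeps \<open>R\<close> positive if
      \<open>c = 0\<close>.\<close>
    define R where "R = sqrt ((c + 1) / e)"
    have R: "R > 0" "R\<^sup>2 = (c + 1) / e" using c e by (simp_all add: R_def)
    have "measure M {\<omega>\<in>space M. norm (?S n \<omega>) > R} \<le> e" for n
    proof -
      have nth: "?S n \<omega> $ j = axis j 1 \<bullet> ?S n \<omega>" for \<omega> j by (simp add: inner_axis')
      \<comment> \<open>Only an inequality, since for \<open>n = 0\<close> the normalized sum is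
        0.\<close>
      have sqj: "integrable M (\<lambda>\<omega>. (?S n \<omega> $ j)\<^sup>2) \<and> expectation (\<lambda>\<omega>. (?S n \<omega> $ j)\<^sup>2) \<le> (norm (axis j 1 v* L))\<^sup>2" for j
        using second_moment_indep_sum[OF Y(1,3,4,5), of "axis j 1" n]
        unfolding nth Y(6) power_divide by (cases "n = 0") simp_all
      have norm_vec: "(norm v)\<^sup>2 = (\<Sum>j\<in>UNIV. (v $ j)\<^sup>2)" for v :: "real ^ 'n"
        unfolding norm_vec_def L2_set_def by (simp add: sum_nonneg)
      note norm_eq = norm_vec[of "?S n _"]
      have int: "integrable M (\<lambda>\<omega>. (norm (?S n \<omega>))\<^sup>2)"
        unfolding norm_eq using sqj by (intro Bochner_Integration.integrable_sum) blast
      have "expectation (\<lambda>\<omega>. (norm (?S n \<omega>))\<^sup>2) = (\<Sum>j\<in>UNIV. expectation (\<lambda>\<omega>. (?S n \<omega> $ j)\<^sup>2))"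
        unfolding norm_eq using sqj by (intro Bochner_Integration.integral_sum) blast
      also have "\<dots> \<le> c" unfolding c_def using sqj by (intro sum_mono) blast
      finally have E: "expectation (\<lambda>\<omega>. (norm (?S n \<omega>))\<^sup>2) \<le> c" .
      have "measure M {\<omega>\<in>space M. norm (?S n \<omega>) > R} \<le> measure M {\<omega>\<in>space M. (norm (?S n \<omega>))\<^sup>2 \<ge> R\<^sup>2}"
        using R(1) by (intro finite_measure_mono) (auto intro!: power_mono)
      also have "\<dots> \<le> expectation (\<lambda>\<omega>. (norm (?S n \<omega>))\<^sup>2) / R\<^sup>2"
        by (rule integral_Markov_inequality_measure[OF int sets.empty_sets]) (use R(1) in auto)
      also have "\<dots> \<le> c / R\<^sup>2" using E by (intro divide_right_mono) auto
      also have "\<dots> \<le> e" unfolding R(2) using c e by (simp add: field_simps)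
      finally show ?thesis .
    qed
    then show ?thesis by blast
  qed
qed

section \<open>Asymptotic equicontinuity over a Donsker class\<close>

text \<open>Tightness puts most of the limit mass on a compact, hence totally bounded, set. A
  continuous test function that separates its net from distant points transfers this to
  \<open>X n\<close>. The exceptional sets come out measurable although \<open>X n\<close> need not
  be.\<close>

lemma tight_limit_net:
  assumes G: "tight_borel_prob (mtopology_of m) G" and G_conv: "weakly_converges (mtopology_of m) M X G"
    and M: "prob_space M"
    and X: "\<And>n \<omega>. \<omega> \<in> space M \<Longrightarrow> X n \<omega> \<in> mspace m"
    and e: "e > 0" and \<eta>: "\<eta> > 0"
  shows "\<exists>Z. finite Z \<and> Z \<subseteq> mspace m \<and> (\<forall>\<^sub>F n in sequentially. \<exists>E\<in>sets M. measure M E \<le> \<eta> \<and>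
    (\<forall>\<omega>\<in>space M - E. \<exists>z\<in>Z. mdist m z (X n \<omega>) < 2 * e))"
proof -
  interpret M: prob_space M by fact
  interpret G: prob_space G using G by (simp add: tight_borel_prob_def)
  interpret m: Metric_space "mspace m" "mdist m" by (rule Metric_space_mspace_mdist)
  obtain K where K: "K \<in> sets G" "compactin (mtopology_of m) K" "measure G K \<ge> 1 - \<eta> / 2"
    using G \<eta> unfolding tight_borel_prob_def by (meson half_gt_zero)
  have "m.mtotally_bounded K"
    using K(2) by (intro m.compactin_imp_mtotally_bounded) (simp add: mtopology_of_def)
  from this[unfolded m.mtotally_bounded_def, rule_format, OF e]
  obtain Z where Z: "finite Z" "Z \<subseteq> K" "K \<subseteq> (\<Union>z\<in>Z. m.mball z e)" by blast
  have Zm: "Z \<subseteq> mspace m" using Z(2) compactin_subset_topspace[OF K(2)] by auto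
  \<comment> \<open>Each factor rises from 0 at distance \<open>e\<close> to 1 at distance
    \<open>2 * e\<close>, so \<open>h\<close> vanishes near any net point and equals 1 only away
    from all of them.\<close>
  define h where "h x = (\<Prod>z\<in>Z. min 1 (max 0 (mdist m z x / e - 1)))" for x
  have h01: "0 \<le> h x" "h x \<le> 1" for x
    unfolding h_def by (auto intro!: prod_nonneg prod_le_1)
  have h_small: "\<exists>z\<in>Z. mdist m z x < 2 * e" if "h x < 1" for x
  proof (rule ccontr)
    assume "\<not> ?thesis"
    then have "h x = (\<Prod>z\<in>Z. 1)"
      unfolding h_def using e by (intro prod.cong refl) (auto simp: not_less min_def max_def field_simps)
    with that show False by simp
  qed
  have h_K: "h x = 0" if "x \<in> K" for x
  proof -
    from that Z(3) obtain z where "z \<in> Z" "mdist m z x < e" by (auto simp: m.in_mball)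
    then show ?thesis unfolding h_def using Z(1) e by (auto intro!: prod_zero bexI[of _ z])
  qed
  have cont: "continuous_map (mtopology_of m) euclideanreal (\<lambda>x. mdist m z x)" if "z \<in> Z" for z
  proof -
    have "continuous_map (mtopology_of m) (mtopology_of euclidean_metric) (mdist m z)"
    proof (rule Lipschitz_continuous_imp_continuous_map)
      have "dist (mdist m z x) (mdist m z y) \<le> 1 * mdist m x y" if "x \<in> mspace m" "y \<in> mspace m" for x y
        using m.triangle[of z x y] m.triangle[of z y x] m.commute[of x y] that \<open>z \<in> Z\<close> Zm
        by (auto simp: dist_real_def subset_iff abs_le_iff)
      then show "Lipschitz_continuous_map m euclidean_metric (mdist m z)"
        unfolding Lipschitz_continuous_map_def mdist_euclidean_metric mspace_euclidean_metric by blast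
    qed
    then show ?thesis by simp
  qed
  have "continuous_map (mtopology_of m) euclideanreal h"
    unfolding h_def
    by (intro continuous_map_prod[OF Z(1)] continuous_map_real_min continuous_map_real_max
        continuous_map_diff continuous_map_real_divide cont) (use e in auto)
  moreover have "bounded (h ` topspace (mtopology_of m))"
    using h01 by (auto simp: bounded_iff intro!: exI[of _ 1])
  ultimately have conv: "(\<lambda>n. outer_expectation M (\<lambda>\<omega>. h (X n \<omega>))) \<longlonglongrightarrow> integral\<^sup>L G h"
    using G_conv unfolding weakly_converges_def by blast
  have "integral\<^sup>L G h \<le> \<eta> / 2"
  \<comment> \<open>A non-integrable \<open>h\<close> would have integral 0 by default, and the
    bound holds again.\<close>
  proof (cases "integrable G h")
    case True
    have "integral\<^sup>L G h \<le> (\<integral>x. indicator (space G - K) x \<partial>G)"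
    proof (intro integral_mono True integrable_real_indicator)
      show "h x \<le> indicator (space G - K) x" if "x \<in> space G" for x
        using that h01(2)[of x] h_K[of x] by (cases "x \<in> K") simp_all
    qed (use K(1) in \<open>auto simp: G.emeasure_eq_measure\<close>)
    also have "\<dots> = measure G (space G - K)" using K(1) by simp
    also have "\<dots> = 1 - measure G K" by (rule G.prob_compl[OF K(1)])
    finally show ?thesis using K(3) by simp
  qed (use \<eta> in \<open>simp add: not_integrable_integral_eq\<close>)
  then have "integral\<^sup>L G h < \<eta>" using \<eta> by simp
  with conv have "\<forall>\<^sub>F n in sequentially. outer_expectation M (\<lambda>\<omega>. h (X n \<omega>)) < \<eta>"
    by (rule order_tendstoD(2))
  then have "\<forall>\<^sub>F n in sequentially. \<exists>E\<in>sets M. measure M E \<le> \<eta> \<and>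
    (\<forall>\<omega>\<in>space M - E. \<exists>z\<in>Z. mdist m z (X n \<omega>) < 2 * e)"
  proof eventually_elim
    case (elim n)
    let ?S = "{integral\<^sup>L M U | U. integrable M U \<and> (\<forall>\<omega>\<in>space M. h (X n \<omega>) \<le> U \<omega>)}"
    have "integral\<^sup>L M (\<lambda>\<omega>. 1) \<in> ?S"
      using h01 by (intro CollectI exI[of _ "\<lambda>\<omega>. 1"]) simp
    then have "?S \<noteq> {}" by blast
    from cInf_lessD[OF this elim[unfolded outer_expectation_def]]
    obtain U where U: "integrable M U" "\<And>\<omega>. \<omega> \<in> space M \<Longrightarrow> h (X n \<omega>) \<le> U \<omega>" "integral\<^sup>L M U < \<eta>"
      by blast
    \<comment> \<open>\<open>U\<close> is an integrable majorant, so its superlevel set is a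
      measurable cover of the event that \<open>h (X n \<omega>)\<close> reaches 1; Markov's
      inequality bounds it.\<close>
    define E where "E = {\<omega>\<in>space M. U \<omega> \<ge> 1}"
    have "measure M E \<le> integral\<^sup>L M U / 1"
      unfolding E_def using h01(1) U(1,2)
      by (intro integral_Markov_inequality_measure[OF _ sets.empty_sets]) (auto intro: order_trans)
    then have "measure M E \<le> \<eta>" using U(3) by simp
    moreover have "E \<in> sets M" unfolding E_def using borel_measurable_integrable[OF U(1)] by measurable
    moreover have "\<exists>z\<in>Z. mdist m z (X n \<omega>) < 2 * e" if "\<omega> \<in> space M - E" for \<omega>
      using that U(2)[of \<omega>] by (intro h_small) (auto simp: E_def)
    ultimately show ?case by blast
  qed
  with Z(1) Zm show ?thesis by blast
qed

lemma empirical_process_eq_sum: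
  assumes "n > 0"
  shows "empirical_process P n x f = (1 / sqrt (real n)) * (\<Sum>i<n. f (x i) - (\<integral>z. f z \<partial>P))"
proof -
  define N where "N = sqrt (real n)"
  have N: "N \<noteq> 0" "real n = N * N" using assms by (simp_all add: N_def)
  have eq: "(\<Sum>i<n. f (x i) - (\<integral>z. f z \<partial>P)) = (\<Sum>i<n. f (x i)) - N * N * (\<integral>z. f z \<partial>P)"
    by (simp add: sum_subtractf N(2))
  show ?thesis
    unfolding empirical_process_def eq N_def[symmetric] unfolding N(2) using N(1) by (simp add: field_simps)
qed

text \<open>The process is a finite combination of centered values at sample points, so a pointwise
  envelope of the centered class suffices.\<close>

lemma empirical_process_in_funspace:
  assumes "\<And>z. z \<in> space P \<Longrightarrow> bdd_above ((\<lambda>f. \<bar>f z - (\<integral>z'. f z' \<partial>P)\<bar>) ` F)"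
    and x: "\<And>i. x i \<in> space P"
  shows "restrict (empirical_process P n x) F \<in> mspace (funspace F euclidean_metric)"
proof -
  have "\<exists>B. \<forall>f\<in>F. \<bar>f z - (\<integral>z'. f z' \<partial>P)\<bar> \<le> B" if "z \<in> space P" for z
    using assms(1)[OF that] by (auto simp: bdd_above_def)
  then obtain B where B: "\<And>z f. z \<in> space P \<Longrightarrow> f \<in> F \<Longrightarrow> \<bar>f z - (\<integral>z'. f z' \<partial>P)\<bar> \<le> B z"
    by metis
  have "\<exists>C. \<forall>f\<in>F. \<bar>empirical_process P n x f\<bar> \<le> C"
  proof (cases "n > 0")
    case True
    have "\<bar>empirical_process P n x f\<bar> \<le> (1 / sqrt (real n)) * (\<Sum>i<n. B (x i))" if "f \<in> F" for f
      unfolding empirical_process_eq_sum[OF True] abs_mult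
      using B[OF x that] by (intro mult_mono order_trans[OF sum_abs] sum_mono) (auto intro!: sum_nonneg)
    then show ?thesis by blast
  qed (auto simp: empirical_process_def)
  then obtain C where C: "\<And>f. f \<in> F \<Longrightarrow> \<bar>empirical_process P n x f\<bar> \<le> C" by blast
  have "Met_TC.mbounded (restrict (empirical_process P n x) F ` F)"
    unfolding Met_TC.mbounded_def by (intro exI[of _ 0] exI[of _ C]) (auto simp: dist_real_def C)
  then show ?thesis by (simp add: Met_TC.fspace_def)
qed

lemma funspace_dist_le:
  assumes "z \<in> mspace (funspace F euclidean_metric)" "y \<in> mspace (funspace F euclidean_metric)" "f \<in> F"
  shows "\<bar>z f - y f :: real\<bar> \<le> mdist (funspace F euclidean_metric) z y"
proof -
  have zy: "z \<in> Met_TC.fspace F" "y \<in> Met_TC.fspace F" using assms by simp_all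
  have "dist (z f) (y f) \<le> Sup ((\<lambda>f. dist (z f) (y f)) ` F)"
    using assms(3) by (intro cSup_upper Met_TC.bdd_above_dist zy) auto
  then show ?thesis using zy assms(3) by (auto simp: Met_TC.fdist_def dist_real_def)
qed

lemma funspace_bounded:
  assumes "z \<in> mspace (funspace F euclidean_metric)"
  shows "\<exists>B. \<forall>f\<in>F. \<bar>z f :: real\<bar> \<le> B"
proof -
  have "Met_TC.mbounded (z ` F)" using assms by (simp add: Met_TC.fspace_def)
  then obtain c B where "z ` F \<subseteq> cball c B" unfolding Met_TC.mbounded_def by auto
  then have "dist c (z f) \<le> B" if "f \<in> F" for f using that by auto
  then have "\<bar>z f\<bar> \<le> \<bar>c\<bar> + B" if "f \<in> F" for f using that by (force simp: dist_real_def)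
  then show ?thesis by blast
qed

text \<open>The label \<open>c f\<close> lists the values of the net functions at \<open>f\<close>,
  rounded to a grid of width \<open>d\<close>; it takes finitely many values because each net
  function is bounded. It depends neither on \<open>n\<close> nor on the sample, so representatives
  of the cells can be fixed in advance.\<close>

lemma donsker_finite_partition:
  fixes P :: "'o measure"
  assumes D: "donsker_class P F" and P: "prob_space P" and e: "e > 0" and \<eta>: "\<eta> > 0"
  shows "\<exists>c :: ('o \<Rightarrow> real) \<Rightarrow> (('o \<Rightarrow> real) \<Rightarrow> real) \<Rightarrow> int. finite (c ` F) \<and>
    (\<forall>\<^sub>F n in sequentially. \<exists>E\<in>sets (\<Pi>\<^sub>M i\<in>(UNIV :: nat set). P). measure (\<Pi>\<^sub>M i\<in>UNIV. P) E \<le> \<eta> \<and>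
      (\<forall>x\<in>space (\<Pi>\<^sub>M i\<in>UNIV. P) - E. \<forall>f\<in>F. \<forall>g\<in>F. c f = c g \<longrightarrow>
        \<bar>empirical_process P n x f - empirical_process P n x g\<bar> < e))"
proof -
  let ?Pi = "\<Pi>\<^sub>M i\<in>(UNIV :: nat set). P"
  let ?m = "funspace F (euclidean_metric :: real metric)"
  interpret Pi: prob_space ?Pi by (intro prob_space_PiM P)
  \<comment> \<open>Two distances of \<open>2 * d\<close> to a net function and one grid width
    \<open>d\<close>.\<close>
  define d where "d = e / 5"
  have d: "d > 0" using e by (simp add: d_def)
  obtain G where G: "tight_borel_prob (mtopology_of ?m) G"
    "weakly_converges (mtopology_of ?m) ?Pi (\<lambda>n x. restrict (empirical_process P n x) F) G"
    using D unfolding donsker_class_def by blast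
  have emp: "restrict (empirical_process P n x) F \<in> mspace ?m" if "x \<in> space ?Pi" for n x
    using D that unfolding donsker_class_def
    by (intro empirical_process_in_funspace) (auto simp: space_PiM)
  obtain Z where Z: "finite Z" "Z \<subseteq> mspace ?m" and
    near: "\<forall>\<^sub>F n in sequentially. \<exists>E\<in>sets ?Pi. measure ?Pi E \<le> \<eta> \<and>
    (\<forall>x\<in>space ?Pi - E. \<exists>z\<in>Z. mdist ?m z (restrict (empirical_process P n x) F) < 2 * d)"
    using tight_limit_net[OF G Pi.prob_space_axioms emp d \<eta>] by blast
  define c where "c f = (\<lambda>z\<in>Z. \<lfloor>z f / d\<rfloor>)" for f
  have "finite (c ` F)"
  proof -
    have "\<exists>B. \<forall>f\<in>F. \<bar>z f\<bar> \<le> B" if "z \<in> Z" for z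
      using funspace_bounded Z(2) that by blast
    then obtain B where B: "\<And>z f. z \<in> Z \<Longrightarrow> f \<in> F \<Longrightarrow> \<bar>z f\<bar> \<le> B z" by metis
    have "c f \<in> (\<Pi>\<^sub>E z\<in>Z. {\<lfloor>- B z / d\<rfloor>..\<lfloor>B z / d\<rfloor>})" if "f \<in> F" for f
      unfolding c_def restrict_PiE_iff
    proof
      fix z assume "z \<in> Z"
      then have "- B z \<le> z f" "z f \<le> B z" using B[of z, OF _ that] by (simp_all add: abs_le_iff)
      then show "\<lfloor>z f / d\<rfloor> \<in> {\<lfloor>- B z / d\<rfloor>..\<lfloor>B z / d\<rfloor>}"
        using d unfolding atLeastAtMost_iff by (intro conjI floor_mono divide_right_mono) simp_all
    qed
    then have "c ` F \<subseteq> (\<Pi>\<^sub>E z\<in>Z. {\<lfloor>- B z / d\<rfloor>..\<lfloor>B z / d\<rfloor>})" by blast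
    then show ?thesis by (rule finite_subset) (intro finite_PiE Z(1) finite_atLeastAtMost_int)
  qed
  moreover have "\<forall>\<^sub>F n in sequentially. \<exists>E\<in>sets ?Pi. measure ?Pi E \<le> \<eta> \<and>
      (\<forall>x\<in>space ?Pi - E. \<forall>f\<in>F. \<forall>g\<in>F. c f = c g \<longrightarrow>
        \<bar>empirical_process P n x f - empirical_process P n x g\<bar> < e)"
    using near
  proof eventually_elim
    case (elim n)
    then obtain E where E: "E \<in> sets ?Pi" "measure ?Pi E \<le> \<eta>" and
      Ez: "\<And>x. x \<in> space ?Pi - E \<Longrightarrow> \<exists>z\<in>Z. mdist ?m z (restrict (empirical_process P n x) F) < 2 * d"
      by blast
    have "\<bar>empirical_process P n x f - empirical_process P n x g\<bar> < e"
      if x: "x \<in> space ?Pi - E" and fg: "f \<in> F" "g \<in> F" "c f = c g" for x f g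
    proof -
      obtain z where z: "z \<in> Z" "mdist ?m z (restrict (empirical_process P n x) F) < 2 * d"
        using Ez[OF x] by blast
      have "\<bar>z h - empirical_process P n x h\<bar> < 2 * d" if "h \<in> F" for h
        using funspace_dist_le[OF _ emp that, of z x n] z x Z(2) that by auto
      note this[OF fg(1)] this[OF fg(2)]
      moreover have "\<lfloor>z f / d\<rfloor> = \<lfloor>z g / d\<rfloor>"
        using fun_cong[OF fg(3), of z] z(1) by (simp add: c_def)
      then have "\<bar>z f / d - z g / d\<bar> < 1" by linarith
      then have "\<bar>z f - z g\<bar> < d" using d by (simp add: diff_divide_distrib[symmetric] abs_divide)
      ultimately show ?thesis unfolding d_def by linarith
    qed
    with E show ?case by blast
  qed
  ultimately show ?thesis by blast
qed

text \<open>For a fixed \<open>f\<close>, in contrast to a data-dependent one, the event is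
  measurable and the process has variance at most the second moment of \<open>f\<close>.\<close>

lemma (in prob_space) chebyshev_empirical_process:
  fixes obs :: "nat \<Rightarrow> 'a \<Rightarrow> 'o"
  assumes P: "prob_space P" and indep: "indep_vars (\<lambda>_. P) obs UNIV" and ident: "\<And>i. distr M P (obs i) = P"
    and f [measurable]: "f \<in> borel_measurable P" and sq: "integrable P (\<lambda>z. (f z)\<^sup>2)"
    and n: "n > 0" and e: "e > 0"
  shows "{\<omega>\<in>space M. \<bar>empirical_process P n (\<lambda>i. obs i \<omega>) f\<bar> \<ge> e} \<in> sets M"
    and "measure M {\<omega>\<in>space M. \<bar>empirical_process P n (\<lambda>i. obs i \<omega>) f\<bar> \<ge> e} \<le> (\<integral>z. (f z)\<^sup>2 \<partial>P) / e\<^sup>2"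
proof -
  interpret P: prob_space P by fact
  have obs [measurable]: "obs i \<in> measurable M P" for i
    using indep unfolding indep_vars_def2 by simp
  define p where "p = (\<integral>z. f z \<partial>P)"
  define Y where "Y i \<omega> = f (obs i \<omega>) - p" for i \<omega>
  have int: "integrable P f" by (rule P.square_integrable_imp_integrable[OF f sq])
  have tr: "integrable M (\<lambda>\<omega>. g (obs i \<omega>)) \<longleftrightarrow> integrable P g" "expectation (\<lambda>\<omega>. g (obs i \<omega>)) = (\<integral>z. g z \<partial>P)"
    if [measurable]: "g \<in> borel_measurable P" for g :: "'o \<Rightarrow> real" and i
    using integrable_distr_eq[OF obs that, of i] integral_distr[OF obs that, of i] by (simp_all add: ident)
  have Y_indep: "indep_vars (\<lambda>_. borel) Y UNIV"
    unfolding Y_def by (rule indep_vars_compose2[OF indep]) simp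
  have Y_mean: "expectation (Y i) = 0" for i
    unfolding Y_def using tr[OF f, of i] int by (simp add: p_def prob_space)
  have sq': "integrable P (\<lambda>z. (f z - p)\<^sup>2)"
    unfolding power2_diff using sq int by simp
  have Y_sq: "integrable M (\<lambda>\<omega>. (Y i \<omega>)\<^sup>2)" "expectation (\<lambda>\<omega>. (Y i \<omega>)\<^sup>2) = (\<integral>z. (f z - p)\<^sup>2 \<partial>P)" for i
    unfolding Y_def using tr[of "\<lambda>z. (f z - p)\<^sup>2" i] sq' by simp_all
  have v: "(\<integral>z. (f z - p)\<^sup>2 \<partial>P) \<le> (\<integral>z. (f z)\<^sup>2 \<partial>P)"
    using P.variance_eq[OF int sq] by (simp add: p_def)
  have emp: "empirical_process P n (\<lambda>i. obs i \<omega>) f = (1 / sqrt (real n)) * (\<Sum>i<n. Y i \<omega>)" for \<omega>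
    unfolding empirical_process_eq_sum[OF n] Y_def p_def ..
  have [measurable]: "(\<lambda>\<omega>. empirical_process P n (\<lambda>i. obs i \<omega>) f) \<in> borel_measurable M"
    unfolding emp Y_def by measurable
  show "{\<omega>\<in>space M. \<bar>empirical_process P n (\<lambda>i. obs i \<omega>) f\<bar> \<ge> e} \<in> sets M" by measurable
  have emp2: "(empirical_process P n (\<lambda>i. obs i \<omega>) f)\<^sup>2 = (\<Sum>i<n. Y i \<omega>)\<^sup>2 / real n" for \<omega>
    unfolding emp by (simp add: power_mult_distrib power_divide)
  note S = second_moment_indep_sum[OF Y_indep Y_mean Y_sq(1) Y_sq(2), of n]
  have int_S: "integrable M (\<lambda>\<omega>. (empirical_process P n (\<lambda>i. obs i \<omega>) f)\<^sup>2)"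
    unfolding emp2 using S by simp
  have E: "expectation (\<lambda>\<omega>. (empirical_process P n (\<lambda>i. obs i \<omega>) f)\<^sup>2) = (\<integral>z. (f z - p)\<^sup>2 \<partial>P)"
    unfolding emp2 using S n by simp
  have "measure M {\<omega>\<in>space M. \<bar>empirical_process P n (\<lambda>i. obs i \<omega>) f\<bar> \<ge> e}
      \<le> measure M {\<omega>\<in>space M. (empirical_process P n (\<lambda>i. obs i \<omega>) f)\<^sup>2 \<ge> e\<^sup>2}"
    using e by (intro finite_measure_mono) (auto simp: abs_le_square_iff[symmetric])
  also have "\<dots> \<le> expectation (\<lambda>\<omega>. (empirical_process P n (\<lambda>i. obs i \<omega>) f)\<^sup>2) / e\<^sup>2"
    by (rule integral_Markov_inequality_measure[OF int_S sets.empty_sets]) (use e in auto)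
  also have "\<dots> \<le> (\<integral>z. (f z)\<^sup>2 \<partial>P) / e\<^sup>2"
    unfolding E using v by (intro divide_right_mono) auto
  finally show "measure M {\<omega>\<in>space M. \<bar>empirical_process P n (\<lambda>i. obs i \<omega>) f\<bar> \<ge> e} \<le> (\<integral>z. (f z)\<^sup>2 \<partial>P) / e\<^sup>2" .
qed

text \<open>Chebyshev's inequality cannot be applied to a random function, but the cell of that
  function is one of finitely many, and each relevant cell has a representative chosen independently
  of the sample. The random function is compared with it by the small oscillation within
  cells.\<close>

theorem (in prob_space) donsker_asymptotic_equicontinuity:
  fixes obs :: "nat \<Rightarrow> 'a \<Rightarrow> 'o"
  assumes P: "prob_space P" and indep: "indep_vars (\<lambda>_. P) obs UNIV" and ident: "\<And>i. distr M P (obs i) = P"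
    and D: "donsker_class P F"
    and in_F: "vanishing M (\<lambda>n. {\<omega>\<in>space M. fhat n \<omega> \<notin> F})"
    and L2: "\<And>d. d > 0 \<Longrightarrow> vanishing M (\<lambda>n. {\<omega>\<in>space M. (\<integral>z. (fhat n \<omega> z)\<^sup>2 \<partial>P) > d})"
    and e: "e > 0"
  shows "vanishing M (\<lambda>n. {\<omega>\<in>space M. \<bar>empirical_process P n (\<lambda>i. obs i \<omega>) (fhat n \<omega>)\<bar> > e})"
  unfolding vanishing_iff
proof (intro allI impI)
  fix \<eta> :: real assume \<eta>: "\<eta> > 0"
  let ?Pi = "\<Pi>\<^sub>M i\<in>(UNIV :: nat set). P"
  have obs [measurable]: "obs i \<in> measurable M P" for i
    using indep unfolding indep_vars_def2 by simp
  have obs_Pi [measurable]: "(\<lambda>\<omega> i. obs i \<omega>) \<in> measurable M ?Pi"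
    by (rule measurable_PiM_single') (auto dest: measurable_space[OF obs])
  \<comment> \<open>The Donsker property concerns coordinate projections on the product space; this
    identity carries its exceptional sets over to \<open>M\<close>.\<close>
  have distr_Pi: "distr M ?Pi (\<lambda>\<omega> i. obs i \<omega>) = ?Pi"
    using indep_vars_iff_distr_eq_PiM[of UNIV obs "\<lambda>_. P"] indep by (simp add: ident restrict_UNIV)
  obtain c :: "('o \<Rightarrow> real) \<Rightarrow> (('o \<Rightarrow> real) \<Rightarrow> real) \<Rightarrow> int" where c: "finite (c ` F)" and
    osc: "\<forall>\<^sub>F n in sequentially. \<exists>E\<in>sets ?Pi. measure ?Pi E \<le> \<eta> / 4 \<and>
      (\<forall>x\<in>space ?Pi - E. \<forall>f\<in>F. \<forall>g\<in>F. c f = c g \<longrightarrow>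
        \<bar>empirical_process P n x f - empirical_process P n x g\<bar> < e / 2)"
    using donsker_finite_partition[OF D P, of "e / 2" "\<eta> / 4"] e \<eta> by auto
  define N where "N = real (card (c ` F)) + 1"
  have N: "N > 0" by (simp add: N_def)
  \<comment> \<open>Chebyshev at level \<open>e / 2\<close> costs
    \<open>4 * \<tau> / e\<^sup>2\<close> for each representative, hence at most
    \<open>\<eta> / 4\<close> for \<open>N\<close> of them.\<close>
  define \<tau> where "\<tau> = \<eta> * e\<^sup>2 / (16 * N)"
  have \<tau>: "\<tau> > 0" using \<eta> e N by (simp add: \<tau>_def)
  define J where "J = {k \<in> c ` F. \<exists>f\<in>F. c f = k \<and> (\<integral>z. (f z)\<^sup>2 \<partial>P) \<le> \<tau>}"
  have J: "finite J" "real (card J) \<le> N"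
    using c card_mono[OF c, of J] unfolding J_def N_def by auto
  have "\<exists>f\<in>F. c f = k \<and> (\<integral>z. (f z)\<^sup>2 \<partial>P) \<le> \<tau>" if "k \<in> J" for k using that by (simp add: J_def)
  then obtain r where r: "\<And>k. k \<in> J \<Longrightarrow> r k \<in> F" "\<And>k. k \<in> J \<Longrightarrow> c (r k) = k"
    "\<And>k. k \<in> J \<Longrightarrow> (\<integral>z. (r k z)\<^sup>2 \<partial>P) \<le> \<tau>" by metis
  have "\<eta> / 4 > 0" using \<eta> by simp
  with in_F L2[OF \<tau>] have
    "\<forall>\<^sub>F n in sequentially. \<exists>E\<in>sets M. {\<omega>\<in>space M. fhat n \<omega> \<notin> F} \<subseteq> E \<and> measure M E \<le> \<eta> / 4"
    "\<forall>\<^sub>F n in sequentially. \<exists>E\<in>sets M. {\<omega>\<in>space M. (\<integral>z. (fhat n \<omega> z)\<^sup>2 \<partial>P) > \<tau>} \<subseteq> E \<and> measure M E \<le> \<eta> / 4"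
    unfolding vanishing_iff by blast+
  with osc eventually_gt_at_top[of 0]
  show "\<forall>\<^sub>F n in sequentially. \<exists>E\<in>sets M.
      {\<omega>\<in>space M. \<bar>empirical_process P n (\<lambda>i. obs i \<omega>) (fhat n \<omega>)\<bar> > e} \<subseteq> E \<and> measure M E \<le> \<eta>"
  proof eventually_elim
    case (elim n)
    obtain E0 where E0: "E0 \<in> sets ?Pi" "measure ?Pi E0 \<le> \<eta> / 4"
      "\<And>x f g. x \<in> space ?Pi \<Longrightarrow> x \<notin> E0 \<Longrightarrow> f \<in> F \<Longrightarrow> g \<in> F \<Longrightarrow> c f = c g \<Longrightarrow>
        \<bar>empirical_process P n x f - empirical_process P n x g\<bar> < e / 2"
      using elim(1) by blast
    obtain E1 where E1: "E1 \<in> sets M" "{\<omega>\<in>space M. fhat n \<omega> \<notin> F} \<subseteq> E1" "measure M E1 \<le> \<eta> / 4"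
      using elim(3) by blast
    obtain E2 where E2: "E2 \<in> sets M" "{\<omega>\<in>space M. (\<integral>z. (fhat n \<omega> z)\<^sup>2 \<partial>P) > \<tau>} \<subseteq> E2"
      "measure M E2 \<le> \<eta> / 4" using elim(4) by blast
    define E3 where "E3 = (\<lambda>\<omega> i. obs i \<omega>) -` E0 \<inter> space M"
    have E3: "E3 \<in> sets M" "measure M E3 \<le> \<eta> / 4"
      unfolding E3_def using measurable_sets[OF obs_Pi E0(1)] E0(2) measure_distr[OF obs_Pi E0(1)]
      by (simp_all add: distr_Pi)
    define A where "A k = {\<omega>\<in>space M. \<bar>empirical_process P n (\<lambda>i. obs i \<omega>) (r k)\<bar> \<ge> e / 2}" for k
    have A: "A k \<in> sets M \<and> measure M (A k) \<le> 4 * \<tau> / e\<^sup>2" if k: "k \<in> J" for k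
    proof -
      have rk: "r k \<in> borel_measurable P" "integrable P (\<lambda>z. (r k z)\<^sup>2)"
        using D r(1)[OF k] by (auto simp: donsker_class_def)
      have "measure M (A k) \<le> (\<integral>z. (r k z)\<^sup>2 \<partial>P) / (e / 2)\<^sup>2"
        unfolding A_def using elim(2) e by (intro chebyshev_empirical_process P indep ident rk) auto
      also have "\<dots> \<le> \<tau> / (e / 2)\<^sup>2" using r(3)[OF k] by (intro divide_right_mono) auto
      finally have "measure M (A k) \<le> 4 * \<tau> / e\<^sup>2" by (simp add: power_divide mult.commute)
      moreover have "A k \<in> sets M"
        unfolding A_def using elim(2) e by (intro chebyshev_empirical_process P indep ident rk) auto
      ultimately show ?thesis by simp
    qed
    define E4 where "E4 = (\<Union>k\<in>J. A k)"
    have E4_sets: "E4 \<in> sets M" unfolding E4_def using A J(1) by blast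
    have "measure M E4 \<le> (\<Sum>k\<in>J. measure M (A k))"
      unfolding E4_def using A by (intro finite_measure_subadditive_finite J(1)) blast
    also have "\<dots> \<le> (\<Sum>k\<in>J. 4 * \<tau> / e\<^sup>2)" using A by (intro sum_mono) blast
    also have "\<dots> \<le> N * (4 * \<tau> / e\<^sup>2)"
      using J(2) \<tau> by (simp add: mult_right_mono divide_right_mono)
    also have "\<dots> = \<eta> / 4" using N e by (simp add: \<tau>_def field_simps)
    finally have E4: "measure M E4 \<le> \<eta> / 4" .
    \<comment> \<open>Four causes of failure, each of measure at most \<open>\<eta> / 4\<close>:
      leaving the class, a large norm, large oscillation within a cell, a large value at some
      representative.\<close>
    define E where "E = E1 \<union> E2 \<union> (E3 \<union> E4)"
    have "measure M E \<le> measure M (E1 \<union> E2) + measure M (E3 \<union> E4)"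
      unfolding E_def using E1 E2 E3 E4_sets by (intro measure_Un_le) auto
    also have "\<dots> \<le> (measure M E1 + measure M E2) + (measure M E3 + measure M E4)"
      using E1 E2 E3 E4_sets by (intro add_mono measure_Un_le) auto
    also have "\<dots> \<le> \<eta>" using E1 E2 E3 E4 by simp
    finally have "measure M E \<le> \<eta>" .
    moreover have "E \<in> sets M" unfolding E_def using E1 E2 E3 E4_sets by auto
    moreover have "\<bar>empirical_process P n (\<lambda>i. obs i \<omega>) (fhat n \<omega>)\<bar> \<le> e"
      if \<omega>: "\<omega> \<in> space M" "\<omega> \<notin> E" for \<omega>
    proof -
      let ?f = "fhat n \<omega>"
      have f: "?f \<in> F" "(\<integral>z. (?f z)\<^sup>2 \<partial>P) \<le> \<tau>"
        using \<omega> E1(2) E2(2) by (auto simp: E_def not_less[symmetric])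
      then have k: "c ?f \<in> J" by (auto simp: J_def)
      have "(\<lambda>i. obs i \<omega>) \<notin> E0" using \<omega> by (auto simp: E_def E3_def)
      then have "\<bar>empirical_process P n (\<lambda>i. obs i \<omega>) ?f - empirical_process P n (\<lambda>i. obs i \<omega>) (r (c ?f))\<bar> < e / 2"
        using measurable_space[OF obs_Pi \<omega>(1)] by (intro E0(3) f(1) r(1)[OF k]) (simp_all add: r(2)[OF k])
      moreover have "\<bar>empirical_process P n (\<lambda>i. obs i \<omega>) (r (c ?f))\<bar> < e / 2"
        using \<omega> k by (auto simp: E_def E4_def A_def not_le)
      ultimately show ?thesis by linarith
    qed
    ultimately show ?case by (intro bexI[of _ E]) (auto simp: not_le[symmetric])
  qed
qed

section \<open>The efficient influence functions have mean zero\<close>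

text \<open>A function of \<open>f\<close> is measurable for the sigma-algebra generated by
  \<open>f\<close> and can be pulled out of the conditional expectation. This turns the almost sure
  identities of the model, with \<open>k\<close> the version it carries, into identities between
  integrals.\<close>

lemma (in prob_space) real_cond_exp_vimage:
  fixes g :: "'a \<Rightarrow> real"
  assumes f: "f \<in> measurable M N" and h: "h \<in> borel_measurable N"
    and [measurable]: "g \<in> borel_measurable M" and int: "integrable M (\<lambda>x. h (f x) * g x)"
    and ce: "AE x in M. real_cond_exp M (vimage_algebra (space M) f N) g x = k x"
    and [measurable]: "k \<in> borel_measurable M"
  shows "integrable M (\<lambda>x. h (f x) * k x)" "expectation (\<lambda>x. h (f x) * k x) = expectation (\<lambda>x. h (f x) * g x)"
proof -
  let ?F = "vimage_algebra (space M) f N"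
  have "subalgebra M ?F" using f by (simp add: subalgebra_def measurable_iff_sets)
  then interpret sigma_finite_subalgebra M ?F
    by (intro finite_measure_subalgebra_is_sigma_finite) (simp add: finite_measure_subalgebra_def
        finite_measure_subalgebra_axioms_def finite_measure_axioms)
  have "f \<in> measurable ?F N" using measurable_space[OF f] by (intro measurable_vimage_algebra1) auto
  then have hf: "(\<lambda>x. h (f x)) \<in> borel_measurable ?F" using h by (rule measurable_compose)
  have [measurable]: "(\<lambda>x. h (f x)) \<in> borel_measurable M" using f h by (rule measurable_compose)
  note I = real_cond_exp_intg[OF int hf]
  have ae: "AE x in M. h (f x) * real_cond_exp M ?F g x = h (f x) * k x" using ce by eventually_elim simp
  show "integrable M (\<lambda>x. h (f x) * k x)"
    using I(1) integrable_cong_AE[OF _ _ ae] by simp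
  show "expectation (\<lambda>x. h (f x) * k x) = expectation (\<lambda>x. h (f x) * g x)"
    using I(2) integral_cong_AE[OF _ _ ae] by simp
qed

lemma finite_arm: "finite (UNIV :: arm set)"
proof -
  have "UNIV = {Active, Control}" using arm.exhaust by auto
  then show ?thesis by (metis finite.emptyI finite_insert)
qed

lemma indicator_comp_measurable [measurable (raw)]:
  assumes "f \<in> measurable N (count_space UNIV)"
  shows "(\<lambda>x. indicator A (f x) :: real) \<in> borel_measurable N"
    and "(\<lambda>x. indicator A (f x) :: ennreal) \<in> borel_measurable N"
  by (rule measurable_compose[OF assms], simp)+

lemma (in prob_space) expectation_01:
  fixes f :: "'a \<Rightarrow> real"
  assumes "\<And>x. x \<in> space M \<Longrightarrow> 0 \<le> f x \<and> f x \<le> 1"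
  shows "0 \<le> expectation f" "expectation f \<le> 1"
proof -
  show "0 \<le> expectation f" using assms by (intro integral_nonneg_AE AE_I2) auto
  show "expectation f \<le> 1"
  proof (cases "integrable M f")
    case True
    then show ?thesis using integral_mono[OF True, of "\<lambda>_. 1"] assms by (simp add: prob_space)
  qed (simp add: not_integrable_integral_eq)
qed

lemma ennreal_integral_le_nn_integral:
  fixes f :: "'a \<Rightarrow> real" assumes "\<And>x. x \<in> space M \<Longrightarrow> 0 \<le> f x"
  shows "ennreal (integral\<^sup>L M f) \<le> (\<integral>\<^sup>+x. ennreal (f x) \<partial>M)"
proof (cases "integrable M f")
  case True
  then show ?thesis using assms by (subst nn_integral_eq_integral) auto
qed (simp add: not_integrable_integral_eq)

section \<open>Conditional laws of the observed data\<close>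

locale observed_law =
  fixes MC :: "'c measure" and mu1 :: "'m1 measure" and mu2 :: "'m2 measure"
    and L :: "('c, 'm1, 'm2) law"
  assumes mu1: "sigma_finite_measure mu1" and mu2: "sigma_finite_measure mu2"
    and L: "L \<in> model MC mu1 mu2"
begin

abbreviation "J \<equiv> joint L"
abbreviation "mu \<equiv> mu1 \<Otimes>\<^sub>M mu2"
abbreviation "kern \<equiv> QM12 mu1 mu2 L"

sublocale J: prob_space J using L by (simp add: model_def)
sublocale mu1: sigma_finite_measure mu1 by (rule mu1)
sublocale mu2: sigma_finite_measure mu2 by (rule mu2)
sublocale mu: pair_sigma_finite mu1 mu2 ..

lemma sets_J [measurable_cong]: "sets J = sets (obs_space MC mu1 mu2)"
  using L by (simp add: model_def)

lemma obs_measurable [measurable]: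
  "obs_C \<in> measurable J MC" "obs_A \<in> measurable J (count_space UNIV)" "obs_M1 \<in> measurable J mu1"
  "obs_M2 \<in> measurable J mu2" "obs_Y \<in> borel_measurable J"
  unfolding obs_C_def obs_A_def obs_M1_def obs_M2_def obs_Y_def measurable_cong_sets[OF sets_J refl]
    obs_space_def
  by (simp_all add: case_prod_beta')

lemma proper: "proper_versions MC mu1 mu2 L" and conds: "conditionals_of_joint MC mu1 mu2 L"
  using L by (simp_all add: model_def)

lemma ps_measurable [measurable (raw)]:
  "h \<in> measurable N MC \<Longrightarrow> (\<lambda>x. ps L t (h x)) \<in> borel_measurable N"
  using proper by (auto simp: proper_versions_def intro: measurable_compose)

lemma triple_measurable:
  assumes "(\<lambda>(m1, m2, c). F m1 m2 c) \<in> borel_measurable (mu1 \<Otimes>\<^sub>M mu2 \<Otimes>\<^sub>M MC)"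
    "f \<in> measurable N mu1" "g \<in> measurable N mu2" "h \<in> measurable N MC"
  shows "(\<lambda>x. F (f x) (g x) (h x)) \<in> borel_measurable N"
proof -
  have "(\<lambda>x. (f x, g x, h x)) \<in> measurable N (mu1 \<Otimes>\<^sub>M mu2 \<Otimes>\<^sub>M MC)" using assms(2-4) by measurable
  from measurable_compose[OF this assms(1)] show ?thesis by simp
qed

lemma med_dens_measurable [measurable (raw)]:
  "f \<in> measurable N mu1 \<Longrightarrow> g \<in> measurable N mu2 \<Longrightarrow> h \<in> measurable N MC \<Longrightarrow>
    (\<lambda>x. med_dens L t (f x) (g x) (h x)) \<in> borel_measurable N"
  using proper by (intro triple_measurable) (auto simp: proper_versions_def)

lemma out_reg_measurable [measurable (raw)]:
  "f \<in> measurable N mu1 \<Longrightarrow> g \<in> measurable N mu2 \<Longrightarrow> h \<in> measurable N MC \<Longrightarrow>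
    (\<lambda>x. out_reg L t (f x) (g x) (h x)) \<in> borel_measurable N"
  using proper by (intro triple_measurable) (auto simp: proper_versions_def)

lemma ps_nonneg: "c \<in> space MC \<Longrightarrow> 0 \<le> ps L t c"
  and ps_sum: "c \<in> space MC \<Longrightarrow> ps L Active c + ps L Control c = 1"
  and med_dens_nonneg: "c \<in> space MC \<Longrightarrow> m1 \<in> space mu1 \<Longrightarrow> m2 \<in> space mu2 \<Longrightarrow> 0 \<le> med_dens L t m1 m2 c"
  and kern_prob: "c \<in> space MC \<Longrightarrow> prob_space (kern t c)"
  and out_reg_01: "c \<in> space MC \<Longrightarrow> m1 \<in> space mu1 \<Longrightarrow> m2 \<in> space mu2 \<Longrightarrow>
    0 \<le> out_reg L t m1 m2 c \<and> out_reg L t m1 m2 c \<le> 1"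
  using proper unfolding proper_versions_def by (force simp: less_imp_le)+

lemma ps_le_1: "c \<in> space MC \<Longrightarrow> ps L t c \<le> 1"
  using ps_sum[of c] ps_nonneg[of c Active] ps_nonneg[of c Control] by (cases t) auto

lemma ps_pos: "AE z in J. 0 < ps L t (obs_C z)"
proof -
  have "AE z in J. 0 < ps L Active (obs_C z) \<and> ps L Active (obs_C z) < 1"
    using L by (simp add: model_def)
  then show ?thesis
  proof (rule AE_mp, intro AE_I2 impI)
    fix z assume "z \<in> space J" "0 < ps L Active (obs_C z) \<and> ps L Active (obs_C z) < 1"
    then show "0 < ps L t (obs_C z)"
      using ps_sum[OF measurable_space[OF obs_measurable(1)], of z] by (cases t) auto
  qed
qed

lemma Y_bounded: "AE z in J. \<bar>obs_Y z\<bar> \<le> 1"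
proof -
  have "AE z in J. obs_Y z \<in> {0<..<1}" using L by (simp add: model_def)
  then show ?thesis by eventually_elim auto
qed

lemma sets_kern [simp, measurable_cong]: "sets (kern t c) = sets mu"
  and space_kern [simp]: "space (kern t c) = space mu"
  by (simp_all add: QM12_def)

lemma integral_kern:
  fixes f :: "_ \<Rightarrow> real"
  assumes c [measurable]: "c \<in> space MC" and [measurable]: "f \<in> borel_measurable mu"
  shows "(\<integral>p. f p \<partial>kern t c) = (\<integral>p. med_dens L t (fst p) (snd p) c * f p \<partial>mu)"
proof -
  have "(\<integral>p. f p \<partial>kern t c) = (\<integral>p. med_dens L t (fst p) (snd p) c *\<^sub>R f p \<partial>mu)"
    unfolding QM12_def case_prod_beta' using med_dens_nonneg[OF c]
    by (intro integral_density) (auto simp: space_pair_measure)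
  then show ?thesis by simp
qed

lemma nn_integral_kern:
  assumes c [measurable]: "c \<in> space MC" and [measurable]: "f \<in> borel_measurable mu"
  shows "(\<integral>\<^sup>+p. f p \<partial>kern t c) = (\<integral>\<^sup>+p. ennreal (med_dens L t (fst p) (snd p) c) * f p \<partial>mu)"
  unfolding QM12_def case_prod_beta' by (rule nn_integral_density) measurable

lemma measure_kern_measurable [measurable]:
  assumes B [measurable]: "B \<in> sets mu"
  shows "(\<lambda>c. measure (kern t c) B) \<in> borel_measurable MC"
proof -
  have "emeasure (kern t c) B = (\<integral>\<^sup>+p. ennreal (med_dens L t (fst p) (snd p) c) * indicator B p \<partial>mu)"
    if [measurable]: "c \<in> space MC" for c
    unfolding nn_integral_kern[OF that borel_measurable_indicator[OF B], symmetric] by simp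
  then have "(\<lambda>c. measure (kern t c) B) \<in> borel_measurable MC \<longleftrightarrow>
      (\<lambda>c. enn2real (\<integral>\<^sup>+p. ennreal (med_dens L t (fst p) (snd p) c) * indicator B p \<partial>mu)) \<in> borel_measurable MC"
    by (intro measurable_cong) (simp add: measure_def)
  also have "\<dots>" by measurable
  finally show ?thesis .
qed

lemma propensity_expectation:
  fixes h :: "'c \<Rightarrow> real"
  assumes [measurable]: "h \<in> borel_measurable MC" and B: "\<And>c. c \<in> space MC \<Longrightarrow> \<bar>h c\<bar> \<le> B"
  shows "J.expectation (\<lambda>z. h (obs_C z) * indicator {t} (obs_A z)) = J.expectation (\<lambda>z. h (obs_C z) * ps L t (obs_C z))"
proof (rule J.real_cond_exp_vimage(2)[symmetric, where N = MC])
  show "integrable J (\<lambda>z. h (obs_C z) * indicator {t} (obs_A z))"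
  proof (intro J.integrable_const_bound[where B = B] AE_I2)
    fix z assume "z \<in> space J"
    then have "\<bar>h (obs_C z)\<bar> \<le> B" by (intro B measurable_space[OF obs_measurable(1)])
    then show "norm (h (obs_C z) * indicator {t} (obs_A z)) \<le> B"
      using abs_ge_zero[of "h (obs_C z)"] by (cases "obs_A z = t") auto
  qed measurable
  show "AE z in J. real_cond_exp J (vimage_algebra (space J) obs_C MC) (\<lambda>z. indicator {t} (obs_A z)) z = ps L t (obs_C z)"
    using conds by (simp add: conditionals_of_joint_def)
qed measurable

text \<open>Tower property in two stages: first given arm and confounders, then given confounders
  alone.\<close>

lemma mediator_expectation:
  assumes S [measurable]: "S \<in> sets MC" and B [measurable]: "B \<in> sets mu"
  shows "J.expectation (\<lambda>z. indicator S (obs_C z) * indicator {t} (obs_A z) * indicator B (obs_M1 z, obs_M2 z))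
    = J.expectation (\<lambda>z. indicator S (obs_C z) * ps L t (obs_C z) * measure (kern t (obs_C z)) B)"
proof -
  let ?h = "\<lambda>(a, c). indicator S c * indicator {t} a :: real"
  have h: "?h \<in> borel_measurable (count_space UNIV \<Otimes>\<^sub>M MC)"
    unfolding case_prod_beta' by measurable
  have kern_A [measurable]: "(\<lambda>z. measure (kern (obs_A z) (obs_C z)) B) \<in> borel_measurable J"
    by (rule measurable_compose_countable'[where f = "\<lambda>a z. measure (kern a (obs_C z)) B" and g = obs_A and I = UNIV]) 
      (simp_all add: countable_finite finite_arm)
  have "J.expectation (\<lambda>z. ?h (obs_A z, obs_C z) * measure (kern (obs_A z) (obs_C z)) B)
    = J.expectation (\<lambda>z. ?h (obs_A z, obs_C z) * indicator B (obs_M1 z, obs_M2 z))"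
  proof (rule J.real_cond_exp_vimage(2)[OF _ h])
    show "integrable J (\<lambda>z. ?h (obs_A z, obs_C z) * indicator B (obs_M1 z, obs_M2 z))"
      by (intro J.integrable_const_bound[where B = 1] AE_I2) (auto simp: indicator_def)
    show "AE z in J. real_cond_exp J (vimage_algebra (space J) (\<lambda>z. (obs_A z, obs_C z)) (count_space UNIV \<Otimes>\<^sub>M MC))
        (\<lambda>z. indicator B (obs_M1 z, obs_M2 z)) z = measure (kern (obs_A z) (obs_C z)) B"
      using conds B by (simp add: conditionals_of_joint_def)
  qed measurable
  then have "J.expectation (\<lambda>z. indicator S (obs_C z) * indicator {t} (obs_A z) * indicator B (obs_M1 z, obs_M2 z))
    = J.expectation (\<lambda>z. indicator S (obs_C z) * indicator {t} (obs_A z) * measure (kern (obs_A z) (obs_C z)) B)"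
    by simp
  \<comment> \<open>On the event that the arm is \<open>t\<close> the kernel may be taken at
    \<open>t\<close>; what multiplies the indicator is then a function of C, as the propensity step
    requires.\<close>
  also have "\<dots> = J.expectation (\<lambda>z. (indicator S (obs_C z) * measure (kern t (obs_C z)) B) * indicator {t} (obs_A z))"
    by (intro Bochner_Integration.integral_cong refl) (auto simp: indicator_def)
  also have "\<dots> = J.expectation (\<lambda>z. (indicator S (obs_C z) * measure (kern t (obs_C z)) B) * ps L t (obs_C z))"
    using prob_space.prob_le_1[OF kern_prob]
    by (intro propensity_expectation[of "\<lambda>c. indicator S c * measure (kern t c) B" 1])
      (auto simp: indicator_def)
  finally show ?thesis by (simp add: ac_simps)
qed

lemma QC_prob: "prob_space (QC MC L)"
  unfolding QC_def by (intro J.prob_space_distr) measurable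

lemma sets_QC [simp, measurable_cong]: "sets (QC MC L) = sets MC"
  and space_QC [simp]: "space (QC MC L) = space MC"
  by (simp_all add: QC_def)

text \<open>Disintegration of the law on the event that the arm is \<open>t\<close>. Rectangles are
  handled by \<open>mediator_expectation\<close>; they form an intersection-stable generator and the
  total mass is finite, so the two measures coincide.\<close>

lemma law_M_C_given_A:
  "distr (density J (\<lambda>z. indicator {t} (obs_A z))) (mu \<Otimes>\<^sub>M MC) (\<lambda>z. ((obs_M1 z, obs_M2 z), obs_C z))
    = density (mu \<Otimes>\<^sub>M QC MC L) (\<lambda>(p, c). ennreal (ps L t c * med_dens L t (fst p) (snd p) c))"
  (is "?l = ?r")
proof (rule measure_eqI_generator_eq[where \<Omega> = "space mu \<times> space MC" and A = "\<lambda>_. space mu \<times> space MC"])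
  let ?E = "{a \<times> b | a b. a \<in> sets mu \<and> b \<in> sets MC}"
  interpret QC: prob_space "QC MC L" by (rule QC_prob)
  interpret muQC: pair_sigma_finite mu "QC MC L" ..
  have sets_eq: "sets (mu \<Otimes>\<^sub>M QC MC L) = sets (mu \<Otimes>\<^sub>M MC)"
    by (intro sets_pair_measure_cong) simp_all
  show "Int_stable ?E" by (rule Int_stable_pair_measure_generator)
  show "?E \<subseteq> Pow (space mu \<times> space MC)" by (rule pair_measure_closed)
  show "sets ?l = sigma_sets (space mu \<times> space MC) ?E" "sets ?r = sigma_sets (space mu \<times> space MC) ?E"
    by (simp_all add: sets_eq) (simp_all add: sets_pair_measure)
  show "range (\<lambda>_. space mu \<times> space MC) \<subseteq> ?E" by blast
  show "(\<Union>i. space mu \<times> space MC) = space mu \<times> space MC" by simp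
  show eq: "emeasure ?l X = emeasure ?r X" if "X \<in> ?E" for X
  proof -
    from that obtain B S where X: "X = B \<times> S" and [measurable]: "B \<in> sets mu" "S \<in> sets MC" by blast
    have [measurable]: "X \<in> sets (mu \<Otimes>\<^sub>M MC)" "X \<in> sets (mu \<Otimes>\<^sub>M QC MC L)"
      unfolding sets_eq by (simp_all add: X)
    have "emeasure ?l X = (\<integral>\<^sup>+z. indicator {t} (obs_A z) * indicator X ((obs_M1 z, obs_M2 z), obs_C z) \<partial>J)"
      by (subst emeasure_distr) (auto simp: emeasure_density indicator_def intro!: nn_integral_cong)
    also have "\<dots> = (\<integral>\<^sup>+z. ennreal (indicator S (obs_C z) * indicator {t} (obs_A z) * indicator B (obs_M1 z, obs_M2 z)) \<partial>J)"
      by (intro nn_integral_cong) (auto simp: X indicator_def)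
    also have "\<dots> = ennreal (J.expectation (\<lambda>z. indicator S (obs_C z) * indicator {t} (obs_A z) * indicator B (obs_M1 z, obs_M2 z)))"
      by (intro nn_integral_eq_integral J.integrable_const_bound[where B = 1] AE_I2) (auto simp: indicator_def)
    also have "\<dots> = ennreal (J.expectation (\<lambda>z. indicator S (obs_C z) * ps L t (obs_C z) * measure (kern t (obs_C z)) B))"
      by (subst mediator_expectation) simp_all
    also have "\<dots> = (\<integral>\<^sup>+z. ennreal (indicator S (obs_C z) * ps L t (obs_C z) * measure (kern t (obs_C z)) B) \<partial>J)"
    proof (rule nn_integral_eq_integral[symmetric])
      have *: "0 \<le> ps L t (obs_C z)" "ps L t (obs_C z) \<le> 1" "measure (kern t (obs_C z)) B \<le> 1" if "z \<in> space J" for z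
        using measurable_space[OF obs_measurable(1) that] ps_nonneg ps_le_1 prob_space.prob_le_1[OF kern_prob] by auto
      show "AE z in J. 0 \<le> indicator S (obs_C z) * ps L t (obs_C z) * measure (kern t (obs_C z)) B"
        using * by (intro AE_I2) auto
      show "integrable J (\<lambda>z. indicator S (obs_C z) * ps L t (obs_C z) * measure (kern t (obs_C z)) B)"
        using * by (intro J.integrable_const_bound[where B = 1] AE_I2) (auto simp: indicator_def intro!: mult_le_one)
    qed
    also have "\<dots> = (\<integral>\<^sup>+c. ennreal (indicator S c * ps L t c * measure (kern t c) B) \<partial>QC MC L)"
      unfolding QC_def by (subst nn_integral_distr) simp_all
    also have "\<dots> = (\<integral>\<^sup>+c. (\<integral>\<^sup>+p. ennreal (ps L t c * med_dens L t (fst p) (snd p) c) * indicator X (p, c) \<partial>mu) \<partial>QC MC L)"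
    proof (intro nn_integral_cong)
      fix c assume "c \<in> space (QC MC L)"
      then have c [measurable]: "c \<in> space MC" by simp
      interpret k: prob_space "kern t c" by (rule kern_prob[OF c])
      have "(\<integral>\<^sup>+p. ennreal (ps L t c * med_dens L t (fst p) (snd p) c) * indicator X (p, c) \<partial>mu)
          = (\<integral>\<^sup>+p. (indicator S c * ennreal (ps L t c)) * (ennreal (med_dens L t (fst p) (snd p) c) * indicator B p) \<partial>mu)"
        using ps_nonneg[OF c] by (intro nn_integral_cong) (auto simp: X indicator_def ennreal_mult')
      also have "\<dots> = (indicator S c * ennreal (ps L t c)) * emeasure (kern t c) B"
        by (subst nn_integral_cmult) (simp_all add: nn_integral_kern[OF c, symmetric])
      also have "\<dots> = ennreal (indicator S c * ps L t c * measure (kern t c) B)"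
        using ps_nonneg[OF c] by (auto simp: indicator_def k.emeasure_eq_measure ennreal_mult')
      finally show "ennreal (indicator S c * ps L t c * measure (kern t c) B)
        = (\<integral>\<^sup>+p. ennreal (ps L t c * med_dens L t (fst p) (snd p) c) * indicator X (p, c) \<partial>mu)" by simp
    qed
    also have "\<dots> = (\<integral>\<^sup>+x. ennreal (ps L t (snd x) * med_dens L t (fst (fst x)) (snd (fst x)) (snd x)) * indicator X x \<partial>(mu \<Otimes>\<^sub>M QC MC L))"
      by (subst muQC.nn_integral_snd[symmetric]) (simp_all add: case_prod_beta')
    also have "\<dots> = emeasure ?r X"
      by (subst emeasure_density) (simp_all add: case_prod_beta')
    finally show ?thesis .
  qed
  have "emeasure ?l (space mu \<times> space MC) \<le> emeasure (density J (\<lambda>z. indicator {t} (obs_A z))) (space J)"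
    by (subst emeasure_distr) (auto simp: space_pair_measure intro!: emeasure_mono)
  also have "\<dots> = (\<integral>\<^sup>+z. indicator {t} (obs_A z) * indicator (space J) z \<partial>J)"
    by (rule emeasure_density) simp_all
  also have "\<dots> \<le> (\<integral>\<^sup>+z. 1 \<partial>J)"
    by (intro nn_integral_mono) (simp add: indicator_def)
  finally have "emeasure ?l (space mu \<times> space MC) \<le> 1" by (simp add: J.emeasure_space_1)
  then show "emeasure ?l (space mu \<times> space MC) \<noteq> \<infinity>"
    by (metis ennreal_one_neq_top infinity_ennreal_def top_unique)
qed

section \<open>Inverse probability weighting as a change of measure\<close>

abbreviation "W t z \<equiv> ipw L t (obs_A z) (obs_C z)"

lemma ipw_measurable [measurable (raw)]:
  assumes [measurable]: "f \<in> measurable N (count_space UNIV)" "h \<in> measurable N MC"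
  shows "(\<lambda>x. ipw L t (f x) (h x)) \<in> borel_measurable N"
  unfolding ipw_def by measurable

lemma ipw_nonneg: "c \<in> space MC \<Longrightarrow> 0 \<le> ipw L t a c"
  unfolding ipw_def using ps_nonneg by simp

lemma space_obs:
  assumes "z \<in> space J"
  shows "obs_C z \<in> space MC" "obs_M1 z \<in> space mu1" "obs_M2 z \<in> space mu2"
    "(obs_M1 z, obs_M2 z) \<in> space mu"
  using measurable_space[OF obs_measurable(1) assms] measurable_space[OF obs_measurable(3) assms]
    measurable_space[OF obs_measurable(4) assms] by (simp_all add: space_pair_measure)

lemma pair_fun_measurable:
  assumes "(\<lambda>(p, c). f p c) \<in> borel_measurable (mu \<Otimes>\<^sub>M MC)" "g \<in> measurable N mu" "h \<in> measurable N MC"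
  shows "(\<lambda>x. f (g x) (h x)) \<in> borel_measurable N"
  using measurable_compose[OF measurable_Pair[OF assms(2,3)] assms(1)] by simp

text \<open>The weight cancels the propensity in the density of the disintegration. Working with
  nonnegative integrands postpones all questions of integrability and is what later settles
  them.\<close>

lemma nn_integral_weighted:
  fixes f :: "'m1 \<times> 'm2 \<Rightarrow> 'c \<Rightarrow> real"
  assumes f: "(\<lambda>(p, c). f p c) \<in> borel_measurable (mu \<Otimes>\<^sub>M MC)"
    and pos: "\<And>p c. p \<in> space mu \<Longrightarrow> c \<in> space MC \<Longrightarrow> 0 \<le> f p c"
  shows "(\<integral>\<^sup>+z. ennreal (W t z * f (obs_M1 z, obs_M2 z) (obs_C z)) \<partial>J)
    = (\<integral>\<^sup>+c. (\<integral>\<^sup>+p. ennreal (med_dens L t (fst p) (snd p) c * f p c) \<partial>mu) \<partial>QC MC L)"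
proof -
  interpret QC: prob_space "QC MC L" by (rule QC_prob)
  interpret muQC: pair_sigma_finite mu "QC MC L" ..
  note [measurable (raw)] = pair_fun_measurable[OF f]
  let ?D = "density J (\<lambda>z. indicator {t} (obs_A z))"
  let ?g = "\<lambda>x. ennreal (f (fst x) (snd x) / ps L t (snd x))"
  have "(\<integral>\<^sup>+z. ennreal (W t z * f (obs_M1 z, obs_M2 z) (obs_C z)) \<partial>J)
      = (\<integral>\<^sup>+z. indicator {t} (obs_A z) * ?g ((obs_M1 z, obs_M2 z), obs_C z) \<partial>J)"
    by (intro nn_integral_cong) (simp add: ipw_def indicator_def)
  also have "\<dots> = (\<integral>\<^sup>+z. ?g ((obs_M1 z, obs_M2 z), obs_C z) \<partial>?D)"
    by (rule nn_integral_density[symmetric]) measurable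
  also have "\<dots> = (\<integral>\<^sup>+x. ?g x \<partial>distr ?D (mu \<Otimes>\<^sub>M MC) (\<lambda>z. ((obs_M1 z, obs_M2 z), obs_C z)))"
    by (rule nn_integral_distr[symmetric]) measurable
  also have "\<dots> = (\<integral>\<^sup>+x. ennreal (ps L t (snd x) * med_dens L t (fst (fst x)) (snd (fst x)) (snd x)) * ?g x
      \<partial>(mu \<Otimes>\<^sub>M QC MC L))"
    unfolding law_M_C_given_A case_prod_beta' by (rule nn_integral_density) measurable
  also have "\<dots> = (\<integral>\<^sup>+c. (\<integral>\<^sup>+p. ennreal (ps L t c * med_dens L t (fst p) (snd p) c) * ?g (p, c) \<partial>mu) \<partial>QC MC L)"
    by (subst muQC.nn_integral_snd[symmetric]) simp_all
  also have "\<dots> = (\<integral>\<^sup>+c. (\<integral>\<^sup>+p. ennreal (med_dens L t (fst p) (snd p) c * f p c) \<partial>mu) \<partial>QC MC L)"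
  proof (rule nn_integral_cong_AE)
    \<comment> \<open>Positivity holds only almost surely, so the quotient by the propensity cancels
      off a null set.\<close>
    have "AE c in QC MC L. 0 < ps L t c"
      unfolding QC_def using ps_pos[of t] by (subst AE_distr_iff) simp_all
    then show "AE c in QC MC L. (\<integral>\<^sup>+p. ennreal (ps L t c * med_dens L t (fst p) (snd p) c) * ?g (p, c) \<partial>mu)
        = (\<integral>\<^sup>+p. ennreal (med_dens L t (fst p) (snd p) c * f p c) \<partial>mu)"
    proof (rule AE_mp, intro AE_I2 impI nn_integral_cong)
      fix c p assume c: "c \<in> space (QC MC L)" "0 < ps L t c" and p: "p \<in> space mu"
      have "0 \<le> med_dens L t (fst p) (snd p) c" "0 \<le> f p c"
        using c p by (auto simp: space_pair_measure intro!: med_dens_nonneg pos)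
      then show "ennreal (ps L t c * med_dens L t (fst p) (snd p) c) * ?g (p, c)
          = ennreal (med_dens L t (fst p) (snd p) c * f p c)"
        using c(2) by (simp add: ennreal_mult[symmetric])
    qed
  qed
  finally show ?thesis .
qed

lemma nn_integral_med_dens: "c \<in> space MC \<Longrightarrow> (\<integral>\<^sup>+p. ennreal (med_dens L t (fst p) (snd p) c) \<partial>mu) = 1"
  using nn_integral_kern[of c "\<lambda>_. 1" t] prob_space.emeasure_space_1[OF kern_prob, of c t] by simp

text \<open>The change of measure cancels the denominator and leaves at most the mass of
  \<open>r\<close>. With \<open>r\<close> a joint mediator density or a product of marginal ones
  this covers the ratios in the influence functions, up to differences.\<close>

lemma integrable_weighted_ratio:
  fixes r :: "'m1 \<times> 'm2 \<Rightarrow> 'c \<Rightarrow> real"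
  assumes r: "(\<lambda>(p, c). r p c) \<in> borel_measurable (mu \<Otimes>\<^sub>M MC)"
    and pos: "\<And>p c. p \<in> space mu \<Longrightarrow> c \<in> space MC \<Longrightarrow> 0 \<le> r p c"
    and le1: "\<And>c. c \<in> space MC \<Longrightarrow> (\<integral>\<^sup>+p. ennreal (r p c) \<partial>mu) \<le> 1"
  shows "integrable J (\<lambda>z. W t z * (r (obs_M1 z, obs_M2 z) (obs_C z) / med_dens L t (obs_M1 z) (obs_M2 z) (obs_C z)))"
proof (rule integrableI_nonneg)
  note [measurable (raw)] = pair_fun_measurable[OF r]
  interpret QC: prob_space "QC MC L" by (rule QC_prob)
  let ?f = "\<lambda>p c. r p c / med_dens L t (fst p) (snd p) c"
  have f_pos: "0 \<le> ?f p c" if "p \<in> space mu" "c \<in> space MC" for p c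
    using that pos med_dens_nonneg by (auto simp: space_pair_measure)
  have f: "(\<lambda>(p, c). ?f p c) \<in> borel_measurable (mu \<Otimes>\<^sub>M MC)"
    unfolding case_prod_beta' by measurable
  show "AE z in J. 0 \<le> W t z * (r (obs_M1 z, obs_M2 z) (obs_C z) / med_dens L t (obs_M1 z) (obs_M2 z) (obs_C z))"
  proof (rule AE_I2)
    fix z assume z: "z \<in> space J"
    show "0 \<le> W t z * (r (obs_M1 z, obs_M2 z) (obs_C z) / med_dens L t (obs_M1 z) (obs_M2 z) (obs_C z))"
      using f_pos[OF space_obs(4)[OF z] space_obs(1)[OF z]]
      by (intro mult_nonneg_nonneg ipw_nonneg[OF space_obs(1)[OF z]]) simp
  qed
  have "(\<integral>\<^sup>+z. ennreal (W t z * ?f (obs_M1 z, obs_M2 z) (obs_C z)) \<partial>J)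
      = (\<integral>\<^sup>+c. (\<integral>\<^sup>+p. ennreal (med_dens L t (fst p) (snd p) c * ?f p c) \<partial>mu) \<partial>QC MC L)"
    by (rule nn_integral_weighted[OF f f_pos])
  also have "\<dots> \<le> (\<integral>\<^sup>+c. (\<integral>\<^sup>+p. ennreal (r p c) \<partial>mu) \<partial>QC MC L)"
  proof (intro nn_integral_mono ennreal_leI)
    fix c p assume "c \<in> space (QC MC L)" "p \<in> space mu"
    \<comment> \<open>Where the density is zero the quotient is 0 by convention, so an inequality
      holds at every point.\<close>
    then show "med_dens L t (fst p) (snd p) c * ?f p c \<le> r p c"
      using pos[of p c] by (cases "med_dens L t (fst p) (snd p) c = 0") auto
  qed
  also have "\<dots> \<le> (\<integral>\<^sup>+c. 1 \<partial>QC MC L)" by (intro nn_integral_mono le1) simp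
  also have "\<dots> < \<infinity>" by (simp add: QC.emeasure_space_1[simplified])
  finally show "(\<integral>\<^sup>+z. ennreal (W t z * (r (obs_M1 z, obs_M2 z) (obs_C z)
      / med_dens L t (obs_M1 z) (obs_M2 z) (obs_C z))) \<partial>J) < \<infinity>" by simp
  have "(\<lambda>z. ?f (obs_M1 z, obs_M2 z) (obs_C z)) \<in> borel_measurable J"
    by (rule pair_fun_measurable[OF f]) measurable
  then show "(\<lambda>z. W t z * (r (obs_M1 z, obs_M2 z) (obs_C z) / med_dens L t (obs_M1 z) (obs_M2 z) (obs_C z)))
      \<in> borel_measurable J"
    by (intro borel_measurable_times) simp_all
qed

lemma integrable_W: "integrable J (W t)" and integral_W: "J.expectation (W t) = 1"
proof -
  interpret QC: prob_space "QC MC L" by (rule QC_prob)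
  have "(\<integral>\<^sup>+z. ennreal (W t z) \<partial>J) = (\<integral>\<^sup>+c. (\<integral>\<^sup>+p. ennreal (med_dens L t (fst p) (snd p) c) \<partial>mu) \<partial>QC MC L)"
    using nn_integral_weighted[of "\<lambda>_ _. 1" t] by simp
  also have "\<dots> = (\<integral>\<^sup>+c. 1 \<partial>QC MC L)" by (intro nn_integral_cong nn_integral_med_dens) simp
  also have "\<dots> = 1" by (simp add: QC.emeasure_space_1[simplified])
  finally have 1: "(\<integral>\<^sup>+z. ennreal (W t z) \<partial>J) = 1" .
  have pos: "AE z in J. 0 \<le> W t z" using ipw_nonneg[OF space_obs(1)] by (intro AE_I2)
  show "integrable J (W t)" using 1 pos by (intro integrableI_nonneg) auto
  show "J.expectation (W t) = 1" using 1 pos by (subst integral_eq_nn_integral) auto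
qed

text \<open>Integrability is included because a non-integrable function also has Bochner integral 0;
  only with it is the property closed under sums and differences.\<close>

definition mean_zero :: "(('c, 'm1, 'm2) obs \<Rightarrow> real) \<Rightarrow> bool" where
  "mean_zero f \<longleftrightarrow> integrable J f \<and> J.expectation f = 0"

lemma mean_zero_add: "mean_zero f \<Longrightarrow> mean_zero g \<Longrightarrow> mean_zero (\<lambda>z. f z + g z)"
  and mean_zero_diff: "mean_zero f \<Longrightarrow> mean_zero g \<Longrightarrow> mean_zero (\<lambda>z. f z - g z)"
  by (simp_all add: mean_zero_def)

text \<open>Adding the bound makes \<open>f\<close> nonnegative, so that
  \<open>nn_integral_weighted\<close> applies. The added constant contributes exactly itself, since
  the weight has mean 1 and each kernel is a probability measure.\<close>

lemma mean_zero_mediator: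
  fixes f :: "'m1 \<times> 'm2 \<Rightarrow> 'c \<Rightarrow> real"
  assumes f: "(\<lambda>(p, c). f p c) \<in> borel_measurable (mu \<Otimes>\<^sub>M MC)"
    and B: "\<And>p c. p \<in> space mu \<Longrightarrow> c \<in> space MC \<Longrightarrow> \<bar>f p c\<bar> \<le> B"
    and zero: "\<And>c. c \<in> space MC \<Longrightarrow> (\<integral>p. f p c \<partial>kern t c) = 0"
  shows "mean_zero (\<lambda>z. W t z * f (obs_M1 z, obs_M2 z) (obs_C z))"
proof -
  note [measurable (raw)] = pair_fun_measurable[OF f]
  interpret QC: prob_space "QC MC L" by (rule QC_prob)
  let ?B = "\<bar>B\<bar>"
  have B: "\<bar>f p c\<bar> \<le> ?B" if "p \<in> space mu" "c \<in> space MC" for p c using B[OF that] by simp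
  have W: "0 \<le> W t z" if "z \<in> space J" for z using ipw_nonneg[OF space_obs(1)[OF that]] .
  have fz: "\<bar>f (obs_M1 z, obs_M2 z) (obs_C z)\<bar> \<le> ?B" if "z \<in> space J" for z
    using B[OF space_obs(4) space_obs(1)] that by simp
  have int: "integrable J (\<lambda>z. W t z * f (obs_M1 z, obs_M2 z) (obs_C z))"
  proof (rule Bochner_Integration.integrable_bound[OF integrable_mult_right[OF integrable_W]])
    show "AE z in J. norm (W t z * f (obs_M1 z, obs_M2 z) (obs_C z)) \<le> norm (?B * W t z)"
    proof (rule AE_I2)
      fix z assume z: "z \<in> space J"
      show "norm (W t z * f (obs_M1 z, obs_M2 z) (obs_C z)) \<le> norm (?B * W t z)"
        using mult_right_mono[OF fz[OF z] W[OF z]] W[OF z] by (simp add: abs_mult mult.commute)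
    qed
  qed measurable
  have inner: "(\<integral>\<^sup>+p. ennreal (med_dens L t (fst p) (snd p) c * (f p c + ?B)) \<partial>mu) = ennreal ?B"
    if c [measurable]: "c \<in> space MC" for c
  proof -
    interpret k: prob_space "kern t c" by (rule kern_prob[OF c])
    have f_int: "integrable (kern t c) (\<lambda>p. f p c)"
      using B[OF _ c] by (intro k.integrable_const_bound[where B = ?B] AE_I2) auto
    have "(\<integral>\<^sup>+p. ennreal (med_dens L t (fst p) (snd p) c * (f p c + ?B)) \<partial>mu)
        = (\<integral>\<^sup>+p. ennreal (med_dens L t (fst p) (snd p) c) * ennreal (f p c + ?B) \<partial>mu)"
    proof (intro nn_integral_cong ennreal_mult)
      fix p assume p: "p \<in> space mu"
      show "0 \<le> med_dens L t (fst p) (snd p) c" using p c by (auto simp: space_pair_measure intro!: med_dens_nonneg)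
      show "0 \<le> f p c + ?B" using B[OF p c] by linarith
    qed
    also have "\<dots> = (\<integral>\<^sup>+p. ennreal (f p c + ?B) \<partial>kern t c)"
      by (rule nn_integral_kern[OF c, symmetric]) measurable
    also have "\<dots> = ennreal (\<integral>p. f p c + ?B \<partial>kern t c)"
    proof (rule nn_integral_eq_integral)
      show "AE p in kern t c. 0 \<le> f p c + ?B"
      proof (rule AE_I2)
        fix p assume "p \<in> space (kern t c)"
        then show "0 \<le> f p c + ?B" using B[of p c] c by (simp add: abs_le_iff)
      qed
    qed (use f_int in simp)
    also have "(\<integral>p. f p c + ?B \<partial>kern t c) = ?B"
      using f_int zero[OF c] by (simp add: k.prob_space[simplified])
    finally show ?thesis .
  qed
  have "(\<integral>\<^sup>+z. ennreal (W t z * (f (obs_M1 z, obs_M2 z) (obs_C z) + ?B)) \<partial>J)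
      = (\<integral>\<^sup>+c. (\<integral>\<^sup>+p. ennreal (med_dens L t (fst p) (snd p) c * (f p c + ?B)) \<partial>mu) \<partial>QC MC L)"
  proof (rule nn_integral_weighted[of "\<lambda>p c. f p c + ?B"])
    show "0 \<le> f p c + ?B" if "p \<in> space mu" "c \<in> space MC" for p c using B[OF that] by linarith
  qed (simp add: case_prod_beta')
  also have "\<dots> = (\<integral>\<^sup>+c. ennreal ?B \<partial>QC MC L)" by (intro nn_integral_cong inner) simp
  also have "\<dots> = ennreal ?B" by (simp add: QC.emeasure_space_1[simplified])
  finally have "J.expectation (\<lambda>z. W t z * (f (obs_M1 z, obs_M2 z) (obs_C z) + ?B)) = ?B"
  proof (subst integral_eq_nn_integral)
    show "AE z in J. 0 \<le> W t z * (f (obs_M1 z, obs_M2 z) (obs_C z) + ?B)"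
    proof (rule AE_I2)
      fix z assume z: "z \<in> space J"
      have "0 \<le> f (obs_M1 z, obs_M2 z) (obs_C z) + ?B" using fz[OF z] by linarith
      with W[OF z] show "0 \<le> W t z * (f (obs_M1 z, obs_M2 z) (obs_C z) + ?B)" by simp
    qed
  qed simp_all
  then have "J.expectation (\<lambda>z. W t z * f (obs_M1 z, obs_M2 z) (obs_C z)) = 0"
    using int integrable_W[of t] integral_W[of t] by (simp add: distrib_left)
  with int show ?thesis by (simp add: mean_zero_def)
qed

text \<open>The factor in front of the residual depends only on arm, mediators and confounders, so
  conditioning on these replaces the outcome by its regression. Boundedness of the outcome supplies
  the remaining integrability.\<close>

lemma mean_zero_outcome:
  fixes v :: "'m1 \<times> 'm2 \<Rightarrow> 'c \<Rightarrow> real"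
  assumes v: "(\<lambda>(p, c). v p c) \<in> borel_measurable (mu \<Otimes>\<^sub>M MC)"
    and int: "integrable J (\<lambda>z. W t z * v (obs_M1 z, obs_M2 z) (obs_C z))"
  shows "mean_zero (\<lambda>z. W t z * v (obs_M1 z, obs_M2 z) (obs_C z)
    * (obs_Y z - out_reg L t (obs_M1 z) (obs_M2 z) (obs_C z)))"
proof -
  note [measurable (raw)] = pair_fun_measurable[OF v]
  let ?N = "count_space UNIV \<Otimes>\<^sub>M mu1 \<Otimes>\<^sub>M mu2 \<Otimes>\<^sub>M MC"
  let ?w = "\<lambda>z. W t z * v (obs_M1 z, obs_M2 z) (obs_C z)"
  let ?h = "\<lambda>x. ipw L t (fst x) (snd (snd (snd x))) * v (fst (snd x), fst (snd (snd x))) (snd (snd (snd x)))"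
  let ?k = "\<lambda>z. out_reg L (obs_A z) (obs_M1 z) (obs_M2 z) (obs_C z)"
  have k [measurable]: "?k \<in> borel_measurable J"
    by (rule measurable_compose_countable'[where f = "\<lambda>a z. out_reg L a (obs_M1 z) (obs_M2 z) (obs_C z)"
          and g = obs_A and I = UNIV]) (simp_all add: countable_finite finite_arm)
  have intY: "integrable J (\<lambda>z. ?w z * obs_Y z)"
  proof (rule Bochner_Integration.integrable_bound[OF int])
    show "AE z in J. norm (?w z * obs_Y z) \<le> norm (?w z)"
      using Y_bounded by eventually_elim (simp add: abs_mult mult_left_le)
  qed measurable
  have obs: "(\<lambda>z. (obs_A z, obs_M1 z, obs_M2 z, obs_C z)) \<in> measurable J ?N" by measurable
  have h: "?h \<in> borel_measurable ?N" by measurable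
  have ce: "AE z in J. real_cond_exp J (vimage_algebra (space J) (\<lambda>z. (obs_A z, obs_M1 z, obs_M2 z, obs_C z)) ?N) obs_Y z = ?k z"
    using conds by (simp add: conditionals_of_joint_def)
  have int': "integrable J (\<lambda>z. ?h (obs_A z, obs_M1 z, obs_M2 z, obs_C z) * obs_Y z)" using intY by simp
  note * = J.real_cond_exp_vimage[OF obs h obs_measurable(5) int' ce k]
  note * = *[simplified]
  \<comment> \<open>The weight vanishes unless the arm is \<open>t\<close>, so the regression at
    \<open>t\<close> and at the observed arm are interchangeable.\<close>
  have eq: "?w z * (obs_Y z - out_reg L t (obs_M1 z) (obs_M2 z) (obs_C z)) = ?w z * obs_Y z - ?w z * ?k z" for z
    by (cases "obs_A z = t") (simp_all add: ipw_def right_diff_distrib)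
  show ?thesis
    unfolding mean_zero_def eq using * intY by simp
qed

lemma mean_zero_covariate:
  assumes [measurable]: "h \<in> borel_measurable MC" and B: "\<And>c. c \<in> space MC \<Longrightarrow> \<bar>h c\<bar> \<le> B"
  shows "mean_zero (\<lambda>z. h (obs_C z) - (\<integral>c. h c \<partial>QC MC L))"
proof -
  have "integrable J (\<lambda>z. h (obs_C z))"
    using B[OF space_obs(1)] by (intro J.integrable_const_bound[where B = B] AE_I2) auto
  moreover have "(\<integral>c. h c \<partial>QC MC L) = J.expectation (\<lambda>z. h (obs_C z))"
    unfolding QC_def by (rule integral_distr) measurable
  ultimately show ?thesis by (simp add: mean_zero_def J.prob_space)
qed

text \<open>The kernel varies with the parameter; writing its density into the integrand leaves an
  integral against the fixed measure \<open>mu\<close>.\<close>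

lemma kern_integral_measurable:
  fixes F :: "_ \<Rightarrow> _ \<Rightarrow> real"
  assumes F: "(\<lambda>(x, p). F x p) \<in> borel_measurable (N \<Otimes>\<^sub>M mu)" and h [measurable]: "h \<in> measurable N MC"
  shows "(\<lambda>x. \<integral>p. F x p \<partial>kern t (h x)) \<in> borel_measurable N"
proof -
  have [measurable]: "(\<lambda>x. F (fst x) (snd x)) \<in> borel_measurable (N \<Otimes>\<^sub>M mu)"
    using F by (simp add: case_prod_beta')
  have "(\<integral>p. F x p \<partial>kern t (h x)) = (\<integral>p. med_dens L t (fst p) (snd p) (h x) * F x p \<partial>mu)"
    if x [measurable]: "x \<in> space N" for x
  proof (rule integral_kern[OF measurable_space[OF h x]])
    show "F x \<in> borel_measurable mu"
      using measurable_compose[OF measurable_Pair1'[OF x] F] by simp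
  qed
  then have "(\<lambda>x. \<integral>p. F x p \<partial>kern t (h x)) \<in> borel_measurable N \<longleftrightarrow>
      (\<lambda>x. \<integral>p. med_dens L t (fst p) (snd p) (h x) * F x p \<partial>mu) \<in> borel_measurable N"
    by (intro measurable_cong)
  also have "\<dots>" by (rule mu.borel_measurable_lebesgue_integral) measurable
  finally show ?thesis .
qed

section \<open>Marginalized outcome regressions\<close>

abbreviation "RJ \<equiv> Q_joint mu1 mu2 L"
abbreviation "RP \<equiv> Q_prod mu1 mu2 L"
abbreviation "R1 \<equiv> Q_M1 mu1 mu2 L"
abbreviation "R2 \<equiv> Q_M2 mu1 mu2 L"

lemma R1_eq:
  assumes [measurable]: "m2 \<in> space mu2" "c \<in> space MC"
  shows "R1 t m2 c = (\<integral>p. out_reg L Active (fst p) m2 c \<partial>kern t c)"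
  unfolding Q_M1_def QM1_def by (rule integral_distr) measurable

lemma R2_eq:
  assumes [measurable]: "m1 \<in> space mu1" "c \<in> space MC"
  shows "R2 t m1 c = (\<integral>p. out_reg L Active m1 (snd p) c \<partial>kern t c)"
  unfolding Q_M2_def QM2_def by (rule integral_distr) measurable

lemma RJ_eq: "RJ t s c = (\<integral>p. out_reg L t (fst p) (snd p) c \<partial>kern s c)"
  by (simp add: Q_joint_def case_prod_beta')

lemma R1_measurable [measurable (raw)]:
  assumes [measurable]: "g \<in> measurable N mu2" "h \<in> measurable N MC"
  shows "(\<lambda>x. R1 t (g x) (h x)) \<in> borel_measurable N"
proof -
  have "(\<lambda>x. R1 t (g x) (h x)) \<in> borel_measurable N \<longleftrightarrow>
      (\<lambda>x. \<integral>p. out_reg L Active (fst p) (g x) (h x) \<partial>kern t (h x)) \<in> borel_measurable N"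
    by (intro measurable_cong R1_eq measurable_space[OF assms(1)] measurable_space[OF assms(2)])
  also have "\<dots>" by (intro kern_integral_measurable) simp_all
  finally show ?thesis .
qed

lemma R2_measurable [measurable (raw)]:
  assumes [measurable]: "g \<in> measurable N mu1" "h \<in> measurable N MC"
  shows "(\<lambda>x. R2 t (g x) (h x)) \<in> borel_measurable N"
proof -
  have "(\<lambda>x. R2 t (g x) (h x)) \<in> borel_measurable N \<longleftrightarrow>
      (\<lambda>x. \<integral>p. out_reg L Active (g x) (snd p) (h x) \<partial>kern t (h x)) \<in> borel_measurable N"
    by (intro measurable_cong R2_eq measurable_space[OF assms(1)] measurable_space[OF assms(2)])
  also have "\<dots>" by (intro kern_integral_measurable) simp_all
  finally show ?thesis .
qed

lemma RP_eq1:
  assumes [measurable]: "c \<in> space MC"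
  shows "RP t s c = (\<integral>p. R2 s (fst p) c \<partial>kern t c)"
  unfolding Q_prod_def Q_M2_def[symmetric] QM1_def by (rule integral_distr) measurable

text \<open>The product of the two marginals is realized by two independent mediator pairs, of which
  one coordinate each is used. Fubini for the kernels then allows either mediator to be averaged
  first, as the terms in \<open>R1\<close> and in \<open>R2\<close> require.\<close>

lemma RP_eq2:
  assumes c [measurable]: "c \<in> space MC"
  shows "RP t s c = (\<integral>p. R1 t (snd p) c \<partial>kern s c)"
proof -
  interpret t: prob_space "kern t c" by (rule kern_prob[OF c])
  interpret s: prob_space "kern s c" by (rule kern_prob[OF c])
  interpret ts: pair_prob_space "kern t c" "kern s c" ..
  have "RP t s c = (\<integral>p. \<integral>p'. out_reg L Active (fst p) (snd p') c \<partial>kern s c \<partial>kern t c)"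
    unfolding RP_eq1[OF c] using c
    by (intro Bochner_Integration.integral_cong refl R2_eq) (auto simp: space_pair_measure)
  also have "\<dots> = (\<integral>p'. \<integral>p. out_reg L Active (fst p) (snd p') c \<partial>kern t c \<partial>kern s c)"
  proof (rule ts.Fubini_integral[symmetric])
    show "integrable (kern t c \<Otimes>\<^sub>M kern s c) (\<lambda>(p, p'). out_reg L Active (fst p) (snd p') c)"
      unfolding case_prod_beta' using out_reg_01 c
      by (intro ts.integrable_const_bound[where B = 1] AE_I2) (auto simp: space_pair_measure)
  qed
  also have "\<dots> = (\<integral>p'. R1 t (snd p') c \<partial>kern s c)"
    using c by (intro Bochner_Integration.integral_cong refl R1_eq[symmetric]) (auto simp: space_pair_measure)
  finally show ?thesis .
qed

lemma RP_measurable [measurable (raw)]: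
  assumes [measurable]: "h \<in> measurable N MC"
  shows "(\<lambda>x. RP t s (h x)) \<in> borel_measurable N"
proof -
  have "(\<lambda>x. RP t s (h x)) \<in> borel_measurable N \<longleftrightarrow>
      (\<lambda>x. \<integral>p. R2 s (fst p) (h x) \<partial>kern t (h x)) \<in> borel_measurable N"
    by (intro measurable_cong RP_eq1 measurable_space[OF assms])
  also have "\<dots>" by (intro kern_integral_measurable) simp_all
  finally show ?thesis .
qed

lemma RJ_measurable [measurable (raw)]:
  assumes [measurable]: "h \<in> measurable N MC"
  shows "(\<lambda>x. RJ t s (h x)) \<in> borel_measurable N"
  unfolding RJ_eq by (intro kern_integral_measurable) simp_all

lemma R_01:
  shows R1_01: "m2 \<in> space mu2 \<Longrightarrow> c \<in> space MC \<Longrightarrow> 0 \<le> R1 t m2 c \<and> R1 t m2 c \<le> 1"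
    and R2_01: "m1 \<in> space mu1 \<Longrightarrow> c \<in> space MC \<Longrightarrow> 0 \<le> R2 t m1 c \<and> R2 t m1 c \<le> 1"
    and RJ_01: "c \<in> space MC \<Longrightarrow> 0 \<le> RJ t s c \<and> RJ t s c \<le> 1"
proof -
  show R1: "0 \<le> R1 t m2 c \<and> R1 t m2 c \<le> 1" if "m2 \<in> space mu2" "c \<in> space MC" for t m2 c
    unfolding R1_eq[OF that] using that out_reg_01
    by (intro conjI prob_space.expectation_01[OF kern_prob]) (auto simp: space_pair_measure)
  show R2: "0 \<le> R2 t m1 c \<and> R2 t m1 c \<le> 1" if "m1 \<in> space mu1" "c \<in> space MC" for t m1 c
    unfolding R2_eq[OF that] using that out_reg_01
    by (intro conjI prob_space.expectation_01[OF kern_prob]) (auto simp: space_pair_measure)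
  show "0 \<le> RJ t s c \<and> RJ t s c \<le> 1" if "c \<in> space MC" for c
    unfolding RJ_eq using that out_reg_01
    by (intro conjI prob_space.expectation_01[OF kern_prob]) (auto simp: space_pair_measure)
qed

lemma RP_01:
  assumes c: "c \<in> space MC" shows "0 \<le> RP t s c \<and> RP t s c \<le> 1"
  unfolding RP_eq1[OF c] using R2_01[OF _ c]
  by (intro conjI prob_space.expectation_01[OF kern_prob[OF c]]) (auto simp: space_pair_measure)

section \<open>Marginal mediator densities and density ratios\<close>

lemma qM1_measurable [measurable (raw)]:
  assumes [measurable]: "g \<in> measurable N mu1" "h \<in> measurable N MC"
  shows "(\<lambda>x. qM1 mu2 L t (g x) (h x)) \<in> borel_measurable N"
  unfolding qM1_def by (rule mu2.borel_measurable_lebesgue_integral) measurable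

lemma qM2_measurable [measurable (raw)]:
  assumes [measurable]: "g \<in> measurable N mu2" "h \<in> measurable N MC"
  shows "(\<lambda>x. qM2 mu1 L t (g x) (h x)) \<in> borel_measurable N"
  unfolding qM2_def by (rule mu1.borel_measurable_lebesgue_integral) measurable

lemma qM_nonneg:
  shows qM1_nonneg: "m1 \<in> space mu1 \<Longrightarrow> c \<in> space MC \<Longrightarrow> 0 \<le> qM1 mu2 L t m1 c"
    and qM2_nonneg: "m2 \<in> space mu2 \<Longrightarrow> c \<in> space MC \<Longrightarrow> 0 \<le> qM2 mu1 L t m2 c"
  unfolding qM1_def qM2_def by (auto intro!: integral_nonneg_AE AE_I2 med_dens_nonneg)

text \<open>The marginal densities are Bochner integrals and take the value 0 where a section of the
  joint density is not integrable. Tonelli is therefore used as an inequality, and integrability of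
  the ratios asks only for an upper bound.\<close>

lemma nn_integral_qM:
  assumes c [measurable]: "c \<in> space MC"
  shows nn_integral_qM1_le: "(\<integral>\<^sup>+m1. ennreal (qM1 mu2 L t m1 c) \<partial>mu1) \<le> 1"
    and nn_integral_qM2_le: "(\<integral>\<^sup>+m2. ennreal (qM2 mu1 L t m2 c) \<partial>mu2) \<le> 1"
proof -
  have "(\<integral>\<^sup>+m1. ennreal (qM1 mu2 L t m1 c) \<partial>mu1) \<le> (\<integral>\<^sup>+m1. (\<integral>\<^sup>+m2. ennreal (med_dens L t m1 m2 c) \<partial>mu2) \<partial>mu1)"
    unfolding qM1_def using c by (intro nn_integral_mono ennreal_integral_le_nn_integral med_dens_nonneg)
  also have "\<dots> = (\<integral>\<^sup>+p. ennreal (med_dens L t (fst p) (snd p) c) \<partial>mu)"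
    by (subst mu2.nn_integral_fst[symmetric]) simp_all
  finally show "(\<integral>\<^sup>+m1. ennreal (qM1 mu2 L t m1 c) \<partial>mu1) \<le> 1"
    by (simp add: nn_integral_med_dens[OF c])
  have "(\<integral>\<^sup>+m2. ennreal (qM2 mu1 L t m2 c) \<partial>mu2) \<le> (\<integral>\<^sup>+m2. (\<integral>\<^sup>+m1. ennreal (med_dens L t m1 m2 c) \<partial>mu1) \<partial>mu2)"
    unfolding qM2_def using c by (intro nn_integral_mono ennreal_integral_le_nn_integral med_dens_nonneg)
  also have "\<dots> = (\<integral>\<^sup>+p. ennreal (med_dens L t (fst p) (snd p) c) \<partial>mu)"
    by (subst mu.nn_integral_snd[symmetric]) simp_all
  finally show "(\<integral>\<^sup>+m2. ennreal (qM2 mu1 L t m2 c) \<partial>mu2) \<le> 1"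
    by (simp add: nn_integral_med_dens[OF c])
qed

lemma nn_integral_qM_prod_le:
  assumes c [measurable]: "c \<in> space MC"
  shows "(\<integral>\<^sup>+p. ennreal (qM1 mu2 L t (fst p) c * qM2 mu1 L s (snd p) c) \<partial>mu) \<le> 1"
proof -
  have "(\<integral>\<^sup>+p. ennreal (qM1 mu2 L t (fst p) c * qM2 mu1 L s (snd p) c) \<partial>mu)
      = (\<integral>\<^sup>+m1. (\<integral>\<^sup>+m2. ennreal (qM1 mu2 L t m1 c * qM2 mu1 L s m2 c) \<partial>mu2) \<partial>mu1)"
    by (subst mu2.nn_integral_fst[symmetric]) simp_all
  also have "\<dots> = (\<integral>\<^sup>+m1. (\<integral>\<^sup>+m2. ennreal (qM1 mu2 L t m1 c) * ennreal (qM2 mu1 L s m2 c) \<partial>mu2) \<partial>mu1)"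
    using c by (intro nn_integral_cong ennreal_mult qM_nonneg)
  also have "\<dots> = (\<integral>\<^sup>+m1. ennreal (qM1 mu2 L t m1 c) * (\<integral>\<^sup>+m2. ennreal (qM2 mu1 L s m2 c) \<partial>mu2) \<partial>mu1)"
    by (intro nn_integral_cong nn_integral_cmult) measurable
  also have "\<dots> = (\<integral>\<^sup>+m1. ennreal (qM1 mu2 L t m1 c) \<partial>mu1) * (\<integral>\<^sup>+m2. ennreal (qM2 mu1 L s m2 c) \<partial>mu2)"
    by (rule nn_integral_multc) measurable
  also have "\<dots> \<le> 1 * 1" by (intro mult_mono nn_integral_qM[OF c]) simp_all
  finally show ?thesis by simp
qed

lemma integrable_qM_ratio:
  "integrable J (\<lambda>z. W t z * (qM1 mu2 L a (obs_M1 z) (obs_C z) * qM2 mu1 L b (obs_M2 z) (obs_C z)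
    / med_dens L t (obs_M1 z) (obs_M2 z) (obs_C z)))"
proof -
  have "integrable J (\<lambda>z. W t z * ((\<lambda>p c. qM1 mu2 L a (fst p) c * qM2 mu1 L b (snd p) c) (obs_M1 z, obs_M2 z) (obs_C z)
    / med_dens L t (obs_M1 z) (obs_M2 z) (obs_C z)))"
  proof (rule integrable_weighted_ratio)
    show "(\<lambda>(p, c). qM1 mu2 L a (fst p) c * qM2 mu1 L b (snd p) c) \<in> borel_measurable (mu \<Otimes>\<^sub>M MC)"
      unfolding case_prod_beta' by measurable
  qed (auto simp: space_pair_measure intro!: mult_nonneg_nonneg qM_nonneg nn_integral_qM_prod_le)
  then show ?thesis by simp
qed

lemma integrable_med_dens_ratio:
  "integrable J (\<lambda>z. W t z * (med_dens L s (obs_M1 z) (obs_M2 z) (obs_C z)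
    / med_dens L t (obs_M1 z) (obs_M2 z) (obs_C z)))"
proof -
  have "integrable J (\<lambda>z. W t z * ((\<lambda>p c. med_dens L s (fst p) (snd p) c) (obs_M1 z, obs_M2 z) (obs_C z)
    / med_dens L t (obs_M1 z) (obs_M2 z) (obs_C z)))"
  proof (rule integrable_weighted_ratio)
    show "(\<lambda>(p, c). med_dens L s (fst p) (snd p) c) \<in> borel_measurable (mu \<Otimes>\<^sub>M MC)"
      unfolding case_prod_beta' by measurable
  qed (auto simp: space_pair_measure nn_integral_med_dens intro!: med_dens_nonneg)
  then show ?thesis by simp
qed

lemma integrable_kern_01:
  fixes f :: "_ \<Rightarrow> real"
  assumes c: "c \<in> space MC" and [measurable]: "f \<in> borel_measurable mu"
    and "\<And>p. p \<in> space mu \<Longrightarrow> 0 \<le> f p \<and> f p \<le> 1"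
  shows "integrable (kern t c) f"
proof -
  interpret k: prob_space "kern t c" by (rule kern_prob[OF c])
  show ?thesis using assms(3) by (intro k.integrable_const_bound[where B = 1] AE_I2) auto
qed

lemma integrable_kern:
  assumes c [measurable]: "c \<in> space MC"
  shows "integrable (kern t c) (\<lambda>p. out_reg L s (fst p) (snd p) c)"
    "integrable (kern t c) (\<lambda>p. R1 s (snd p) c)" "integrable (kern t c) (\<lambda>p. R2 s (fst p) c)"
  using c by (auto intro!: integrable_kern_01 simp: space_pair_measure R1_01 R2_01 out_reg_01)

lemma integral_kern_diff_const:
  fixes f :: "_ \<Rightarrow> real"
  assumes c: "c \<in> space MC" and "integrable (kern t c) f"
  shows "(\<integral>p. f p - k \<partial>kern t c) = (\<integral>p. f p \<partial>kern t c) - k"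
proof -
  interpret k: prob_space "kern t c" by (rule kern_prob[OF c])
  show ?thesis using assms(2) by (subst Bochner_Integration.integral_diff) (simp_all add: k.prob_space[simplified])
qed

section \<open>Mean-zero components of the influence functions\<close>

lemma abs_diff_01: "0 \<le> x \<and> x \<le> 1 \<Longrightarrow> 0 \<le> y \<and> y \<le> 1 \<Longrightarrow> \<bar>x - y\<bar> \<le> 1" for x y :: real
  by linarith

abbreviation "outcome_term t v z \<equiv> W t z * v (obs_M1 z, obs_M2 z) (obs_C z)
    * (obs_Y z - out_reg L t (obs_M1 z) (obs_M2 z) (obs_C z))"

lemma mean_zero_residual: "mean_zero (outcome_term t (\<lambda>_ _. 1))"
  by (rule mean_zero_outcome) (simp_all add: integrable_W)

lemma mean_zero_RJ:
  "mean_zero (\<lambda>z. W s z * (out_reg L t (obs_M1 z) (obs_M2 z) (obs_C z) - RJ t s (obs_C z)))"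
proof -
  have "mean_zero (\<lambda>z. W s z * (\<lambda>p c. out_reg L t (fst p) (snd p) c - RJ t s c) (obs_M1 z, obs_M2 z) (obs_C z))"
  proof (rule mean_zero_mediator)
    show "(\<lambda>(p, c). out_reg L t (fst p) (snd p) c - RJ t s c) \<in> borel_measurable (mu \<Otimes>\<^sub>M MC)"
      unfolding case_prod_beta' by measurable
    show "\<bar>out_reg L t (fst p) (snd p) c - RJ t s c\<bar> \<le> 1" if "p \<in> space mu" "c \<in> space MC" for p c
      using that by (intro abs_diff_01 out_reg_01 RJ_01) (auto simp: space_pair_measure)
    show "(\<integral>p. out_reg L t (fst p) (snd p) c - RJ t s c \<partial>kern s c) = 0" if "c \<in> space MC" for c
      using that by (simp add: integral_kern_diff_const integrable_kern RJ_eq)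
  qed
  then show ?thesis by simp
qed

lemma mean_zero_R2: "mean_zero (\<lambda>z. W t z * (R2 s (obs_M1 z) (obs_C z) - RP t s (obs_C z)))"
proof -
  have "mean_zero (\<lambda>z. W t z * (\<lambda>p c. R2 s (fst p) c - RP t s c) (obs_M1 z, obs_M2 z) (obs_C z))"
  proof (rule mean_zero_mediator)
    show "(\<lambda>(p, c). R2 s (fst p) c - RP t s c) \<in> borel_measurable (mu \<Otimes>\<^sub>M MC)"
      unfolding case_prod_beta' by measurable
    show "\<bar>R2 s (fst p) c - RP t s c\<bar> \<le> 1" if "p \<in> space mu" "c \<in> space MC" for p c
      using that by (intro abs_diff_01 R2_01 RP_01) (auto simp: space_pair_measure)
    show "(\<integral>p. R2 s (fst p) c - RP t s c \<partial>kern t c) = 0" if "c \<in> space MC" for c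
      using that by (simp add: integral_kern_diff_const integrable_kern RP_eq1)
  qed
  then show ?thesis by simp
qed

lemma mean_zero_R1: "mean_zero (\<lambda>z. W s z * (R1 t (obs_M2 z) (obs_C z) - RP t s (obs_C z)))"
proof -
  have "mean_zero (\<lambda>z. W s z * (\<lambda>p c. R1 t (snd p) c - RP t s c) (obs_M1 z, obs_M2 z) (obs_C z))"
  proof (rule mean_zero_mediator)
    show "(\<lambda>(p, c). R1 t (snd p) c - RP t s c) \<in> borel_measurable (mu \<Otimes>\<^sub>M MC)"
      unfolding case_prod_beta' by measurable
    show "\<bar>R1 t (snd p) c - RP t s c\<bar> \<le> 1" if "p \<in> space mu" "c \<in> space MC" for p c
      using that by (intro abs_diff_01 R1_01 RP_01) (auto simp: space_pair_measure)
    show "(\<integral>p. R1 t (snd p) c - RP t s c \<partial>kern s c) = 0" if "c \<in> space MC" for c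
      using that by (simp add: integral_kern_diff_const integrable_kern RP_eq2)
  qed
  then show ?thesis by simp
qed

lemma mean_zero_RJ_diff:
  "mean_zero (\<lambda>z. RJ t s (obs_C z) - RJ t' s' (obs_C z) - (\<integral>c. RJ t s c - RJ t' s' c \<partial>QC MC L))"
  by (rule mean_zero_covariate[where B = 1]) (simp_all add: abs_diff_01 RJ_01)

lemma mean_zero_RP_diff:
  "mean_zero (\<lambda>z. RP t s (obs_C z) - RP t' s' (obs_C z) - (\<integral>c. RP t s c - RP t' s' c \<partial>QC MC L))"
  by (rule mean_zero_covariate[where B = 1]) (simp_all add: abs_diff_01 RP_01)

lemma mean_zero_med_dens_ratio:
  "mean_zero (outcome_term t (\<lambda>p c. med_dens L s (fst p) (snd p) c / med_dens L t (fst p) (snd p) c))"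
proof (rule mean_zero_outcome)
  show "(\<lambda>(p, c). med_dens L s (fst p) (snd p) c / med_dens L t (fst p) (snd p) c) \<in> borel_measurable (mu \<Otimes>\<^sub>M MC)"
    unfolding case_prod_beta' by measurable
qed (simp add: integrable_med_dens_ratio[simplified])

lemma mean_zero_qM_ratio:
  "mean_zero (outcome_term t (\<lambda>p c. qM1 mu2 L a (fst p) c * qM2 mu1 L b (snd p) c / med_dens L t (fst p) (snd p) c))"
proof (rule mean_zero_outcome)
  show "(\<lambda>(p, c). qM1 mu2 L a (fst p) c * qM2 mu1 L b (snd p) c / med_dens L t (fst p) (snd p) c)
      \<in> borel_measurable (mu \<Otimes>\<^sub>M MC)"
    unfolding case_prod_beta' by measurable
qed (simp add: integrable_qM_ratio[simplified])

text \<open>Each influence function is regrouped along the factorization of the law into outcome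
  residuals, mediator deviations from their conditional means, and a centered function of the
  confounders. Every group has mean zero by itself.\<close>

theorem EIF_mean_zero: "mean_zero (EIF MC mu1 mu2 k L)"
proof (cases k)
  case Total
  \<comment> \<open>Inserting the outcome regression splits the deviation of \<open>y\<close> from
    its marginalized mean into a residual and a mediator deviation.\<close>
  have "mean_zero (\<lambda>z. outcome_term Active (\<lambda>_ _. 1) z
      + W Active z * (out_reg L Active (obs_M1 z) (obs_M2 z) (obs_C z) - RJ Active Active (obs_C z))
      - (outcome_term Control (\<lambda>_ _. 1) z
        + W Control z * (out_reg L Control (obs_M1 z) (obs_M2 z) (obs_C z) - RJ Control Control (obs_C z)))
      + (RJ Active Active (obs_C z) - RJ Control Control (obs_C z) - Psi MC mu1 mu2 Total L))"
    unfolding Psi.simps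
    by (intro mean_zero_add mean_zero_diff mean_zero_residual mean_zero_RJ mean_zero_RJ_diff)
  also have "(\<lambda>z. outcome_term Active (\<lambda>_ _. 1) z
      + W Active z * (out_reg L Active (obs_M1 z) (obs_M2 z) (obs_C z) - RJ Active Active (obs_C z))
      - (outcome_term Control (\<lambda>_ _. 1) z
        + W Control z * (out_reg L Control (obs_M1 z) (obs_M2 z) (obs_C z) - RJ Control Control (obs_C z)))
      + (RJ Active Active (obs_C z) - RJ Control Control (obs_C z) - Psi MC mu1 mu2 Total L))
    = EIF MC mu1 mu2 Total L"
    by (rule ext) (auto simp: obs_C_def obs_A_def obs_M1_def obs_M2_def obs_Y_def algebra_simps simp del: Psi.simps)
  finally show ?thesis by (simp add: Total)
next
  case Direct
  have "mean_zero (\<lambda>z. outcome_term Active (\<lambda>p c. med_dens L Control (fst p) (snd p) c / med_dens L Active (fst p) (snd p) c) z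
      - outcome_term Control (\<lambda>_ _. 1) z
      + (W Control z * (out_reg L Active (obs_M1 z) (obs_M2 z) (obs_C z) - RJ Active Control (obs_C z))
        - W Control z * (out_reg L Control (obs_M1 z) (obs_M2 z) (obs_C z) - RJ Control Control (obs_C z)))
      + (RJ Active Control (obs_C z) - RJ Control Control (obs_C z) - Psi MC mu1 mu2 Direct L))"
    unfolding Psi.simps
    by (intro mean_zero_add mean_zero_diff mean_zero_residual mean_zero_med_dens_ratio mean_zero_RJ mean_zero_RJ_diff)
  also have "(\<lambda>z. outcome_term Active (\<lambda>p c. med_dens L Control (fst p) (snd p) c / med_dens L Active (fst p) (snd p) c) z
      - outcome_term Control (\<lambda>_ _. 1) z
      + (W Control z * (out_reg L Active (obs_M1 z) (obs_M2 z) (obs_C z) - RJ Active Control (obs_C z))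
        - W Control z * (out_reg L Control (obs_M1 z) (obs_M2 z) (obs_C z) - RJ Control Control (obs_C z)))
      + (RJ Active Control (obs_C z) - RJ Control Control (obs_C z) - Psi MC mu1 mu2 Direct L))
    = EIF MC mu1 mu2 Direct L"
    by (rule ext) (auto simp: obs_C_def obs_A_def obs_M1_def obs_M2_def obs_Y_def algebra_simps simp del: Psi.simps)
  finally show ?thesis by (simp add: Direct)
next
  case Indirect1
  let ?v = "\<lambda>a p c. qM1 mu2 L a (fst p) c * qM2 mu1 L Control (snd p) c / med_dens L Active (fst p) (snd p) c"
  \<comment> \<open>The difference of marginal densities is split because the integrability
    criterion needs a nonnegative numerator; likewise the bracket with two \<open>R1\<close> terms
    becomes two deviations, each centered under the control arm.\<close>
  have "mean_zero (\<lambda>z. outcome_term Active (?v Active) z - outcome_term Active (?v Control) z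
      + W Active z * (R2 Control (obs_M1 z) (obs_C z) - RP Active Control (obs_C z))
      - W Control z * (R2 Control (obs_M1 z) (obs_C z) - RP Control Control (obs_C z))
      + (W Control z * (R1 Active (obs_M2 z) (obs_C z) - RP Active Control (obs_C z))
        - W Control z * (R1 Control (obs_M2 z) (obs_C z) - RP Control Control (obs_C z)))
      + (RP Active Control (obs_C z) - RP Control Control (obs_C z) - Psi MC mu1 mu2 Indirect1 L))"
    unfolding Psi.simps
    by (intro mean_zero_add mean_zero_diff mean_zero_qM_ratio mean_zero_R1 mean_zero_R2 mean_zero_RP_diff)
  also have "(\<lambda>z. outcome_term Active (?v Active) z - outcome_term Active (?v Control) z
      + W Active z * (R2 Control (obs_M1 z) (obs_C z) - RP Active Control (obs_C z))
      - W Control z * (R2 Control (obs_M1 z) (obs_C z) - RP Control Control (obs_C z))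
      + (W Control z * (R1 Active (obs_M2 z) (obs_C z) - RP Active Control (obs_C z))
        - W Control z * (R1 Control (obs_M2 z) (obs_C z) - RP Control Control (obs_C z)))
      + (RP Active Control (obs_C z) - RP Control Control (obs_C z) - Psi MC mu1 mu2 Indirect1 L))
    = EIF MC mu1 mu2 Indirect1 L"
    by (rule ext) (auto simp: obs_C_def obs_A_def obs_M1_def obs_M2_def obs_Y_def algebra_simps diff_divide_distrib
      simp del: Psi.simps)
  finally show ?thesis by (simp add: Indirect1)
next
  case Indirect2
  let ?v = "\<lambda>b p c. qM1 mu2 L Active (fst p) c * qM2 mu1 L b (snd p) c / med_dens L Active (fst p) (snd p) c"
  have "mean_zero (\<lambda>z. outcome_term Active (?v Active) z - outcome_term Active (?v Control) z
      + W Active z * (R1 Active (obs_M2 z) (obs_C z) - RP Active Active (obs_C z))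
      - W Control z * (R1 Active (obs_M2 z) (obs_C z) - RP Active Control (obs_C z))
      + (W Active z * (R2 Active (obs_M1 z) (obs_C z) - RP Active Active (obs_C z))
        - W Active z * (R2 Control (obs_M1 z) (obs_C z) - RP Active Control (obs_C z)))
      + (RP Active Active (obs_C z) - RP Active Control (obs_C z) - Psi MC mu1 mu2 Indirect2 L))"
    unfolding Psi.simps
    by (intro mean_zero_add mean_zero_diff mean_zero_qM_ratio mean_zero_R1 mean_zero_R2 mean_zero_RP_diff)
  also have "(\<lambda>z. outcome_term Active (?v Active) z - outcome_term Active (?v Control) z
      + W Active z * (R1 Active (obs_M2 z) (obs_C z) - RP Active Active (obs_C z))
      - W Control z * (R1 Active (obs_M2 z) (obs_C z) - RP Active Control (obs_C z))
      + (W Active z * (R2 Active (obs_M1 z) (obs_C z) - RP Active Active (obs_C z))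
        - W Active z * (R2 Control (obs_M1 z) (obs_C z) - RP Active Control (obs_C z)))
      + (RP Active Active (obs_C z) - RP Active Control (obs_C z) - Psi MC mu1 mu2 Indirect2 L))
    = EIF MC mu1 mu2 Indirect2 L"
    by (rule ext) (auto simp: obs_C_def obs_A_def obs_M1_def obs_M2_def obs_Y_def algebra_simps diff_divide_distrib
      simp del: Psi.simps)
  finally show ?thesis by (simp add: Indirect2)
qed

end

section \<open>Asymptotic normality of the estimators\<close>

lemma effect_vec_eq_axis:
  "effect_vec f = f Direct *\<^sub>R axis 1 1 + f Indirect1 *\<^sub>R axis 2 1 + f Indirect2 *\<^sub>R axis 3 1
    + (f Total - f Direct - f Indirect1 - f Indirect2) *\<^sub>R axis 4 1"
  by (simp add: vec_eq_iff forall_4 axis_def)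

lemma effect_vec_linear:
  "effect_vec (\<lambda>k. f k + g k) = effect_vec f + effect_vec g"
  "effect_vec (\<lambda>k. f k - g k) = effect_vec f - effect_vec g"
  "effect_vec (\<lambda>k. c * f k) = c *\<^sub>R effect_vec f"
  "effect_vec (\<lambda>k. \<Sum>i\<in>I. h i k) = (\<Sum>i\<in>I. effect_vec (h i))"
  by (simp_all add: vec_eq_iff forall_4 algebra_simps sum_subtractf sum.distrib)

lemma effect_vec_measurable:
  assumes [measurable]: "\<And>k. (\<lambda>x. f k x) \<in> borel_measurable N"
  shows "(\<lambda>x. effect_vec (\<lambda>k. f k x)) \<in> borel_measurable N"
  unfolding effect_vec_eq_axis by measurable

text \<open>Three coordinates contribute \<open>d\<close> each, and the covariant one, combining
  four terms, contributes \<open>4 * d\<close>.\<close>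

lemma norm_effect_vec_le:
  assumes "\<And>k. \<bar>f k\<bar> \<le> d" shows "norm (effect_vec f) \<le> 7 * d"
proof -
  have "norm (effect_vec f) \<le> (\<Sum>i\<in>UNIV. \<bar>effect_vec f $ i\<bar>)" by (rule norm_le_l1_cart)
  also have "\<dots> = \<bar>f Direct\<bar> + \<bar>f Indirect1\<bar> + \<bar>f Indirect2\<bar> + \<bar>f Total - f Direct - f Indirect1 - f Indirect2\<bar>"
    by (simp add: sum_4)
  also have "\<dots> \<le> 7 * d"
    using assms[of Direct] assms[of Indirect1] assms[of Indirect2] assms[of Total] by linarith
  finally show ?thesis .
qed

lemma finite_param: "finite (UNIV :: param set)"
proof -
  have "UNIV = {Total, Direct, Indirect1, Indirect2}" using param.exhaust by auto
  then show ?thesis by (metis finite.emptyI finite_insert)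
qed

lemma integrable_square_diff:
  fixes f g :: "'a \<Rightarrow> real"
  assumes "f \<in> borel_measurable M" "g \<in> borel_measurable M"
    "integrable M (\<lambda>x. (f x)\<^sup>2)" "integrable M (\<lambda>x. (g x)\<^sup>2)"
  shows "integrable M (\<lambda>x. (f x - g x)\<^sup>2)"
  using integrable_mult_if_squares[OF assms] assms(3,4) by (simp add: power2_diff mult.assoc)

text \<open>The quadratic form at \<open>x\<close> is the integral of the squared projection
  \<open>x \<bullet> u z\<close>, hence nonnegative.\<close>

lemma second_moment_matrix_factor:
  fixes u :: "'o \<Rightarrow> real ^ 'n"
  assumes [measurable]: "\<And>j. (\<lambda>z. u z $ j) \<in> borel_measurable P"
    and sq: "\<And>j. integrable P (\<lambda>z. (u z $ j)\<^sup>2)"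
  shows "\<exists>L :: real ^ 'n ^ 'n. L ** transpose L = second_moment_matrix P u"
proof (rule psd_matrix_factor)
  show "second_moment_matrix P u $ i $ j = second_moment_matrix P u $ j $ i" for i j
    by (simp add: second_moment_matrix_def mult.commute)
  have int: "integrable P (\<lambda>z. u z $ i * u z $ j)" for i j
    by (intro integrable_mult_if_squares sq) measurable
  show "0 \<le> x \<bullet> (second_moment_matrix P u *v x)" for x
  proof -
    have "x \<bullet> (second_moment_matrix P u *v x)
        = (\<Sum>i\<in>UNIV. \<Sum>j\<in>UNIV. x $ i * x $ j * (\<integral>z. u z $ i * u z $ j \<partial>P))"
      by (simp add: inner_vec_def matrix_vector_mult_def second_moment_matrix_def sum_distrib_left algebra_simps)
    also have "\<dots> = (\<integral>z. (\<Sum>i\<in>UNIV. \<Sum>j\<in>UNIV. x $ i * x $ j * (u z $ i * u z $ j)) \<partial>P)"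
      by (simp add: int)
    also have "\<dots> = (\<integral>z. (x \<bullet> u z)\<^sup>2 \<partial>P)"
      by (intro Bochner_Integration.integral_cong refl)
        (simp add: inner_vec_def power2_eq_square sum_product algebra_simps)
    also have "\<dots> \<ge> 0" by simp
    finally show ?thesis .
  qed
qed

lemma powr_neg_half: "n > 0 \<Longrightarrow> x / real n powr (- 1 / 2) = sqrt (real n) * x"
  by (simp add: powr_minus_divide powr_half_sqrt)

theorem theorem2:
  fixes MC :: "'c measure" and mu1 :: "'m1 measure" and mu2 :: "'m2 measure"
    and M :: "'w measure"
    and P :: "('c, 'm1, 'm2) law"
    and obs :: "nat \<Rightarrow> 'w \<Rightarrow> ('c, 'm1, 'm2) obs"
    and P' :: "param \<Rightarrow> nat \<Rightarrow> 'w \<Rightarrow> ('c, 'm1, 'm2) law"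
    and est :: "param \<Rightarrow> nat \<Rightarrow> 'w \<Rightarrow> real"
  assumes "sigma_finite_measure mu1" and "sigma_finite_measure mu2"
    and P: "P \<in> model MC mu1 mu2"
    and prob: "prob_space M"
    and indep: "prob_space.indep_vars M (\<lambda>_. obs_space MC mu1 mu2) obs UNIV"
    and ident: "\<And>i. distr M (obs_space MC mu1 mu2) (obs i) = joint P"
    and P'_model: "\<And>k n \<omega>. n > 0 \<Longrightarrow> \<omega> \<in> space M \<Longrightarrow> P' k n \<omega> \<in> model MC mu1 mu2"
    and P'_QC: "\<And>k n \<omega>. n > 0 \<Longrightarrow> \<omega> \<in> space M \<Longrightarrow>
      QC MC (P' k n \<omega>) = empirical_QC MC n (\<lambda>i. obs i \<omega>)"
    and estimator:
      "(\<forall>k n. n > 0 \<longrightarrow> (\<forall>\<omega>\<in>space M.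
          est k n \<omega> = one_step MC mu1 mu2 k (P' k n \<omega>) n (\<lambda>i. obs i \<omega>)))
       \<or> (\<forall>k. (\<forall>n>0. \<forall>\<omega>\<in>space M. est k n \<omega> = Psi MC mu1 mu2 k (P' k n \<omega>)) \<and>
              little_op M (\<lambda>n \<omega>. (\<Sum>i<n. EIF MC mu1 mu2 k (P' k n \<omega>) (obs i \<omega>)) / real n)
                (\<lambda>n. real n powr (- 1 / 2)))"
    and i: "\<And>k. pathwise_differentiable MC mu1 mu2 (Psi MC mu1 mu2 k) P (EIF MC mu1 mu2 k P)"
    and ii: "\<And>k. \<exists>F. donsker_class (joint P) F \<and>
      prob_tends_to_1 M
        (\<lambda>n \<omega>. (\<lambda>z. EIF MC mu1 mu2 k (P' k n \<omega>) z - EIF MC mu1 mu2 k P z) \<in> F)"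
    and iii: "\<And>k. little_op M
      (\<lambda>n \<omega>. \<integral>z. (EIF MC mu1 mu2 k (P' k n \<omega>) z - EIF MC mu1 mu2 k P z)\<^sup>2 \<partial>joint P) (\<lambda>n. 1)"
    and iv: "\<And>k. little_op M (\<lambda>n \<omega>. remainder MC mu1 mu2 k P (P' k n \<omega>)) (\<lambda>n. real n powr (- 1 / 2))"
  shows "\<exists>N. is_normal 0
      (second_moment_matrix (joint P) (\<lambda>z. effect_vec (\<lambda>k. EIF MC mu1 mu2 k P z))) N \<and>
    weakly_converges euclidean M
      (\<lambda>n \<omega>. sqrt (real n) *\<^sub>R (effect_vec (\<lambda>k. est k n \<omega>) - effect_vec (\<lambda>k. Psi MC mu1 mu2 k P))) N"
proof -
  interpret M: prob_space M by (rule prob)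
  interpret P: observed_law MC mu1 mu2 P by (rule observed_law.intro[OF assms(1,2) P])
  let ?J = "joint P"
  define D where "D k = EIF MC mu1 mu2 k P" for k
  define Dh where "Dh k n \<omega> = EIF MC mu1 mu2 k (P' k n \<omega>)" for k n \<omega>
  define fhat where "fhat k n \<omega> = (\<lambda>z. Dh k n \<omega> z - D k z)" for k n \<omega>
  define \<psi> where "\<psi> k = Psi MC mu1 mu2 k P" for k
  define G where "G n \<omega> = empirical_process ?J n (\<lambda>i. obs i \<omega>)" for n \<omega>
  define u where "u z = effect_vec (\<lambda>k. D k z)" for z
  have sets_J: "sets ?J = sets (obs_space MC mu1 mu2)" by (rule P.sets_J)
  \<comment> \<open>\<open>obs_space\<close> and \<open>joint P\<close> have the same measurable
    sets; the results on empirical processes expect the latter as target.\<close>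
  have indep_J: "M.indep_vars (\<lambda>_. ?J) obs UNIV"
    using M.indep_vars_compose2[OF indep, of "\<lambda>_ x. x" "\<lambda>_. ?J"] measurable_ident_sets[OF sets_J[symmetric]]
    by simp
  have ident_J: "distr M ?J (obs i) = ?J" for i
    using ident[of i] by (subst distr_cong[OF refl sets_J refl]) simp
  have obs [measurable]: "obs i \<in> measurable M ?J" for i
    using indep_J unfolding M.indep_vars_def2 by simp
  have D_meas [measurable]: "D k \<in> borel_measurable ?J" and D_sq: "integrable ?J (\<lambda>z. (D k z)\<^sup>2)" for k
    using i[of k] by (simp_all add: pathwise_differentiable_def D_def)
  have D_int: "integrable ?J (D k)" and D_mean: "(\<integral>z. D k z \<partial>?J) = 0" for k
    using P.EIF_mean_zero[of k] by (simp_all add: P.mean_zero_def D_def)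

  \<comment> \<open>Scaled distance to the one-step estimator: for positive \<open>n\<close> it is 0
    for that estimator itself, and for the targeted one it is the mean estimated gradient times
    minus \<open>sqrt (real n)\<close>. One decomposition thus serves both kinds.\<close>
  define c where "c k n \<omega> = sqrt (real n) * (est k n \<omega>
    - one_step MC mu1 mu2 k (P' k n \<omega>) n (\<lambda>i. obs i \<omega>))" for k n \<omega>
  have c: "vanishing M (\<lambda>n. {\<omega>\<in>space M. \<bar>c k n \<omega>\<bar> > d})" if d: "d > 0" for k d
    using estimator
  proof
    assume os: "\<forall>k n. n > 0 \<longrightarrow> (\<forall>\<omega>\<in>space M. est k n \<omega> = one_step MC mu1 mu2 k (P' k n \<omega>) n (\<lambda>i. obs i \<omega>))"
    show ?thesis
      by (rule vanishing_mono[OF vanishing_empty eventually_mono[OF eventually_gt_at_top[of 0]]])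
        (use os d in \<open>auto simp: c_def\<close>)
  next
    assume tmle: "\<forall>k. (\<forall>n>0. \<forall>\<omega>\<in>space M. est k n \<omega> = Psi MC mu1 mu2 k (P' k n \<omega>)) \<and>
              little_op M (\<lambda>n \<omega>. (\<Sum>i<n. EIF MC mu1 mu2 k (P' k n \<omega>) (obs i \<omega>)) / real n)
                (\<lambda>n. real n powr (- 1 / 2))"
    then have "vanishing M (\<lambda>n. {\<omega>\<in>space M.
        \<bar>(\<Sum>i<n. EIF MC mu1 mu2 k (P' k n \<omega>) (obs i \<omega>)) / real n / real n powr (- 1 / 2)\<bar> > d})"
      using d by (simp add: little_op_def tends_to_0_in_prob_iff)
    then show ?thesis
    proof (rule vanishing_mono)
      show "\<forall>\<^sub>F n in sequentially. {\<omega>\<in>space M. \<bar>c k n \<omega>\<bar> > d} \<subseteq> {\<omega>\<in>space M.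
        \<bar>(\<Sum>i<n. EIF MC mu1 mu2 k (P' k n \<omega>) (obs i \<omega>)) / real n / real n powr (- 1 / 2)\<bar> > d}"
        using eventually_gt_at_top[of 0]
      proof eventually_elim
        case (elim n)
        then show ?case
          unfolding powr_neg_half[OF elim] using tmle by (auto simp: c_def one_step_def)
      qed
    qed
  qed
  have rem: "vanishing M (\<lambda>n. {\<omega>\<in>space M. \<bar>sqrt (real n) * remainder MC mu1 mu2 k P (P' k n \<omega>)\<bar> > d})"
    if d: "d > 0" for k d
  proof -
    have "vanishing M (\<lambda>n. {\<omega>\<in>space M. \<bar>remainder MC mu1 mu2 k P (P' k n \<omega>) / real n powr (- 1 / 2)\<bar> > d})"
      using iv[of k] d by (simp add: little_op_def tends_to_0_in_prob_iff)
    then show ?thesis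
    proof (rule vanishing_mono)
      show "\<forall>\<^sub>F n in sequentially.
          {\<omega>\<in>space M. \<bar>sqrt (real n) * remainder MC mu1 mu2 k P (P' k n \<omega>)\<bar> > d}
          \<subseteq> {\<omega>\<in>space M. \<bar>remainder MC mu1 mu2 k P (P' k n \<omega>) / real n powr (- 1 / 2)\<bar> > d}"
        using eventually_gt_at_top[of 0] by eventually_elim (simp only: powr_neg_half order_refl)
    qed
  qed
  have close: "vanishing M (\<lambda>n. {\<omega>\<in>space M. \<bar>sqrt (real n) * (est k n \<omega> - \<psi> k) - G n \<omega> (D k)\<bar> > d})"
    if d: "d > 0" for k d
  proof -
    obtain F where F: "donsker_class ?J F"
      and in_F: "vanishing M (\<lambda>n. {\<omega>\<in>space M. fhat k n \<omega> \<notin> F})"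
      using ii[of k] by (auto simp: prob_tends_to_1_def vanishing_def fhat_def Dh_def D_def)
    have L2: "vanishing M (\<lambda>n. {\<omega>\<in>space M. (\<integral>z. (fhat k n \<omega> z)\<^sup>2 \<partial>?J) > e})" if "e > 0" for e
    proof -
      have "vanishing M (\<lambda>n. {\<omega>\<in>space M. \<bar>\<integral>z. (fhat k n \<omega> z)\<^sup>2 \<partial>?J\<bar> > e})"
        using iii[of k] that by (simp add: little_op_def tends_to_0_in_prob_iff fhat_def Dh_def D_def)
      then show ?thesis by (rule vanishing_mono) auto
    qed
    have "d / 3 > 0" using d by simp
    have a: "vanishing M (\<lambda>n. {\<omega>\<in>space M. \<bar>G n \<omega> (fhat k n \<omega>)\<bar> > d / 3})"
      unfolding G_def
      by (rule M.donsker_asymptotic_equicontinuity[OF P.J.prob_space_axioms indep_J ident_J F in_F L2 \<open>d / 3 > 0\<close>])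
    \<comment> \<open>Membership in \<open>F\<close> gives integrability of \<open>fhat\<close>,
      hence of \<open>Dh\<close>; without it the integral in the remainder could be the default 0
      and would not split. Centering of \<open>D\<close> then turns that integral into the one of
      \<open>fhat\<close>, as the empirical process needs.\<close>
    have decomp: "sqrt (real n) * (est k n \<omega> - \<psi> k) - G n \<omega> (D k)
        = G n \<omega> (fhat k n \<omega>) + sqrt (real n) * remainder MC mu1 mu2 k P (P' k n \<omega>) + c k n \<omega>"
      if "fhat k n \<omega> \<in> F" for n \<omega>
    proof -
      have "fhat k n \<omega> \<in> borel_measurable ?J" "integrable ?J (\<lambda>z. (fhat k n \<omega> z)\<^sup>2)"
        using F that by (auto simp: donsker_class_def)
      then have "integrable ?J (fhat k n \<omega>)" by (rule P.J.square_integrable_imp_integrable)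
      then have "(\<integral>z. fhat k n \<omega> z + D k z \<partial>?J) = (\<integral>z. fhat k n \<omega> z \<partial>?J) + (\<integral>z. D k z \<partial>?J)"
        by (intro Bochner_Integration.integral_add D_int)
      then have "(\<integral>z. Dh k n \<omega> z \<partial>?J) = (\<integral>z. fhat k n \<omega> z \<partial>?J)"
        by (simp add: fhat_def D_mean)
      then have R: "remainder MC mu1 mu2 k P (P' k n \<omega>) = Psi MC mu1 mu2 k (P' k n \<omega>) - \<psi> k + (\<integral>z. fhat k n \<omega> z \<partial>?J)"
        by (simp add: remainder_def Dh_def \<psi>_def)
      have S: "(\<Sum>i<n. fhat k n \<omega> (obs i \<omega>)) = (\<Sum>i<n. Dh k n \<omega> (obs i \<omega>)) - (\<Sum>i<n. D k (obs i \<omega>))"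
        by (simp add: fhat_def sum_subtractf)
      have O: "one_step MC mu1 mu2 k (P' k n \<omega>) n (\<lambda>i. obs i \<omega>)
          = Psi MC mu1 mu2 k (P' k n \<omega>) + (\<Sum>i<n. Dh k n \<omega> (obs i \<omega>)) / real n"
        by (simp add: one_step_def Dh_def)
      show ?thesis
        unfolding G_def empirical_process_def c_def R S O D_mean by (simp add: diff_divide_distrib algebra_simps)
    qed
    have "vanishing M (\<lambda>n. {\<omega>\<in>space M. fhat k n \<omega> \<notin> F} \<union> ({\<omega>\<in>space M. \<bar>G n \<omega> (fhat k n \<omega>)\<bar> > d / 3} \<union>
        ({\<omega>\<in>space M. \<bar>sqrt (real n) * remainder MC mu1 mu2 k P (P' k n \<omega>)\<bar> > d / 3} \<union>
         {\<omega>\<in>space M. \<bar>c k n \<omega>\<bar> > d / 3})))"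
      by (intro M.vanishing_Un in_F a rem c \<open>d / 3 > 0\<close>)
    then show ?thesis
    proof (rule vanishing_mono, intro always_eventually allI subsetI)
      fix n \<omega>
      assume \<omega>: "\<omega> \<in> {\<omega>\<in>space M. \<bar>sqrt (real n) * (est k n \<omega> - \<psi> k) - G n \<omega> (D k)\<bar> > d}"
      show "\<omega> \<in> {\<omega>\<in>space M. fhat k n \<omega> \<notin> F} \<union> ({\<omega>\<in>space M. \<bar>G n \<omega> (fhat k n \<omega>)\<bar> > d / 3} \<union>
        ({\<omega>\<in>space M. \<bar>sqrt (real n) * remainder MC mu1 mu2 k P (P' k n \<omega>)\<bar> > d / 3} \<union>
         {\<omega>\<in>space M. \<bar>c k n \<omega>\<bar> > d / 3}))"
      proof (rule ccontr)
        assume "\<not> ?thesis"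
        with \<omega> have "fhat k n \<omega> \<in> F" "\<bar>G n \<omega> (fhat k n \<omega>)\<bar> \<le> d / 3" "\<bar>c k n \<omega>\<bar> \<le> d / 3"
          "\<bar>sqrt (real n) * remainder MC mu1 mu2 k P (P' k n \<omega>)\<bar> \<le> d / 3" by auto
        then show False using \<omega> decomp[of n \<omega>] by auto
      qed
    qed
  qed

  have u_meas: "u \<in> borel_measurable ?J"
    unfolding u_def by (rule effect_vec_measurable) measurable
  \<comment> \<open>The covariant component is a difference of the other influence functions and
    inherits centering and square integrability from them.\<close>
  have u_nth: "P.mean_zero (\<lambda>z. u z $ j) \<and> (\<lambda>z. u z $ j) \<in> borel_measurable ?J \<and> integrable ?J (\<lambda>z. (u z $ j)\<^sup>2)" for j
  proof -
    have mz: "P.mean_zero (D k)" for k unfolding D_def by (rule P.EIF_mean_zero)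
    have "\<forall>j. P.mean_zero (\<lambda>z. u z $ j) \<and> (\<lambda>z. u z $ j) \<in> borel_measurable ?J \<and> integrable ?J (\<lambda>z. (u z $ j)\<^sup>2)"
      unfolding forall_4 u_def effect_vec_nth
      by (intro conjI P.mean_zero_diff mz borel_measurable_diff D_meas integrable_square_diff D_sq)
    then show ?thesis by blast
  qed
  note [measurable] = u_nth[THEN conjunct2, THEN conjunct1]
  obtain L :: "real ^ 4 ^ 4" where L: "L ** transpose L = second_moment_matrix ?J u"
    using second_moment_matrix_factor[of u ?J] u_nth by blast
  have tr: "integrable M (\<lambda>\<omega>. g (obs i \<omega>)) \<longleftrightarrow> integrable ?J g" "M.expectation (\<lambda>\<omega>. g (obs i \<omega>)) = (\<integral>z. g z \<partial>?J)"
    if "g \<in> borel_measurable ?J" for g :: "_ \<Rightarrow> real" and i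
    using integrable_distr_eq[OF obs that, of i] integral_distr[OF obs that, of i] by (simp_all add: ident_J)
  have "weakly_converges euclidean M
      (\<lambda>n \<omega>. sqrt (real n) *\<^sub>R (effect_vec (\<lambda>k. est k n \<omega>) - effect_vec \<psi>))
      (distr std_normal_vec borel (\<lambda>z. 0 + L *v z))"
  proof (rule M.clt_vec[where X = "\<lambda>i \<omega>. u (obs i \<omega>)"])
    show "M.indep_vars (\<lambda>_. borel) (\<lambda>i \<omega>. u (obs i \<omega>)) UNIV"
      by (rule M.indep_vars_compose2[OF indep_J u_meas])
    show "distr M borel (\<lambda>\<omega>. u (obs i \<omega>)) = distr ?J borel u" for i
      using distr_distr[OF u_meas obs[of i]] by (simp add: ident_J comp_def)
    show "M.expectation (\<lambda>\<omega>. u (obs i \<omega>) $ j) = 0" for i j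
      using tr(2)[of "\<lambda>z. u z $ j" i] u_nth[of j] by (simp add: P.mean_zero_def)
    show "integrable M (\<lambda>\<omega>. (u (obs i \<omega>) $ j)\<^sup>2)" for i j
      using tr(1)[of "\<lambda>z. (u z $ j)\<^sup>2" i] u_nth[of j] by simp
    show "(L ** transpose L) $ j $ k = M.expectation (\<lambda>\<omega>. u (obs i \<omega>) $ j * u (obs i \<omega>) $ k)" for i j k
      unfolding L using tr(2)[of "\<lambda>z. u z $ j * u z $ k" i] by (simp add: second_moment_matrix_def)
    show "vanishing M (\<lambda>n. {\<omega>\<in>space M. norm (sqrt (real n) *\<^sub>R (effect_vec (\<lambda>k. est k n \<omega>) - effect_vec \<psi>)
        - (1 / sqrt (real n)) *\<^sub>R (\<Sum>i<n. u (obs i \<omega>))) > d})" if d: "d > 0" for d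
    proof -
      \<comment> \<open>The divisor is the constant of \<open>norm_effect_vec_le\<close>: a vector
        of norm above \<open>d\<close> forces one of the four scalar errors above
        \<open>d / 7\<close>.\<close>
      let ?A = "\<lambda>k n. {\<omega>\<in>space M. \<bar>sqrt (real n) * (est k n \<omega> - \<psi> k) - G n \<omega> (D k)\<bar> > d / 7}"
      have "vanishing M (\<lambda>n. \<Union>k\<in>UNIV. ?A k n)"
        using d by (intro M.vanishing_UN finite_param close) simp
      then show ?thesis
      proof (rule vanishing_mono)
        show "\<forall>\<^sub>F n in sequentially. {\<omega>\<in>space M. norm (sqrt (real n) *\<^sub>R (effect_vec (\<lambda>k. est k n \<omega>) - effect_vec \<psi>)
          - (1 / sqrt (real n)) *\<^sub>R (\<Sum>i<n. u (obs i \<omega>))) > d} \<subseteq> (\<Union>k\<in>UNIV. ?A k n)"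
          using eventually_gt_at_top[of 0]
        proof (eventually_elim, intro subsetI)
          fix n :: nat and \<omega>
          assume n: "n > 0" and \<omega>: "\<omega> \<in> {\<omega>\<in>space M. norm (sqrt (real n) *\<^sub>R (effect_vec (\<lambda>k. est k n \<omega>) - effect_vec \<psi>)
            - (1 / sqrt (real n)) *\<^sub>R (\<Sum>i<n. u (obs i \<omega>))) > d}"
          \<comment> \<open>By linearity of \<open>effect_vec\<close> the vector error is assembled
            from the scalar ones. As \<open>D k\<close> has mean zero, its empirical process is the
            normalized sum without a centering term.\<close>
          have "sqrt (real n) *\<^sub>R (effect_vec (\<lambda>k. est k n \<omega>) - effect_vec \<psi>)
              - (1 / sqrt (real n)) *\<^sub>R (\<Sum>i<n. u (obs i \<omega>))
            = effect_vec (\<lambda>k. sqrt (real n) * (est k n \<omega> - \<psi> k) - G n \<omega> (D k))"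
            unfolding G_def empirical_process_eq_sum[OF n] D_mean diff_zero effect_vec_linear u_def ..
          with \<omega> have "\<not> (\<forall>k. \<bar>sqrt (real n) * (est k n \<omega> - \<psi> k) - G n \<omega> (D k)\<bar> \<le> d / 7)"
            using norm_effect_vec_le[of "\<lambda>k. sqrt (real n) * (est k n \<omega> - \<psi> k) - G n \<omega> (D k)" "d / 7"] by auto
          with \<omega> show "\<omega> \<in> (\<Union>k\<in>UNIV. ?A k n)" by (auto simp: not_le)
        qed
      qed
    qed
  qed
  with L show ?thesis
    unfolding is_normal_def u_def D_def \<psi>_def by blast
qed

end
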